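(* Consider a networked Euler–Lagrange system of $N$ agents with communication digraph $\mathcal{G}=\{\mathcal{V},\mathcal{E}\}$, where each agent is modeled by $M_i(q_i)\ddot q_i+C_i(q_i,\dot q_i)\dot q_i+g_i(q_i)=\tau_i$ with $q_i,\tau_i\in\mathbb{R}^n$ (satisfying the Euler–Lagrange properties listed in the context). Let $f\in\mathbb{N}$ (non-negative integers), and suppose that the system is under an $f$-local Byzantine attack, with set of Byzantine agents $\mathcal{F}$ and set of normal agents $\mathcal{H}=\mathcal{V}\setminus\mathcal{F}$. Suppose that each agent obtains the initial state of all its in-neighbors and that $\mathcal{G}$ is $(2f+1)$-robust. Suppose that every normal agent $i$ runs the resilient consensus algorithm described in the context (observer, event-triggered scheme, dynamic control law and auxiliary-variable-based resilient decision (AVBRD) algorithm), with auxiliary variable $\mathcal{W}_i(t)=e^{-St}\eta_i(t)$ and constant gains $\mu_1>0$, $\alpha_1>0$, $\alpha_2>1$, $\alpha_3>1$, $\mu_2>0$, $k_i>0$, $F_i>0$ and $k_i\mu_2>\tfrac12$. Then the event-triggered resilient consensus problem under $f$-local Byzantine attacks is solved, that is: (1) for all $i,j\in\mathcal{H}$, $\lim_{t\to\infty}(q_j(t)-q_i(t))=\mathbf{0}_n$ and $\lim_{t\to\infty}(\dot q_j(t)-\dot q_i(t))=\mathbf{0}_n$; (2) for every $i\in\mathcal{H}$, $q_i(t)$ and $\dot q_i(t)$ remain bounded for any $t$; (3) Zeno behavior is eliminated, i.e., the triggering instants of the normal agents do not accumulate in finite time.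
   Context: **Graph.** $\mathcal{G}=\{\mathcal{V},\mathcal{E}\}$ is a digraph with $N$ vertices (agents). $(v_i,v_j)\in\mathcal{E}$ means that agent $i$ can receive information transmitted by agent $j$, and $\mathcal{N}_i=\{j\mid (v_i,v_j)\in\mathcal{E}\}$ is the in-neighbor set of $i$; if $j\in\mathcal N_i$, then $i$ is an out-neighbor of $j$. A nonempty $S_0\subset\mathcal{V}$ is $r$-reachable if some $i\in S_0$ has $|\mathcal{N}_i\setminus S_0|\ge r$. $\mathcal{G}$ is $r$-robust if for every pair of nonempty disjoint subsets $S_1,S_2\subset\mathcal{V}$, at least one of them is $r$-reachable. **Euler–Lagrange properties.** $M_i(q_i)\in\mathbb{R}^{n\times n}$ is bounded, symmetric and positive definite. For every $p\in\mathbb{R}^n$, $p^T(\dot M_i(q_i)-2C_i(q_i,\dot q_i))p=0$. There are a vector $\varphi_i\in\mathbb{R}^l$ of unknown system parameters and a known regression matrix $\Omega_i(q_i,\dot q_i,x,y)\in\mathbb{R}^{n\times l}$ such that for all measurable $x,y\in\mathbb{R}^n$, $M_i(q_i)x+C_i(q_i,\dot q_i)y+g_i(q_i)=\Omega_i(q_i,\dot q_i,x,y)\varphi_i$. **Attack model.** Agents in $\mathcal{F}\subset\mathcal{V}$ (Byzantine) do not follow the algorithm. They are omniscient and may collude. They may arbitrarily update their own states and the information transmitted to each of their out-neighbors; this information may be discontinuous, and they may arbitrarily sever connections with their out-neighbors. The attack is $f$-local if $|\mathcal{N}_i\cap\mathcal{F}|\le f$ for every normal agent $i\in\mathcal{H}=\mathcal{V}\setminus\mathcal{F}$.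 **Algorithm run by normal agent $i$, from the initial instant $t_0$.** $S\in\mathbb{R}^{n\times n}$ is a common semi-simple matrix whose eigenvalues all have zero real parts. *Observer:* $\dot\eta_i(t)=S\eta_i(t)-\mu_1(\hat\eta_i(t)-\bar\eta_i(t))$, $\eta_i\in\mathbb{R}^n$. Here $\hat\eta_i(t)=e^{S(t-t_k^i)}\eta_i(t_k^i)$, where $t_k^i$ is the latest triggering instant of $i$ (the initial instant $t_0$ before any triggering), and $\bar\eta_i(t)=e^{St}\bar{\mathcal{W}}_i(t)$, with $\bar{\mathcal{W}}_i$ defined below. Set $\mathcal{W}_i(t)=e^{-St}\eta_i(t)$ and $\hat{\mathcal{W}}_i(t)=e^{-St}\hat\eta_i(t)=\mathcal{W}_i(t_k^i)$. *Triggering:* $t_{k+1}^i=\inf\{t>t_k^i \mid \|e_{\eta i}(t)\|-\frac{\alpha_1}{(t-t_0+\alpha_2)^{\alpha_3}}\ge 0\}$, where $e_{\eta i}(t)=\hat\eta_i(t)-\eta_i(t)$. At each triggering instant agent $i$ transmits its observer state and the triggering instant to all its out-neighbors. *Storage:* agent $i$ stores for each in-neighbor $j$ the transmitted observer state and triggering instant $(\eta_j(t_m^j),t_m^j)$, starting from the initial states of all its in-neighbors. Agent $i$ checks whether any of its in-neighbors have transmitted their state information to it; if so, it updates the storage for those in-neighbors that have a time interval since their last transmission. From the stored data agent $i$ forms the open-loop estimates $\hat\eta_j(t)=e^{S(t-t_m^j)}\eta_j(t_m^j)$, where $t_m^j$ is the latest triggering instant of $j$ before $t$, and $\hat{\mathcal{W}}_j(t)=e^{-St}\hat\eta_j(t)$.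 *AVBRD algorithm* (executed when the storage is updated): for each coordinate $l=1,\dots,n$ separately, agent $i$ sorts the $|\mathcal{N}_i|$ scalars $\hat{\mathcal{W}}_j^l(t)$, $j\in\mathcal{N}_i$ (the $l$-th coordinates), and the $l$-th coordinate $\bar{\mathcal{W}}_i^l(t)$ of $\bar{\mathcal{W}}_i(t)$ is the mean of the $(f+1)$-th and the $(|\mathcal{N}_i|-f)$-th entries of the sorted list. *Control law:* $\tau_i=-k_is_i+\Omega_i(q_i,\dot q_i,\dot v_i,v_i)\hat\varphi_i$, with $v_i=S\eta_i-\mu_2(q_i-\eta_i)$, $s_i=\dot q_i-v_i$, and $\dot{\hat\varphi}_i=-F_i\Omega_i^Ts_i$, where $k_i,\mu_2,F_i$ are constants and $\hat\varphi_i$ is the estimate of $\varphi_i$.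
   Formalization: The regression matrix Ω_i is assumed jointly continuous and M_i differentiable; without regularity of Ω_i velocity consensus can fail. An agent with at most f in-neighbors, for which the AVBRD entries do not exist, uses its own estimate. *)

theory Defs
  imports "HOL-Analysis.Analysis" "HOL-Library.Multiset"
begin

section \<open>Digraphs, robustness and the attack model\<close>

text \<open>An edge (i, j) means that agent i receives information from agent j.\<close>

definition in_nbrs :: "('v \<times> 'v) set \<Rightarrow> 'v \<Rightarrow> 'v set" where
  "in_nbrs E i = {j. (i, j) \<in> E}"

definition r_reachable :: "('v \<times> 'v) set \<Rightarrow> nat \<Rightarrow> 'v set \<Rightarrow> bool" where
  "r_reachable E r A \<longleftrightarrow> (\<exists>i\<in>A. card (in_nbrs E i - A) \<ge> r)"

definition r_robust :: "('v::finite \<times> 'v) set \<Rightarrow> nat \<Rightarrow> bool" where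
  "r_robust E r \<longleftrightarrow>
     (\<forall>S1 S2. S1 \<noteq> {} \<and> S2 \<noteq> {} \<and> S1 \<inter> S2 = {} \<longrightarrow> r_reachable E r S1 \<or> r_reachable E r S2)"

definition f_local :: "('v::finite \<times> 'v) set \<Rightarrow> nat \<Rightarrow> 'v set \<Rightarrow> bool" where
  "f_local E f Byz \<longleftrightarrow> (\<forall>i. i \<notin> Byz \<longrightarrow> card (in_nbrs E i \<inter> Byz) \<le> f)"


section \<open>Matrices\<close>

definition complexify :: "real^'n^'n \<Rightarrow> complex^'n^'n" where
  "complexify A = map_matrix complex_of_real A"

definition semisimple_matrix :: "real^'n^'n \<Rightarrow> bool" where
  "semisimple_matrix A \<longleftrightarrow>
     (\<exists>(P :: complex^'n^'n) D. invertible P \<and> (\<forall>i j. i \<noteq> j \<longrightarrow> D $ i $ j = 0) \<and>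
        complexify A = P ** D ** matrix_inv P)"

definition complex_eigenvalue :: "real^'n^'n \<Rightarrow> complex \<Rightarrow> bool" where
  "complex_eigenvalue A z \<longleftrightarrow> (\<exists>x. x \<noteq> 0 \<and> complexify A *v x = z *s x)"

definition mat_exp :: "real^'n^'n \<Rightarrow> real^'n^'n" where
  "mat_exp A = (\<Sum>k. (1 / fact k) *\<^sub>R (((**) A) ^^ k) (mat 1))"

definition pos_def :: "real^'n^'n \<Rightarrow> bool" where
  "pos_def A \<longleftrightarrow> (\<forall>x. x \<noteq> 0 \<longrightarrow> x \<bullet> (A *v x) > 0)"


section \<open>Euler--Lagrange agents\<close>

text \<open>
  Along a motion, the time derivative of the inertia matrix is the Frechet derivative of \<open>M\<close>
  at the position, applied to the velocity; hence \<open>M\<close> is differentiable. Continuity of the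
  regressor \<open>\<Omega>\<close> is the only other regularity that is imposed: by the regression identity
  it entails continuity of \<open>M\<close>, \<open>C\<close> and \<open>g\<close>.
\<close>

definition euler_lagrange ::
  "(real^'n \<Rightarrow> real^'n^'n) \<Rightarrow> (real^'n \<Rightarrow> real^'n \<Rightarrow> real^'n^'n) \<Rightarrow> (real^'n \<Rightarrow> real^'n) \<Rightarrow>
   (real^'n \<Rightarrow> real^'n \<Rightarrow> real^'n \<Rightarrow> real^'n \<Rightarrow> real^'l^'n) \<Rightarrow> bool" where
  "euler_lagrange M C g \<Omega> \<longleftrightarrow>
     bounded (range M) \<and>
     (\<forall>x. transpose (M x) = M x \<and> pos_def (M x)) \<and>
     (\<forall>x. M differentiable (at x)) \<and>
     (\<forall>x dx p. p \<bullet> ((frechet_derivative M (at x) dx - 2 *\<^sub>R C x dx) *v p) = 0) \<and>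
     continuous_on UNIV (\<lambda>(x, dx, y, z). \<Omega> x dx y z) \<and>
     (\<exists>\<phi>. \<forall>x dx y z. M x *v y + C x dx *v z + g x = \<Omega> x dx y z *v \<phi>)"


section \<open>Trajectories\<close>

text \<open>
  Right-hand sides jump (triggering instants, Byzantine data), so solutions are understood in
  the sense of Caratheodory: \<open>x\<close> is an indefinite integral of \<open>dx\<close>.
  The horizon \<open>T\<close> may be finite or infinite.
\<close>

definition horizon :: "real \<Rightarrow> ereal \<Rightarrow> real set" where
  "horizon t0 T = {t. t0 \<le> t \<and> ereal t < T}"

definition caratheodory_deriv ::
  "real \<Rightarrow> ereal \<Rightarrow> (real \<Rightarrow> 'a::euclidean_space) \<Rightarrow> (real \<Rightarrow> 'a) \<Rightarrow> bool" where
  "caratheodory_deriv t0 T x dx \<longleftrightarrow>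
     (\<forall>t\<in>horizon t0 T. (dx has_integral (x t - x t0)) {t0..t})"


section \<open>Event-triggered scheme\<close>

definition threshold :: "real \<Rightarrow> real \<Rightarrow> real \<Rightarrow> real \<Rightarrow> real \<Rightarrow> real" where
  "threshold \<alpha>\<^sub>1 \<alpha>\<^sub>2 \<alpha>\<^sub>3 t0 t = \<alpha>\<^sub>1 / (t - t0 + \<alpha>\<^sub>2) powr \<alpha>\<^sub>3"

definition open_loop :: "real^'n^'n \<Rightarrow> (real^'n) \<times> real \<Rightarrow> real \<Rightarrow> real^'n" where
  "open_loop S d t = mat_exp ((t - snd d) *\<^sub>R S) *v fst d"

text \<open>
  Triggering instants of a trajectory \<open>x\<close> that lives on \<open>horizon t0 T\<close>, with threshold \<open>\<theta>\<close>.
  The value \<open>\<infinity>\<close>, the infimum of the empty set, means that no further triggering occurs.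
\<close>

primrec trigger ::
  "real^'n^'n \<Rightarrow> (real \<Rightarrow> real) \<Rightarrow> real \<Rightarrow> ereal \<Rightarrow> (real \<Rightarrow> real^'n) \<Rightarrow> nat \<Rightarrow> ereal" where
  "trigger S \<theta> t0 T x 0 = ereal t0"
| "trigger S \<theta> t0 T x (Suc k) =
     (let u = trigger S \<theta> t0 T x k; r = real_of_ereal u in
      Inf (ereal ` {t. u < ereal t \<and> ereal t < T \<and>
                       norm (open_loop S (x r, r) t - x t) - \<theta> t \<ge> 0}))"

text \<open>
  The latest triggering instant up to time \<open>t\<close>. It is a supremum rather than a maximum so that
  it still denotes something if the instants accumulate: absence of Zeno behavior must not be
  built into the notion of trajectory.
\<close>

definition last_trigger ::
  "real^'n^'n \<Rightarrow> (real \<Rightarrow> real) \<Rightarrow> real \<Rightarrow> ereal \<Rightarrow> (real \<Rightarrow> real^'n) \<Rightarrow> real \<Rightarrow> real" where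
  "last_trigger S \<theta> t0 T x t =
     real_of_ereal (Sup {u. u \<in> range (trigger S \<theta> t0 T x) \<and> u \<le> ereal t})"


section \<open>The AVBRD algorithm\<close>

text \<open>
  Lists are indexed from 0. The mean is meaningful only for more than \<open>f\<close> entries.
\<close>

definition trimmed_mid :: "nat \<Rightarrow> real multiset \<Rightarrow> real" where
  "trimmed_mid f A =
     (let xs = sorted_list_of_multiset A in (xs ! f + xs ! (length xs - f - 1)) / 2)"

text \<open>
  \<open>own\<close> is the agent's own estimate and \<open>w j\<close> the one of in-neighbor \<open>j\<close>, both in the auxiliary
  variable. An agent with at most \<open>f\<close> in-neighbors has no \<open>(f+1)\<close>-th entry to select; it uses
  \<open>own\<close>, which switches the correction term of its observer off. In a \<open>(2f+1)\<close>-robust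
  digraph this can only happen to the root for \<open>f = 0\<close>, or for a single vertex.
\<close>

definition avbrd :: "nat \<Rightarrow> 'v set \<Rightarrow> real^'n \<Rightarrow> ('v \<Rightarrow> real^'n) \<Rightarrow> real^'n" where
  "avbrd f A own w =
     (if card A \<le> f then own
      else (\<chi> l. trimmed_mid f (image_mset (\<lambda>j. w j $ l) (mset_set A))))"

end

theory Submission
  imports Defs
begin

text \<open>
  In the auxiliary variable \<open>e\<^sup>-\<^sup>S\<^sup>t \<eta>\<close> the open-loop estimates are constant between triggerings, and
  \<open>e\<^sup>S\<^sup>t\<close> is bounded because \<open>S\<close> is semisimple with imaginary spectrum. The threshold therefore turns
  each coordinate of the observers into a consensus protocol with a disturbance that is integrable
  in time since \<open>\<alpha>\<^sub>3 > 1\<close>. The selected values lie between those of normal agents, so up to the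
  integral of the disturbance the largest normal value does not increase and the smallest one does
  not decrease; this bounds the speed of all observers, which excludes Zeno behavior also at the
  end of a finite horizon. If the limits of the maximum and of the minimum differed, robustness
  would provide in every unit of time an agent near one of the two extremes with more than \<open>f\<close>
  normal in-neighbors away from that extreme, and this agent would be pulled off it; after
  finitely many steps nobody is left near one of the extremes. For the plant, the classical
  adaptive Lyapunov function shows that \<open>s\<close> is square integrable, then \<open>q - \<eta>\<close> and hence all signals
  are bounded, so that \<open>s\<close> is Lipschitz and tends to zero, and \<open>q - \<eta>\<close> with it.
\<close>

section \<open>Primitives of bounded integrable functions\<close>

text \<open>Solutions are only indefinite integrals of discontinuous functions, and gauge
  integrability alone gives neither Lipschitz bounds nor a product rule. Every signal is therefore
  treated as the integral of a bounded function; on compact intervals this boundedness is extracted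
  from the equations themselves. The main obstacle is a circularity. The error is known to stay
  below the threshold only if the latest triggering instant is a genuine instant, so accumulation
  has to be excluded first; excluding it needs a bound on the observer speed; and a bound that is
  uniform up to the end of the horizon comes from the consensus argument, which uses the error
  bound. The circle is broken on \<open>{t0..b}\<close>: there every held value is an earlier value
  of a continuous function, whether or not instants accumulate, which gives a crude speed bound
  depending on \<open>b\<close>. The resulting error bound no longer depends on \<open>b\<close>, so
  it feeds the consensus argument on the whole horizon. All consensus estimates are one-sided; those
  for the minimum are obtained by negating the signals.\<close>

definition bounded_primitive ::
  "real \<Rightarrow> real \<Rightarrow> (real \<Rightarrow> 'a::euclidean_space) \<Rightarrow> (real \<Rightarrow> 'a) \<Rightarrow> bool" where
  "bounded_primitive a b x dx \<longleftrightarrow>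
     bounded (dx ` {a..b}) \<and> (\<forall>t\<in>{a..b}. (dx has_integral (x t - x a)) {a..t})"

lemma primitive_subinterval_integral:
  fixes x :: "real \<Rightarrow> 'a::euclidean_space"
  assumes "\<And>t. t \<in> {a..b} \<Longrightarrow> (dx has_integral (x t - x a)) {a..t}"
    and "a \<le> s" "s \<le> t" "t \<le> b"
  shows "(dx has_integral (x t - x s)) {s..t}"
proof -
  have t: "(dx has_integral (x t - x a)) {a..t}" and s: "(dx has_integral (x s - x a)) {a..s}"
    using assms by auto
  have "dx integrable_on {s..t}"
    using integrable_subinterval_real[OF has_integral_integrable[OF t], of s t] assms by auto
  then obtain j where j: "(dx has_integral j) {s..t}" by blast
  have "(dx has_integral ((x s - x a) + j)) {a..t}"
    using assms s j by (intro has_integral_combine[of a s t]) auto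
  with t have "(x s - x a) + j = x t - x a"
    using has_integral_unique by blast
  then have "j = x t - x s" by (simp add: algebra_simps)
  then show ?thesis using j by simp
qed

lemma bounded_primitive_integral:
  assumes "bounded_primitive a b x dx" "a \<le> s" "s \<le> t" "t \<le> b"
  shows "(dx has_integral (x t - x s)) {s..t}"
  using assms primitive_subinterval_integral[of a b dx x s t]
  by (auto simp: bounded_primitive_def)

lemma bounded_primitive_subinterval:
  assumes "bounded_primitive a b x dx" "a \<le> c" "d \<le> b"
  shows "bounded_primitive c d x dx"
proof -
  have "bounded (dx ` {c..d})"
    using assms by (auto simp: bounded_primitive_def intro: bounded_subset)
  then show ?thesis
    using assms bounded_primitive_integral[OF assms(1)] by (auto simp: bounded_primitive_def)
qed

lemma bounded_primitive_norm_diff_le: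
  assumes bp: "bounded_primitive a b x dx" and st: "a \<le> s" "s \<le> t" "t \<le> b"
    and L: "\<And>u. u \<in> {s..t} \<Longrightarrow> norm (dx u) \<le> L"
  shows "norm (x t - x s) \<le> L * (t - s)"
proof -
  have "0 \<le> L" using L[of s] st norm_ge_zero[of "dx s"] by (simp del: norm_ge_zero)
  then show ?thesis
    using has_integral_bound[of L dx "x t - x s" s t] bounded_primitive_integral[OF bp st] L st
    by (auto simp: cbox_interval)
qed

lemma bounded_primitive_lipschitz:
  assumes bp: "bounded_primitive a b x dx"
  obtains L where "L \<ge> 0" "\<And>t. t \<in> {a..b} \<Longrightarrow> norm (dx t) \<le> L"
    "\<And>s t. s \<in> {a..b} \<Longrightarrow> t \<in> {a..b} \<Longrightarrow> norm (x t - x s) \<le> L * \<bar>t - s\<bar>"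
proof -
  obtain L where L: "L > 0" "\<And>t. t \<in> {a..b} \<Longrightarrow> norm (dx t) \<le> L"
    using bp unfolding bounded_primitive_def bounded_pos by auto
  have "norm (x t - x s) \<le> L * \<bar>t - s\<bar>" if "s \<in> {a..b}" "t \<in> {a..b}" for s t
  proof (cases "s \<le> t")
    case True
    then show ?thesis
      using bounded_primitive_norm_diff_le[OF bp, of s t L] L that by auto
  next
    case False
    then show ?thesis
      using bounded_primitive_norm_diff_le[OF bp, of t s L] L that
      by (auto simp: norm_minus_commute)
  qed
  with L show ?thesis by (intro that[of L]) auto
qed

lemma primitive_continuous_on:
  fixes x :: "real \<Rightarrow> 'a::euclidean_space"
  assumes "\<And>t. t \<in> {a..b} \<Longrightarrow> (dx has_integral (x t - x a)) {a..t}"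
  shows "continuous_on {a..b} x"
proof (cases "a \<le> b")
  case True
  then have "dx integrable_on {a..b}" using assms[of b] by auto
  then have "continuous_on {a..b} (\<lambda>t. x a + integral {a..t} dx)"
    by (intro continuous_intros indefinite_integral_continuous_1)
  moreover have "x a + integral {a..t} dx = x t" if "t \<in> {a..b}" for t
    using assms[OF that] by (simp add: integral_unique)
  ultimately show ?thesis by (rule continuous_on_eq)
qed auto

lemma bounded_primitive_continuous_on:
  "bounded_primitive a b x dx \<Longrightarrow> continuous_on {a..b} x"
  by (rule primitive_continuous_on) (auto simp: bounded_primitive_def)

lemma bounded_primitive_cong:
  assumes "bounded_primitive a b x dx"
    and "\<And>t. t \<in> {a..b} \<Longrightarrow> x' t = x t" "\<And>t. t \<in> {a..b} \<Longrightarrow> dx' t = dx t"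
  shows "bounded_primitive a b x' dx'"
proof -
  have "(dx' has_integral (x' t - x' a)) {a..t}" if "t \<in> {a..b}" for t
  proof -
    have "(dx has_integral (x t - x a)) {a..t}"
      using assms(1) that by (auto simp: bounded_primitive_def)
    then have "(dx' has_integral (x t - x a)) {a..t}"
      by (rule has_integral_eq[rotated]) (use assms(3) that in auto)
    then show ?thesis using assms(2) that by auto
  qed
  moreover have "dx' ` {a..b} = dx ` {a..b}" using assms(3) by auto
  ultimately show ?thesis using assms(1) by (auto simp: bounded_primitive_def)
qed

lemma bounded_primitive_linear:
  fixes h :: "'a::euclidean_space \<Rightarrow> 'b::euclidean_space"
  assumes "bounded_primitive a b x dx" and h: "bounded_linear h"
  shows "bounded_primitive a b (\<lambda>t. h (x t)) (\<lambda>t. h (dx t))"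
proof -
  interpret h: bounded_linear h by fact
  have "bounded (h ` dx ` {a..b})"
    using assms by (auto simp: bounded_primitive_def intro: bounded_linear_image)
  moreover have "((\<lambda>t. h (dx t)) has_integral (h (x t) - h (x a))) {a..t}" if "t \<in> {a..b}" for t
    using has_integral_linear[OF _ h, of dx "x t - x a" "{a..t}"] assms(1) that
    by (auto simp: bounded_primitive_def o_def h.diff)
  ultimately show ?thesis by (auto simp: bounded_primitive_def image_image)
qed

lemma bounded_primitive_add:
  assumes "bounded_primitive a b x dx" "bounded_primitive a b y dy"
  shows "bounded_primitive a b (\<lambda>t. x t + y t) (\<lambda>t. dx t + dy t)"
proof -
  have "((\<lambda>t. dx t + dy t) has_integral (x t + y t - (x a + y a))) {a..t}" if "t \<in> {a..b}" for t
    using has_integral_add[of dx "x t - x a" "{a..t}" dy "y t - y a"] assms that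
    by (auto simp: bounded_primitive_def algebra_simps)
  then show ?thesis using assms by (auto simp: bounded_primitive_def intro: bounded_plus_comp)
qed

lemma bounded_primitive_diff:
  assumes "bounded_primitive a b x dx" "bounded_primitive a b y dy"
  shows "bounded_primitive a b (\<lambda>t. x t - y t) (\<lambda>t. dx t - dy t)"
  using bounded_primitive_add[OF assms(1) bounded_primitive_linear[OF assms(2) bounded_linear_minus[OF bounded_linear_ident]]]
  by simp

lemma bounded_primitive_const: "bounded_primitive a b (\<lambda>t. c) (\<lambda>t. 0)"
  by (auto simp: bounded_primitive_def image_constant_conv)

lemma bounded_primitive_vector_derivative:
  assumes "\<And>t. t \<in> {a..b} \<Longrightarrow> (x has_vector_derivative dx t) (at t within {a..b})"
    and "bounded (dx ` {a..b})"
  shows "bounded_primitive a b x dx"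
proof -
  have "(dx has_integral (x t - x a)) {a..t}" if "t \<in> {a..b}" for t
    using that assms(1)
    by (intro fundamental_theorem_of_calculus)
      (auto intro: has_vector_derivative_within_subset[of x _ _ "{a..b}"])
  then show ?thesis using assms(2) by (auto simp: bounded_primitive_def)
qed

lemma bounded_bilinear_image:
  assumes "bounded_bilinear h" "bounded (f ` A)" "bounded (g ` A)"
  shows "bounded ((\<lambda>t. h (f t) (g t)) ` A)"
proof -
  interpret bounded_bilinear h by fact
  obtain K where K: "0 < K" "\<And>a b. norm (h a b) \<le> norm a * norm b * K" using pos_bounded by blast
  obtain a where a: "\<forall>t\<in>A. norm (f t) \<le> a" using assms(2) by (auto simp: bounded_iff)
  obtain b where b: "\<forall>t\<in>A. norm (g t) \<le> b" using assms(3) by (auto simp: bounded_iff)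
  have "norm (h (f t) (g t)) \<le> \<bar>a\<bar> * \<bar>b\<bar> * K" if "t \<in> A" for t
    using a b that K(1)
    by (intro order_trans[OF K(2)] mult_right_mono mult_mono) (auto intro: order_trans[OF _ abs_ge_self])
  then show ?thesis by (auto simp: bounded_iff intro!: exI[of _ "\<bar>a\<bar> * \<bar>b\<bar> * K"])
qed

text \<open>Difference quotients are at most \<open>K * \<bar>t - s\<bar>\<close> in norm, so the
  derivative vanishes at every point and not merely almost everywhere.\<close>

lemma quadratic_modulus_imp_constant:
  fixes D :: "real \<Rightarrow> 'a::real_normed_vector"
  assumes K: "\<And>s t. s \<in> {a..b} \<Longrightarrow> t \<in> {a..b} \<Longrightarrow> norm (D t - D s) \<le> K * (t - s)\<^sup>2"
    and st: "s \<in> {a..b}" "t \<in> {a..b}"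
  shows "D t = D s"
proof -
  have "(D has_derivative (\<lambda>h. 0)) (at x within {a..b})" if x: "x \<in> {a..b}" for x
    unfolding has_derivative_within_alt
  proof (intro conjI allI impI)
    show "bounded_linear (\<lambda>h::real. 0::'a)" by (rule bounded_linear_zero)
    fix e :: real assume e: "e > 0"
    show "\<exists>d>0. \<forall>y\<in>{a..b}. norm (y - x) < d \<longrightarrow> norm (D y - D x - 0) \<le> e * norm (y - x)"
    \<comment> \<open>The summand 1 keeps the radius meaningful for \<open>K = 0\<close>.\<close>
    proof (intro exI[of _ "e / (\<bar>K\<bar> + 1)"] conjI ballI impI)
      show "e / (\<bar>K\<bar> + 1) > 0" using e by auto
      fix y assume y: "y \<in> {a..b}" and d: "norm (y - x) < e / (\<bar>K\<bar> + 1)"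
      have "norm (D y - D x) \<le> K * (y - x)\<^sup>2" using K x y by blast
      also have "\<dots> \<le> (\<bar>K\<bar> + 1) * (y - x)\<^sup>2" by (intro mult_right_mono) auto
      also have "\<dots> = ((\<bar>K\<bar> + 1) * \<bar>y - x\<bar>) * \<bar>y - x\<bar>"
        by (simp add: power2_eq_square flip: abs_mult)
      also have "\<dots> \<le> e * \<bar>y - x\<bar>"
        using d by (intro mult_right_mono) (auto simp: field_simps)
      finally show "norm (D y - D x - 0) \<le> e * norm (y - x)" by simp
    qed
  qed
  then obtain c where "\<forall>x\<in>{a..b}. D x = c"
    using has_derivative_zero_constant[of "{a..b}" D] by (auto simp: convex_real_interval)
  then show ?thesis using st by simp
qed

text \<open>
  No differentiability almost everywhere is needed: the difference of the two sides of the
  product rule changes by at most a constant times \<open>(t - s)\<^sup>2\<close> between \<open>s\<close> and \<open>t\<close>.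
\<close>

lemma bounded_primitive_bilinear:
  fixes h :: "'a::euclidean_space \<Rightarrow> 'b::euclidean_space \<Rightarrow> 'c::euclidean_space"
  assumes h: "bilinear h"
    and x: "bounded_primitive a b x dx" and y: "bounded_primitive a b y dy"
  shows "bounded_primitive a b (\<lambda>t. h (x t) (y t)) (\<lambda>t. h (dx t) (y t) + h (x t) (dy t))"
proof (cases "a \<le> b")
  case False
  then show ?thesis by (auto simp: bounded_primitive_def)
next
  case ab: True
  interpret h: bounded_bilinear h using h bilinear_conv_bounded_bilinear by blast
  obtain C where C: "C > 0" "\<And>u w. norm (h u w) \<le> norm u * norm w * C"
    using h.pos_bounded by blast
  obtain L where L: "L \<ge> 0" "\<And>t. t \<in> {a..b} \<Longrightarrow> norm (dx t) \<le> L"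
    "\<And>s t. s \<in> {a..b} \<Longrightarrow> t \<in> {a..b} \<Longrightarrow> norm (x t - x s) \<le> L * \<bar>t - s\<bar>"
    using bounded_primitive_lipschitz[OF x] by blast
  obtain N where N: "N \<ge> 0" "\<And>t. t \<in> {a..b} \<Longrightarrow> norm (dy t) \<le> N"
    "\<And>s t. s \<in> {a..b} \<Longrightarrow> t \<in> {a..b} \<Longrightarrow> norm (y t - y s) \<le> N * \<bar>t - s\<bar>"
    using bounded_primitive_lipschitz[OF y] by blast
  have cont: "continuous_on {a..b} x" "continuous_on {a..b} y"
    using x y bounded_primitive_continuous_on by auto
  then have bnd: "bounded (x ` {a..b})" "bounded (y ` {a..b})"
    by (auto intro: compact_imp_bounded compact_continuous_image)
  have int: "dx integrable_on {a..b}" "dy integrable_on {a..b}"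
    using x y ab by (auto simp: bounded_primitive_def)
  \<comment> \<open>Boundedness upgrades integrability to absolute integrability, which makes
    products with continuous factors integrable.\<close>
  have abs: "dx absolutely_integrable_on {a..b}" "dy absolutely_integrable_on {a..b}"
    using absolutely_integrable_integrable_bound[OF L(2) int(1)]
      absolutely_integrable_integrable_bound[OF N(2) int(2)] by auto
  have meas: "x \<in> borel_measurable (lebesgue_on {a..b})" "y \<in> borel_measurable (lebesgue_on {a..b})"
    using cont by (auto intro: continuous_imp_measurable_on_sets_lebesgue)
  define dz where "dz = (\<lambda>t. h (dx t) (y t) + h (x t) (dy t))"
  have flip: "bilinear (\<lambda>u w. h w u)" using h by (auto simp: bilinear_def)
  have "(\<lambda>t. h (dx t) (y t)) absolutely_integrable_on {a..b}"
    using absolutely_integrable_bounded_measurable_product[OF flip meas(2) _ bnd(2) abs(1)] by simp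
  moreover have "(\<lambda>t. h (x t) (dy t)) absolutely_integrable_on {a..b}"
    using absolutely_integrable_bounded_measurable_product[OF h meas(1) _ bnd(1) abs(2)] by simp
  ultimately have dz_int: "dz integrable_on {a..b}"
    unfolding dz_def by (intro integrable_add set_lebesgue_integral_eq_integral(1))
  \<comment> \<open>The discrepancy between the two sides of the integrated product rule; the goal
    is that it is constant.\<close>
  define D where "D t = h (x t) (y t) - integral {a..t} dz" for t
  have step: "norm (D t - D s) \<le> (3 * (L * N * C)) * (t - s)\<^sup>2" if "a \<le> s" "s \<le> t" "t \<le> b" for s t
  proof -
    have i1: "(dx has_integral (x t - x s)) {s..t}" and i2: "(dy has_integral (y t - y s)) {s..t}"
      using bounded_primitive_integral[OF x that] bounded_primitive_integral[OF y that] by auto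
    have "(dz has_integral integral {s..t} dz) {s..t}"
      using integrable_integral[OF integrable_subinterval_real[OF dz_int, of s t]] that by auto
    \<comment> \<open>With the undifferentiated factors frozen at \<open>s\<close> the integral is
      known exactly. Freezing costs at most \<open>2 * (L * N * C) * (t - s)\<close> pointwise,
      hence a quadratic error after integration.\<close>
    then have "((\<lambda>u. dz u - h (dx u) (y s) - h (x s) (dy u)) has_integral
        (integral {s..t} dz - h (x t - x s) (y s) - h (x s) (y t - y s))) {s..t}"
      using has_integral_linear[OF i1 h.bounded_linear_left, of "y s"]
        has_integral_linear[OF i2 h.bounded_linear_right, of "x s"]
      by (intro has_integral_diff) (auto simp: o_def)
    moreover have "norm (dz u - h (dx u) (y s) - h (x s) (dy u)) \<le> 2 * (L * N * C) * (t - s)"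
      if u: "u \<in> {s..t}" for u
    proof -
      have uu: "u \<in> {a..b}" "s \<in> {a..b}" using u \<open>a \<le> s\<close> \<open>t \<le> b\<close> by auto
      have "dz u - h (dx u) (y s) - h (x s) (dy u) = h (dx u) (y u - y s) + h (x u - x s) (dy u)"
        by (simp add: dz_def h.diff_left h.diff_right)
      also have "norm \<dots> \<le> norm (dx u) * norm (y u - y s) * C + norm (x u - x s) * norm (dy u) * C"
        by (intro norm_triangle_le add_mono C)
      also have "\<dots> \<le> L * (N * \<bar>u - s\<bar>) * C + (L * \<bar>u - s\<bar>) * N * C"
        using C(1) L N uu by (intro add_mono mult_right_mono mult_mono) auto
      also have "\<dots> = 2 * (L * N * C) * \<bar>u - s\<bar>" by (simp add: algebra_simps)
      also have "\<dots> \<le> 2 * (L * N * C) * (t - s)"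
        using u C(1) L(1) N(1) by (intro mult_left_mono) auto
      finally show ?thesis .
    qed
    ultimately have 1: "norm (integral {s..t} dz - h (x t - x s) (y s) - h (x s) (y t - y s))
        \<le> 2 * (L * N * C) * (t - s) * (t - s)"
      using has_integral_bound[of "2 * (L * N * C) * (t - s)" _ _ s t] that C(1) L(1) N(1)
      by (auto simp: cbox_interval)
    have 2: "norm (h (x t - x s) (y t - y s)) \<le> (L * N * C) * (t - s)\<^sup>2"
    proof -
      have "norm (h (x t - x s) (y t - y s)) \<le> (L * \<bar>t - s\<bar>) * (N * \<bar>t - s\<bar>) * C"
        using C(1) L(1) N(1) L(3)[of s t] N(3)[of s t] that
        by (intro order_trans[OF C(2)] mult_right_mono mult_mono) auto
      then show ?thesis by (simp add: power2_eq_square algebra_simps that)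
    qed
    have 3: "D t - D s = h (x t - x s) (y t - y s)
        - (integral {s..t} dz - h (x t - x s) (y s) - h (x s) (y t - y s))"
    proof -
      have "integral {a..t} dz = integral {a..s} dz + integral {s..t} dz"
        using Henstock_Kurzweil_Integration.integral_combine[of a s t dz]
          integrable_subinterval_real[OF dz_int, of a t] that by auto
      then show ?thesis by (simp add: D_def h.diff_left h.diff_right)
    qed
    have "norm (D t - D s) \<le> (L * N * C) * (t - s)\<^sup>2 + 2 * (L * N * C) * (t - s) * (t - s)"
      unfolding 3 by (rule order_trans[OF norm_triangle_ineq4 add_mono[OF 2 1]])
    then show ?thesis by (simp add: power2_eq_square algebra_simps)
  qed
  have "norm (D t - D s) \<le> (3 * (L * N * C)) * (t - s)\<^sup>2" if "s \<in> {a..b}" "t \<in> {a..b}" for s t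
  proof (cases "s \<le> t")
    case True
    then show ?thesis using step that by simp
  next
    case False
    then have "norm (D s - D t) \<le> (3 * (L * N * C)) * (s - t)\<^sup>2" using step that by simp
    then show ?thesis by (simp only: norm_minus_commute[of "D t"] power2_commute[of t])
  qed
  then have D: "D t = D a" if "t \<in> {a..b}" for t
    by (rule quadratic_modulus_imp_constant) (use that ab in auto)
  have eq: "integral {a..t} dz = h (x t) (y t) - h (x a) (y a)" if "t \<in> {a..b}" for t
    using D[OF that] by (simp add: D_def diff_eq_eq)
  have "(dz has_integral (h (x t) (y t) - h (x a) (y a))) {a..t}" if t: "t \<in> {a..b}" for t
  proof -
    have "(dz has_integral (integral {a..t} dz)) {a..t}"
      using integrable_integral[OF integrable_subinterval_real[OF dz_int, of a t]] t by auto
    then show ?thesis using eq[OF t] by simp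
  qed
  moreover have "bounded (dz ` {a..b})"
    unfolding dz_def
    by (intro bounded_plus_comp bounded_bilinear_image[OF h.bounded_bilinear_axioms] bnd)
      (use x y in \<open>auto simp: bounded_primitive_def\<close>)
  ultimately show ?thesis by (auto simp: bounded_primitive_def dz_def)
qed

lemma bounded_primitive_nonincreasing:
  fixes x :: "real \<Rightarrow> real"
  assumes "bounded_primitive a b x dx" "a \<le> s" "s \<le> t" "t \<le> b"
    and "\<And>u. u \<in> {s..t} \<Longrightarrow> dx u \<le> c"
  shows "x t - x s \<le> c * (t - s)"
proof -
  have "((\<lambda>_. c) has_integral (c * (t - s))) {s..t}"
    using has_integral_const_real[of c s t] assms by (simp add: mult.commute)
  then show ?thesis
    using has_integral_le[OF bounded_primitive_integral[OF assms(1-4)]] assms(5) by blast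
qed

text \<open>Gronwall's inequality by an integrating factor:
  \<open>exp (\<mu> * (t - a)) * (x t - c)\<close> has a nonpositive derivative. It carries both the
  consensus estimates and those for the plant.\<close>

lemma bounded_primitive_comparison:
  fixes x :: "real \<Rightarrow> real"
  assumes x: "bounded_primitive a b x dx" and ab: "a \<le> b"
    and le: "\<And>t. t \<in> {a..b} \<Longrightarrow> dx t \<le> - \<mu> * (x t - c)"
  shows "x b \<le> c + (x a - c) * exp (- \<mu> * (b - a))"
proof -
  define e where "e t = exp (\<mu> * (t - a))" for t
  have "bounded_primitive a b e (\<lambda>t. \<mu> * e t)"
  proof (rule bounded_primitive_vector_derivative)
    show "(e has_vector_derivative \<mu> * e t) (at t within {a..b})" for t
      unfolding e_def
      by (auto intro!: derivative_eq_intros simp flip: has_real_derivative_iff_has_vector_derivative)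
    have "continuous_on {a..b} (\<lambda>t. \<mu> * e t)" unfolding e_def by (intro continuous_intros)
    then show "bounded ((\<lambda>t. \<mu> * e t) ` {a..b})"
      by (auto intro: compact_imp_bounded compact_continuous_image)
  qed
  moreover have "bounded_primitive a b (\<lambda>t. x t - c) (\<lambda>t. dx t - 0)"
    by (intro bounded_primitive_diff bounded_primitive_const x)
  ultimately have "bounded_primitive a b (\<lambda>t. e t * (x t - c)) (\<lambda>t. \<mu> * e t * (x t - c) + e t * (dx t - 0))"
    using bounded_primitive_bilinear[OF bilinear_times] by blast
  note z = this
  have "e b * (x b - c) \<le> e a * (x a - c)"
  proof -
    have "\<mu> * e t * (x t - c) + e t * (dx t - 0) \<le> 0" if "t \<in> {a..b}" for t
      using mult_left_mono[OF le[OF that], of "e t"] by (simp add: e_def algebra_simps)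
    then show ?thesis
      using bounded_primitive_nonincreasing[OF z order_refl ab order_refl, of 0] by simp
  qed
  then have "x b - c \<le> (x a - c) / e b"
    by (simp add: e_def field_simps)
  also have "\<dots> = (x a - c) * exp (- \<mu> * (b - a))"
    unfolding e_def by (simp add: exp_minus divide_inverse)
  finally show ?thesis by simp
qed

section \<open>The matrix exponential of a semisimple matrix with imaginary spectrum\<close>

definition diag_matrix :: "('n \<Rightarrow> complex) \<Rightarrow> complex^'n^'n" where
  "diag_matrix d = (\<chi> i j. if i = j then d i else 0)"

lemma diag_matrix_mult: "diag_matrix a ** diag_matrix b = diag_matrix (\<lambda>i. a i * b i)"
  by (simp add: diag_matrix_def matrix_matrix_mult_def vec_eq_iff if_distrib[of "\<lambda>x. x * _"]
      cong: if_cong)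

lemma diag_matrix_one: "diag_matrix (\<lambda>i. 1) = mat 1"
  by (simp add: diag_matrix_def mat_def)

lemma similar_diag_matrix_entry:
  "(P ** diag_matrix d ** Q) $ i $ j = (\<Sum>m\<in>UNIV. P $ i $ m * d m * Q $ m $ j)"
  by (simp add: diag_matrix_def matrix_matrix_mult_def if_distrib[of "\<lambda>x. _ * x"] cong: if_cong)

lemma similar_diag_matrix_mult:
  assumes "Q ** P = mat 1"
  shows "(P ** diag_matrix a ** Q) ** (P ** diag_matrix b ** Q)
    = P ** diag_matrix (\<lambda>i. a i * b i) ** Q"
proof -
  have "(P ** diag_matrix a ** Q) ** (P ** diag_matrix b ** Q)
      = P ** (diag_matrix a ** (Q ** P) ** diag_matrix b) ** Q"
    by (simp only: matrix_mul_assoc)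
  then show ?thesis by (simp add: assms diag_matrix_mult)
qed

lemma complexify_mult: "complexify (A ** B) = complexify A ** complexify B"
  by (simp add: complexify_def vec_eq_iff matrix_matrix_mult_def)

lemma complexify_one: "complexify (mat 1) = mat 1"
  by (simp add: complexify_def vec_eq_iff mat_def)

lemma complexify_inject: "complexify A = complexify B \<longleftrightarrow> A = B"
  by (simp add: complexify_def vec_eq_iff)

lemma complexify_nth: "complexify A $ i $ j = of_real (A $ i $ j)"
  by (simp add: complexify_def)

text \<open>Packages one diagonalization with the exponential at all times, so that each identity
  for \<open>mat_exp\<close> reduces to scalar exponentials on the diagonal.\<close>

definition exp_diagonalization ::
  "real^'n^'n \<Rightarrow> complex^'n^'n \<Rightarrow> complex^'n^'n \<Rightarrow> ('n \<Rightarrow> complex) \<Rightarrow> bool" where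
  "exp_diagonalization S P Q d \<longleftrightarrow> P ** Q = mat 1 \<and> Q ** P = mat 1 \<and>
     complexify S = P ** diag_matrix d ** Q \<and>
     (\<forall>t. complexify (mat_exp (t *\<^sub>R S)) = P ** diag_matrix (\<lambda>i. exp (of_real t * d i)) ** Q)"

text \<open>Powers of \<open>t *\<^sub>R S\<close> keep the same \<open>P\<close> and
  \<open>Q\<close>, so each entry of the exponential series is a fixed finite combination of scalar
  exponential series. No norm estimate for matrix powers is involved.\<close>

lemma semisimple_mat_exp:
  fixes S :: "real^'n^'n"
  assumes "semisimple_matrix S"
  obtains P Q d where "exp_diagonalization S P Q d"
proof -
  obtain P D :: "complex^'n^'n" where P: "invertible P" and D: "\<forall>i j. i \<noteq> j \<longrightarrow> D $ i $ j = 0"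
    and S: "complexify S = P ** D ** matrix_inv P"
    using assms unfolding semisimple_matrix_def by blast
  define Q d where "Q = matrix_inv P" and "d i = D $ i $ i" for i
  \<comment> \<open>\<open>matrix_inv\<close> is a choice among the two-sided inverses, and
    invertibility says that there is one.\<close>
  have PQ: "P ** Q = mat 1 \<and> Q ** P = mat 1"
    using P unfolding Q_def matrix_inv_def invertible_def by (rule someI_ex)
  have "D = diag_matrix d" using D by (auto simp: diag_matrix_def d_def vec_eq_iff)
  then have S': "complexify S = P ** diag_matrix d ** Q" using S by (simp add: Q_def)
  have St: "complexify (t *\<^sub>R S) = P ** diag_matrix (\<lambda>i. of_real t * d i) ** Q" for t
  proof -
    have "complexify (t *\<^sub>R S) $ i $ j = of_real t * complexify S $ i $ j" for i j
      by (simp add: complexify_nth)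
    then show ?thesis
      by (simp add: vec_eq_iff S' similar_diag_matrix_entry sum_distrib_left mult_ac)
  qed
  have "complexify (mat_exp (t *\<^sub>R S)) = P ** diag_matrix (\<lambda>i. exp (of_real t * d i)) ** Q" for t
  proof -
    define Z where "Z = P ** diag_matrix (\<lambda>i. exp (of_real t * d i)) ** Q"
    define A where "A k = (1 / fact k) *\<^sub>R (((**) (t *\<^sub>R S)) ^^ k) (mat 1)" for k
    have pow: "complexify ((((**) (t *\<^sub>R S)) ^^ k) (mat 1))
        = P ** diag_matrix (\<lambda>i. (of_real t * d i) ^ k) ** Q" for k
    proof (induction k)
      case 0
      then show ?case using PQ by (simp add: complexify_one diag_matrix_one)
    next
      case (Suc k)
      then show ?case
        using PQ by (simp add: complexify_mult St similar_diag_matrix_mult)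
    qed
    have "(\<lambda>k. complex_of_real (A k $ i $ j)) sums Z $ i $ j" for i j
    proof -
      have "(\<lambda>k. \<Sum>m\<in>UNIV. P $ i $ m * ((of_real t * d m) ^ k /\<^sub>R fact k) * Q $ m $ j)
          sums (\<Sum>m\<in>UNIV. P $ i $ m * exp (of_real t * d m) * Q $ m $ j)"
        unfolding exp_def
        by (intro sums_sum sums_mult sums_mult2 summable_sums summable_exp_generic)
      moreover have "complex_of_real (A k $ i $ j)
          = (\<Sum>m\<in>UNIV. P $ i $ m * ((of_real t * d m) ^ k /\<^sub>R fact k) * Q $ m $ j)" for k
      proof -
        have "complex_of_real (A k $ i $ j) = of_real (1 / fact k) *
            complexify ((((**) (t *\<^sub>R S)) ^^ k) (mat 1)) $ i $ j"
          by (simp add: A_def complexify_nth)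
        then show ?thesis
          unfolding pow similar_diag_matrix_entry
          by (simp add: sum_distrib_left scaleR_conv_of_real field_simps)
      qed
      ultimately show ?thesis by (simp add: Z_def similar_diag_matrix_entry)
    qed
    \<comment> \<open>The partial sums are real, so the complex limit \<open>Z\<close> is itself the
      complexification of a real matrix.\<close>
    then have re: "(\<lambda>k. A k $ i $ j) sums Re (Z $ i $ j)" and im: "Im (Z $ i $ j) = 0" for i j
      using sums_Re[of "\<lambda>k. complex_of_real (A k $ i $ j)"]
        sums_unique2[OF sums_Im[of "\<lambda>k. complex_of_real (A k $ i $ j)"], of _ 0]
      by auto
    have "A sums (\<chi> i j. Re (Z $ i $ j))"
      using re unfolding sums_def by (intro vec_tendstoI) (simp add: sum_component)
    then have "mat_exp (t *\<^sub>R S) = (\<chi> i j. Re (Z $ i $ j))"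
      unfolding mat_exp_def A_def by (simp add: sums_iff)
    then show ?thesis
      using im by (simp add: vec_eq_iff complexify_nth complex_eq_iff flip: Z_def)
  qed
  with PQ S' show ?thesis by (intro that[of P Q d]) (simp add: exp_diagonalization_def)
qed

text \<open>Complexification is injective and multiplicative, so the identity is checked on the
  diagonal, where it is the functional equation of \<open>exp\<close>.\<close>

lemma mat_exp_add:
  assumes "semisimple_matrix S"
  shows "mat_exp ((s + t) *\<^sub>R S) = mat_exp (s *\<^sub>R S) ** mat_exp (t *\<^sub>R S)"
proof -
  obtain P Q d where "exp_diagonalization S P Q d"
    using semisimple_mat_exp[OF assms] by blast
  then have PQ: "P ** Q = mat 1" "Q ** P = mat 1"
    and S: "complexify S = P ** diag_matrix d ** Q"
    and X: "complexify (mat_exp (t *\<^sub>R S)) = P ** diag_matrix (\<lambda>i. exp (of_real t * d i)) ** Q" for t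
    by (auto simp: exp_diagonalization_def)
  have "complexify (mat_exp ((s + t) *\<^sub>R S)) = complexify (mat_exp (s *\<^sub>R S) ** mat_exp (t *\<^sub>R S))"
    unfolding complexify_mult X similar_diag_matrix_mult[OF PQ(2)]
    by (simp add: exp_add distrib_right)
  then show ?thesis by (simp only: complexify_inject)
qed

lemma mat_exp_zero:
  assumes "semisimple_matrix S"
  shows "mat_exp (0 *\<^sub>R S) = mat 1"
proof -
  obtain P Q d where "exp_diagonalization S P Q d"
    using semisimple_mat_exp[OF assms] by blast
  then have PQ: "P ** Q = mat 1" "Q ** P = mat 1"
    and S: "complexify S = P ** diag_matrix d ** Q"
    and X: "complexify (mat_exp (t *\<^sub>R S)) = P ** diag_matrix (\<lambda>i. exp (of_real t * d i)) ** Q" for t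
    by (auto simp: exp_diagonalization_def)
  have "complexify (mat_exp (0 *\<^sub>R S)) = complexify (mat 1)"
    unfolding X by (simp add: PQ complexify_one diag_matrix_one)
  then show ?thesis by (simp only: complexify_inject)
qed

lemma mat_exp_add_vector:
  assumes "semisimple_matrix S"
  shows "mat_exp (s *\<^sub>R S) *v (mat_exp (t *\<^sub>R S) *v x) = mat_exp ((s + t) *\<^sub>R S) *v x"
  by (simp add: mat_exp_add[OF assms] matrix_vector_mul_assoc)

lemma mat_exp_cancel:
  assumes "semisimple_matrix S"
  shows "mat_exp (t *\<^sub>R S) *v (mat_exp ((- t) *\<^sub>R S) *v x) = x"
    and "mat_exp ((- t) *\<^sub>R S) *v (mat_exp (t *\<^sub>R S) *v x) = x"
  using mat_exp_zero[OF assms] by (simp_all only: mat_exp_add_vector[OF assms]) simp_all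

lemma mat_exp_commute:
  assumes "semisimple_matrix S"
  shows "mat_exp (t *\<^sub>R S) ** S = S ** mat_exp (t *\<^sub>R S)"
proof -
  obtain P Q d where "exp_diagonalization S P Q d"
    using semisimple_mat_exp[OF assms] by blast
  then have PQ: "P ** Q = mat 1" "Q ** P = mat 1"
    and S: "complexify S = P ** diag_matrix d ** Q"
    and X: "complexify (mat_exp (t *\<^sub>R S)) = P ** diag_matrix (\<lambda>i. exp (of_real t * d i)) ** Q" for t
    by (auto simp: exp_diagonalization_def)
  have "complexify (mat_exp (t *\<^sub>R S) ** S) = complexify (S ** mat_exp (t *\<^sub>R S))"
    unfolding complexify_mult X S similar_diag_matrix_mult[OF PQ(2)] by (simp add: mult.commute)
  then show ?thesis by (simp only: complexify_inject)
qed

lemma has_vector_derivative_matrix_componentwise: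
  fixes X :: "real \<Rightarrow> real^'n^'m"
  assumes "\<And>i j. ((\<lambda>t. X t $ i $ j) has_vector_derivative X' $ i $ j) (at t within A)"
  shows "(X has_vector_derivative X') (at t within A)"
  using assms unfolding has_vector_derivative_def
  by (subst has_derivative_componentwise_within)
    (auto simp: Basis_vec_def inner_axis)

lemma mat_exp_has_vector_derivative:
  assumes "semisimple_matrix S"
  shows "((\<lambda>t. mat_exp (t *\<^sub>R S)) has_vector_derivative S ** mat_exp (t *\<^sub>R S)) (at t within A)"
proof (rule has_vector_derivative_matrix_componentwise)
  fix i j
  obtain P Q d where "exp_diagonalization S P Q d"
    using semisimple_mat_exp[OF assms] by blast
  then have PQ: "P ** Q = mat 1" "Q ** P = mat 1"
    and S: "complexify S = P ** diag_matrix d ** Q"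
    and X: "complexify (mat_exp (t *\<^sub>R S)) = P ** diag_matrix (\<lambda>i. exp (of_real t * d i)) ** Q" for t
    by (auto simp: exp_diagonalization_def)
  have X_Re: "mat_exp (t *\<^sub>R S) $ i $ j = Re (\<Sum>m\<in>UNIV. P $ i $ m * exp (of_real t * d m) * Q $ m $ j)" for t
    using X[of t, THEN arg_cong, of "\<lambda>M. Re (M $ i $ j)"]
    by (simp only: complexify_nth similar_diag_matrix_entry Re_complex_of_real)
  have "complexify (S ** mat_exp (t *\<^sub>R S)) = P ** diag_matrix (\<lambda>i. d i * exp (of_real t * d i)) ** Q"
    unfolding complexify_mult X S similar_diag_matrix_mult[OF PQ(2)] ..
  from this[THEN arg_cong, of "\<lambda>M. Re (M $ i $ j)"]
  have S_Re: "(S ** mat_exp (t *\<^sub>R S)) $ i $ j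
      = Re (\<Sum>m\<in>UNIV. P $ i $ m * (d m * exp (of_real t * d m)) * Q $ m $ j)"
    by (simp only: complexify_nth similar_diag_matrix_entry Re_complex_of_real)
  have "((\<lambda>t. \<Sum>m\<in>UNIV. P $ i $ m * exp (of_real t * d m) * Q $ m $ j) has_vector_derivative
      (\<Sum>m\<in>UNIV. P $ i $ m * (d m * exp (of_real t * d m)) * Q $ m $ j)) (at t within A)"
  proof (intro has_vector_derivative_sum)
    fix m
    have "((\<lambda>t. exp (t *\<^sub>R d m)) has_vector_derivative exp (t *\<^sub>R d m) * d m) (at t within A)"
      by (rule exp_scaleR_has_vector_derivative_right)
    then have "((\<lambda>t. P $ i $ m * exp (t *\<^sub>R d m) * Q $ m $ j) has_vector_derivative
        P $ i $ m * (exp (t *\<^sub>R d m) * d m) * Q $ m $ j) (at t within A)"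
      by (intro has_vector_derivative_mult_left has_vector_derivative_mult_right)
    then show "((\<lambda>t. P $ i $ m * exp (of_real t * d m) * Q $ m $ j) has_vector_derivative
        P $ i $ m * (d m * exp (of_real t * d m)) * Q $ m $ j) (at t within A)"
      by (simp add: scaleR_conv_of_real mult.commute)
  qed
  then show "((\<lambda>t. mat_exp (t *\<^sub>R S) $ i $ j) has_vector_derivative
      (S ** mat_exp (t *\<^sub>R S)) $ i $ j) (at t within A)"
    unfolding X_Re S_Re by (rule bounded_linear.has_vector_derivative[OF bounded_linear_Re])
qed

text \<open>The columns of \<open>P\<close> are eigenvectors with the diagonal entries
  \<open>d m\<close> as eigenvalues, so every \<open>d m\<close> is imaginary and the time
  dependence has modulus one.\<close>

lemma mat_exp_entries_bounded:
  fixes S :: "real^'n^'n"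
  assumes "semisimple_matrix S" and re: "\<And>z. complex_eigenvalue S z \<Longrightarrow> Re z = 0"
  obtains B where "\<And>t i j. \<bar>mat_exp (t *\<^sub>R S) $ i $ j\<bar> \<le> B"
proof -
  obtain P Q d where "exp_diagonalization S P Q d"
    using semisimple_mat_exp[OF assms(1)] by blast
  then have PQ: "P ** Q = mat 1" "Q ** P = mat 1"
    and S: "complexify S = P ** diag_matrix d ** Q"
    and X: "complexify (mat_exp (t *\<^sub>R S)) = P ** diag_matrix (\<lambda>i. exp (of_real t * d i)) ** Q" for t
    by (auto simp: exp_diagonalization_def)
  have d: "Re (d m) = 0" for m
  proof (rule re)
    have "complexify S ** P = P ** diag_matrix d ** (Q ** P)"
      by (simp only: S matrix_mul_assoc)
    then have SP: "complexify S ** P = P ** diag_matrix d" by (simp add: PQ)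
    have "complexify S *v column m P = d m *s column m P"
    proof (simp add: vec_eq_iff, intro allI)
      fix i
      have "(complexify S *v column m P) $ i = (complexify S ** P) $ i $ m"
        by (simp add: matrix_vector_mult_def matrix_matrix_mult_def column_def)
      also have "\<dots> = d m * P $ i $ m"
        unfolding SP by (simp add: matrix_matrix_mult_def diag_matrix_def
            if_distrib[of "\<lambda>x. _ * x"] mult.commute cong: if_cong)
      finally show "(complexify S *v column m P) $ i = d m * column m P $ i"
        by (simp add: column_def)
    qed
    \<comment> \<open>A zero column would make the diagonal entry of \<open>Q ** P = mat 1\<close>
      vanish.\<close>
    moreover have "column m P \<noteq> 0"
    proof
      assume "column m P = 0"
      then have "P $ k $ m = 0" for k by (simp add: vec_eq_iff column_def)
      then have "(Q ** P) $ m $ m = 0" by (simp add: matrix_matrix_mult_def)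
      then show False by (simp add: PQ mat_def)
    qed
    ultimately show "complex_eigenvalue S (d m)" by (auto simp: complex_eigenvalue_def)
  qed
  define b where "b i j = (\<Sum>m\<in>UNIV. norm (P $ i $ m) * norm (Q $ m $ j))" for i j
  have "\<bar>mat_exp (t *\<^sub>R S) $ i $ j\<bar> \<le> (\<Sum>i\<in>UNIV. \<Sum>j\<in>UNIV. b i j)" for t i j
  proof -
    have "\<bar>mat_exp (t *\<^sub>R S) $ i $ j\<bar> = norm (complexify (mat_exp (t *\<^sub>R S)) $ i $ j)"
      by (simp add: complexify_nth)
    also have "\<dots> \<le> (\<Sum>m\<in>UNIV. norm (P $ i $ m * exp (of_real t * d m) * Q $ m $ j))"
      unfolding X similar_diag_matrix_entry by (rule norm_sum)
    also have "\<dots> = b i j" by (simp add: b_def norm_mult d)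
    also have "\<dots> \<le> (\<Sum>j\<in>UNIV. b i j)"
      by (rule member_le_sum) (auto simp: b_def sum_nonneg)
    also have "\<dots> \<le> (\<Sum>i\<in>UNIV. \<Sum>j\<in>UNIV. b i j)"
      by (rule member_le_sum) (auto simp: b_def sum_nonneg)
    finally show ?thesis .
  qed
  then show ?thesis using that by blast
qed

text \<open>One constant serves positive and negative times, so passing to the auxiliary variable
  and back costs only a bounded factor in either direction.\<close>

lemma mat_exp_norm_bounded:
  fixes S :: "real^'n^'n"
  assumes "semisimple_matrix S" "\<And>z. complex_eigenvalue S z \<Longrightarrow> Re z = 0"
  obtains K where "K > 0" "\<And>t x. norm (mat_exp (t *\<^sub>R S) *v x) \<le> K * norm x"
proof -
  obtain B where B: "\<And>t i j. \<bar>mat_exp (t *\<^sub>R S) $ i $ j\<bar> \<le> B"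
    using mat_exp_entries_bounded[OF assms] by metis
  define K where "K = real (CARD('n)) * real (CARD('n)) * B"
  have "norm (mat_exp (t *\<^sub>R S) *v x) \<le> (\<bar>K\<bar> + 1) * norm x" for t x
  proof -
    have "onorm ((*v) (mat_exp (t *\<^sub>R S))) \<le> K"
      unfolding K_def by (rule onorm_le_matrix_component[OF B])
    then have "norm (mat_exp (t *\<^sub>R S) *v x) \<le> K * norm x"
      using onorm[OF matrix_vector_mul_bounded_linear, of "mat_exp (t *\<^sub>R S)" x]
      by (meson mult_right_mono norm_ge_zero order_trans)
    also have "\<dots> \<le> (\<bar>K\<bar> + 1) * norm x" by (intro mult_right_mono) auto
    finally show ?thesis .
  qed
  then show ?thesis by (intro that[of "\<bar>K\<bar> + 1"]) auto
qed

section \<open>The event-triggered scheme\<close>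

lemma bilinear_matrix_vector_mult: "bilinear ((*v) :: real^'n^'m \<Rightarrow> real^'n \<Rightarrow> real^'m)"
  by (auto simp: bilinear_def intro!: linearI
      simp: matrix_vector_mult_add_rdistrib matrix_vector_right_distrib
        scaleR_matrix_vector_assoc matrix_vector_mult_scaleR)

lemmas bounded_bilinear_matrix_vector_mult =
  bilinear_matrix_vector_mult[unfolded bilinear_conv_bounded_bilinear]

lemma continuous_on_mat_exp:
  assumes "semisimple_matrix S" "continuous_on A c"
  shows "continuous_on A (\<lambda>t. mat_exp (c t *\<^sub>R S))"
proof -
  have "continuous_on UNIV (\<lambda>t. mat_exp (t *\<^sub>R S))"
    unfolding continuous_on_eq_continuous_within
    using has_vector_derivative_continuous[OF mat_exp_has_vector_derivative[OF assms(1)]] by blast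
  then show ?thesis using continuous_on_compose2[OF _ assms(2)] by blast
qed

lemma Icc_subset_horizon:
  assumes "b \<in> horizon t0 T"
  shows "{t0..b} \<subseteq> horizon t0 T"
proof
  fix t assume "t \<in> {t0..b}"
  moreover from this have "ereal t \<le> ereal b" by simp
  ultimately show "t \<in> horizon t0 T"
    using assms le_less_trans[of "ereal t" "ereal b" T] by (auto simp: horizon_def)
qed

locale event_trigger =
  fixes S :: "real^'n^'n" and \<theta> :: "real \<Rightarrow> real" and t0 :: real and T :: ereal
    and x :: "real \<Rightarrow> real^'n"
  assumes S: "semisimple_matrix S" and T: "ereal t0 < T"
    and x_cont: "\<And>b. b \<in> horizon t0 T \<Longrightarrow> continuous_on {t0..b} x"
    and \<theta>_cont: "continuous_on {t0..} \<theta>" and \<theta>_pos: "\<And>t. t0 \<le> t \<Longrightarrow> 0 < \<theta> t"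
    and \<theta>_antimono: "\<And>s t. t0 \<le> s \<Longrightarrow> s \<le> t \<Longrightarrow> \<theta> t \<le> \<theta> s"
begin

abbreviation "u \<equiv> trigger S \<theta> t0 T x"

definition err :: "real \<Rightarrow> real \<Rightarrow> real" where
  "err r t = norm (open_loop S (x r, r) t - x t)"

lemma err_self: "err r r = 0"
  using mat_exp_zero[OF S] by (simp add: err_def open_loop_def)

lemma err_continuous:
  assumes "b \<in> horizon t0 T"
  shows "continuous_on {t0..b} (\<lambda>t. err r t - \<theta> t)"
proof -
  have "continuous_on {t0..b} (\<lambda>t. mat_exp ((t - r) *\<^sub>R S) *v x r)"
    by (intro bounded_bilinear.continuous_on[OF bounded_bilinear_matrix_vector_mult]
        continuous_on_mat_exp[OF S] continuous_intros)
  moreover have "continuous_on {t0..b} \<theta>" using \<theta>_cont by (rule continuous_on_subset) auto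
  ultimately show ?thesis
    unfolding err_def open_loop_def fst_conv snd_conv using x_cont[OF assms]
    by (intro continuous_intros)
qed

text \<open>Right at a triggering instant the error is zero while the threshold is positive. By
  continuity the infimum defining the next instant is attained if it is finite, and it is strictly
  later.\<close>

lemma trigger_step:
  assumes k: "u k = ereal r" and r: "r \<in> horizon t0 T"
  obtains "u (Suc k) = \<infinity>" "\<And>t. r \<le> t \<Longrightarrow> t \<in> horizon t0 T \<Longrightarrow> err r t < \<theta> t"
  | r' where "u (Suc k) = ereal r'" "r < r'" "r' \<in> horizon t0 T" "\<theta> r' \<le> err r r'"
      "\<And>t. r \<le> t \<Longrightarrow> t < r' \<Longrightarrow> err r t < \<theta> t"
proof -
  define A where "A = {t. ereal r < ereal t \<and> ereal t < T \<and> \<theta> t \<le> err r t}"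
  have u: "u (Suc k) = Inf (ereal ` A)"
    using k by (simp add: A_def err_def Let_def)
  have r0: "err r r < \<theta> r" using \<theta>_pos[of r] r by (simp add: err_self horizon_def)
  show ?thesis
  proof (cases "A = {}")
    case True
    then have inf: "u (Suc k) = \<infinity>" using u by (simp add: top_ereal_def)
    have "err r t < \<theta> t" if "r \<le> t" "t \<in> horizon t0 T" for t
      using True r0 that by (cases "t = r") (auto simp: A_def horizon_def)
    with inf show ?thesis by (rule that(1))
  next
    case False
    then obtain a where a: "a \<in> A" by blast
    then have ah: "a \<in> horizon t0 T" "r < a" using r by (auto simp: A_def horizon_def)
    \<comment> \<open>Cutting at one violating time \<open>a\<close> gives a compact set, whose
      minimum exists; violations after \<open>a\<close> cannot lower it.\<close>
    define B where "B = {t\<in>{r..a}. 0 \<le> err r t - \<theta> t}"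
    have "continuous_on {r..a} (\<lambda>t. err r t - \<theta> t)"
      using err_continuous[OF ah(1)] by (rule continuous_on_subset) (use r in \<open>auto simp: horizon_def\<close>)
    then have "closed B"
      unfolding B_def by (intro continuous_on_closed_Collect_le continuous_on_const closed_atLeastAtMost)
    moreover have "B \<subseteq> {r..a}" by (auto simp: B_def)
    ultimately have "compact B"
      by (meson bounded_closed_interval bounded_subset compact_eq_bounded_closed)
    moreover have "B \<noteq> {}" using a by (auto simp: B_def A_def)
    ultimately obtain r' where r'B: "r' \<in> B" and r'_le: "\<forall>t\<in>B. r' \<le> t"
      using compact_attains_inf[of B] by blast
    note r' = r'B r'_le[rule_format]
    have rB: "r \<le> r'" "r' \<le> a" "\<theta> r' \<le> err r r'" using r'B by (simp_all add: B_def)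
    moreover have "r' \<noteq> r" using rB(3) r0 by force
    ultimately have rr': "r < r'" "r' \<le> a" "\<theta> r' \<le> err r r'" by simp_all
    have least: "r' \<le> t" if "t \<in> A" for t
    proof (cases "t \<le> a")
      case True
      then show ?thesis using r'(2)[of t] that by (auto simp: A_def B_def)
    next
      case False
      then show ?thesis using rr' by simp
    qed
    have "r' \<in> {t0..a}" using rr' r by (simp add: horizon_def)
    then have h: "r' \<in> horizon t0 T" using Icc_subset_horizon[OF ah(1)] by blast
    have "r' \<in> A" using rr' h by (auto simp: A_def horizon_def)
    then have "u (Suc k) = ereal r'"
      unfolding u using least by (intro Inf_eqI) auto
    moreover have "err r t < \<theta> t" if "r \<le> t" "t < r'" for t
    proof -
      have "ereal t < T" using h that(2) less_trans[of "ereal t" "ereal r'" T] by (simp add: horizon_def)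
      moreover have "t \<notin> A" using least[of t] that by auto
      ultimately show ?thesis using r0 that by (cases "t = r") (auto simp: A_def not_le)
    qed
    ultimately show ?thesis using rr' h by (intro that(2))
  qed
qed

lemma trigger_cases:
  obtains "u k = \<infinity>" | r where "u k = ereal r" "r \<in> horizon t0 T"
proof -
  have "u k = \<infinity> \<or> (\<exists>r\<in>horizon t0 T. u k = ereal r)"
  proof (induction k)
    case 0
    then show ?case using T by (auto simp: horizon_def)
  next
    case (Suc k)
    then consider "u k = \<infinity>" | r where "r \<in> horizon t0 T" "u k = ereal r" by blast
    then show ?case
    proof cases
      case 1
      then have "u (Suc k) = \<infinity>" by (simp add: top_ereal_def)
      then show ?thesis by blast
    next
      case 2
      show ?thesis by (rule trigger_step[OF 2(2,1)]) auto
    qed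
  qed
  then show ?thesis using that by blast
qed

lemma trigger_Suc_ge: "u k \<le> u (Suc k)"
proof (cases rule: trigger_cases[of k])
  case 1
  then show ?thesis by (simp add: top_ereal_def)
next
  case (2 r)
  show ?thesis by (rule trigger_step[OF 2]) (auto simp: 2(1) simp del: trigger.simps)
qed

lemma trigger_mono: "j \<le> k \<Longrightarrow> u j \<le> u k"
  using lift_Suc_mono_le[of u] trigger_Suc_ge by blast

lemma trigger_ge: "ereal t0 \<le> u k"
  using trigger_mono[of 0 k] by simp

text \<open>Only order properties of the supremum enter, so this is available before accumulation of
  instants has been excluded.\<close>

lemma last_trigger_bounds:
  assumes "t \<in> horizon t0 T"
  shows "last_trigger S \<theta> t0 T x t \<in> {t0..t}"
proof -
  define A where "A = {v. v \<in> range u \<and> v \<le> ereal t}"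
  have "ereal t0 \<in> A"
    using assms rangeI[of u 0] by (auto simp: A_def horizon_def)
  then have "ereal t0 \<le> Sup A" by (rule Sup_upper)
  moreover have "Sup A \<le> ereal t" by (rule Sup_least) (auto simp: A_def)
  ultimately show ?thesis
    unfolding last_trigger_def A_def[symmetric] by (cases "Sup A") auto
qed

text \<open>Finiteness turns the supremum in \<open>last_trigger\<close> into a maximum. The latest
  instant is then a genuine \<open>u k\<close>, and the next one has not yet occurred, so the
  threshold is not reached at \<open>t\<close>.\<close>

lemma err_last_trigger_less:
  assumes t: "t \<in> horizon t0 T" and fin: "finite {k. u k \<le> ereal t}"
  shows "err (last_trigger S \<theta> t0 T x t) t < \<theta> t"
proof -
  define I where "I = {k. u k \<le> ereal t}"
  have "0 \<in> I" using t by (auto simp: I_def horizon_def)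
  define k where "k = Max I"
  have k: "k \<in> I" "\<And>j. j \<in> I \<Longrightarrow> j \<le> k"
    unfolding k_def using fin \<open>0 \<in> I\<close> Max_in[of I] Max_ge[of I] by (fastforce simp flip: I_def)+
  then have "Suc k \<notin> I" by fastforce
  then have after: "ereal t < u (Suc k)" by (simp add: I_def not_le)
  obtain r where r: "u k = ereal r" "r \<in> horizon t0 T"
    using k(1) by (cases rule: trigger_cases[of k]) (auto simp: I_def)
  have "Sup {v. v \<in> range u \<and> v \<le> ereal t} = u k"
    using k trigger_mono by (intro Sup_eqI) (auto simp: I_def)
  then have last: "last_trigger S \<theta> t0 T x t = r" by (simp add: last_trigger_def r)
  have "r \<le> t" using k(1) r by (simp add: I_def)
  then show ?thesis
    unfolding last by (rule_tac trigger_step[OF r]) (use t after in auto)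
qed

text \<open>
  In the auxiliary variable the open-loop estimate is constant, so the error grows at most at
  the speed of that variable, while it has to reach the threshold before the next instant.
\<close>

lemma finite_triggers:
  assumes K: "0 < K" "\<And>t y. norm (mat_exp (t *\<^sub>R S) *v y) \<le> K * norm y"
    and L: "\<And>r t. t0 \<le> r \<Longrightarrow> r \<le> t \<Longrightarrow> t \<le> b \<Longrightarrow> t \<in> horizon t0 T \<Longrightarrow>
      norm (mat_exp ((- t) *\<^sub>R S) *v x t - mat_exp ((- r) *\<^sub>R S) *v x r) \<le> L * (t - r)"
  shows "finite {k. u k \<le> ereal b}"
proof (cases "t0 \<le> b")
  case False
  then have "ereal b < u k" for k using trigger_ge[of k] less_le_trans[of "ereal b" "ereal t0"] by simp
  then have "{k. u k \<le> ereal b} = {}" by (simp add: not_le)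
  then show ?thesis by simp
next
  case b: True
  \<comment> \<open>A minimal gap between instants up to \<open>b\<close>: the error grows at rate
    at most \<open>K * \<bar>L\<bar>\<close> and has to reach at least \<open>\<theta> b\<close>.
    The summand 1 avoids division by zero.\<close>
  define d where "d = \<theta> b / (K * \<bar>L\<bar> + 1)"
  have den: "K * \<bar>L\<bar> + 1 > 0" using K(1) by (simp add: add_nonneg_pos)
  have d: "d > 0" using \<theta>_pos[OF b] den by (simp add: d_def)
  have gap: "d \<le> r' - r"
    if "u k = ereal r" "r \<in> horizon t0 T" "u (Suc k) = ereal r'" "r' \<le> b" for k r r'
    using trigger_step[OF that(1,2)]
  proof cases
    case 1
    then show ?thesis using that by simp
  next
    case (2 r'')
    then have [simp]: "r'' = r'" using that by simp
    have r: "t0 \<le> r" using that by (simp add: horizon_def)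
    have "open_loop S (x r, r) r' - x r' = mat_exp (r' *\<^sub>R S) *v
        (mat_exp ((- r) *\<^sub>R S) *v x r - mat_exp ((- r') *\<^sub>R S) *v x r')"
      using mat_exp_cancel(1)[OF S, of r' "x r'"] mat_exp_add_vector[OF S, of r' "- r" "x r"]
      by (simp add: open_loop_def matrix_vector_mult_diff_distrib)
    then have "err r r' \<le> K * norm (mat_exp ((- r) *\<^sub>R S) *v x r - mat_exp ((- r') *\<^sub>R S) *v x r')"
      unfolding err_def using K(2) by simp
    also have "\<dots> \<le> K * (\<bar>L\<bar> * (r' - r))"
    proof -
      have "norm (mat_exp ((- r) *\<^sub>R S) *v x r - mat_exp ((- r') *\<^sub>R S) *v x r') \<le> L * (r' - r)"
        using L[of r r'] r 2 that by (simp add: norm_minus_commute)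
      also have "\<dots> \<le> \<bar>L\<bar> * (r' - r)" using 2 by (intro mult_right_mono) auto
      finally show ?thesis using K(1) by simp
    qed
    also have "\<dots> \<le> (K * \<bar>L\<bar> + 1) * (r' - r)" using 2 by (simp add: algebra_simps)
    finally have "\<theta> b \<le> (K * \<bar>L\<bar> + 1) * (r' - r)"
      using 2 \<theta>_antimono[of r' b] that r by auto
    then show ?thesis unfolding d_def using den by (simp add: divide_le_eq mult.commute)
  qed
  have lower: "ereal (t0 + real k * d) \<le> u k" if "u k \<le> ereal b" for k
    using that
  proof (induction k)
    case 0
    then show ?case by simp
  next
    case (Suc k)
    then have kb: "u k \<le> ereal b" using trigger_Suc_ge order_trans by blast
    obtain r where r: "u k = ereal r" "r \<in> horizon t0 T"
      using kb by (cases rule: trigger_cases[of k]) auto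
    obtain r' where r': "u (Suc k) = ereal r'"
      using Suc.prems by (cases rule: trigger_cases[of "Suc k"]) auto
    have "d \<le> r' - r" using gap[OF r r'] Suc.prems r' by simp
    moreover have "t0 + real k * d \<le> r" using Suc.IH[OF kb] r by simp
    ultimately have "t0 + real (Suc k) * d \<le> r'" by (simp add: algebra_simps)
    then show ?case using r' by (simp del: trigger.simps)
  qed
  have "{k. u k \<le> ereal b} \<subseteq> {k. real k \<le> (b - t0) / d}"
  proof
    fix k assume "k \<in> {k. u k \<le> ereal b}"
    then have "u k \<le> ereal b" by simp
    then have "ereal (t0 + real k * d) \<le> ereal b" using lower order_trans by blast
    then show "k \<in> {k. real k \<le> (b - t0) / d}" using d by (simp add: le_divide_eq algebra_simps)
  qed
  moreover have "{k. real k \<le> (b - t0) / d} \<subseteq> {..nat \<lceil>(b - t0) / d\<rceil>}"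
    by (auto simp: le_nat_iff) linarith
  ultimately show ?thesis by (meson finite_atMost finite_subset)
qed

end

section \<open>The AVBRD algorithm\<close>

text \<open>If the entry at \<open>k\<close> exceeded \<open>c\<close>, all entries up to
  \<open>c\<close> would have indices below \<open>k\<close>, which are only \<open>k\<close>
  many.\<close>

lemma sorted_nth_le:
  fixes xs :: "'a::linorder list"
  assumes "sorted xs" "k < length (filter (\<lambda>x. x \<le> c) xs)"
  shows "xs ! k \<le> c"
proof (rule ccontr)
  assume c: "\<not> xs ! k \<le> c"
  have "{i. i < length xs \<and> xs ! i \<le> c} \<subseteq> {..<k}"
  proof
    fix i assume i: "i \<in> {i. i < length xs \<and> xs ! i \<le> c}"
    then show "i \<in> {..<k}"
      using c sorted_nth_mono[OF assms(1), of k i] by (cases "k \<le> i") auto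
  qed
  then have "card {i. i < length xs \<and> xs ! i \<le> c} \<le> k"
    using card_mono[of "{..<k}"] by fastforce
  then show False using assms(2) by (simp add: length_filter_conv_card)
qed

lemma sorted_nth_ge:
  fixes xs :: "'a::linorder list"
  assumes "sorted xs" "k < length xs" "length xs \<le> k + length (filter (\<lambda>x. c \<le> x) xs)"
  shows "c \<le> xs ! k"
proof (rule ccontr)
  assume c: "\<not> c \<le> xs ! k"
  have "{i. i < length xs \<and> c \<le> xs ! i} \<subseteq> {k<..<length xs}"
  proof
    fix i assume i: "i \<in> {i. i < length xs \<and> c \<le> xs ! i}"
    then show "i \<in> {k<..<length xs}"
      using c sorted_nth_mono[OF assms(1), of i k] assms(2) by (cases "i \<le> k") auto
  qed
  then have "card {i. i < length xs \<and> c \<le> xs ! i} \<le> length xs - Suc k"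
    using card_mono[of "{k<..<length xs}"] by fastforce
  then show False using assms(2,3) by (simp add: length_filter_conv_card)
qed

lemma length_filter_sorted_list_of_image_mset:
  assumes "finite A"
  shows "length (filter P (sorted_list_of_multiset (image_mset w (mset_set A)))) = card {j\<in>A. P (w j)}"
proof -
  have "length (filter P (sorted_list_of_multiset (image_mset w (mset_set A))))
      = size (filter_mset P (image_mset w (mset_set A)))"
    by (metis mset_filter mset_sorted_list_of_multiset size_mset)
  also have "\<dots> = card {j\<in>A. P (w j)}"
    using assms by (simp add: filter_mset_image_mset filter_mset_mset_set)
  finally show ?thesis .
qed

context
  fixes A H :: "'v set" and f :: nat and w :: "'v \<Rightarrow> real"
  assumes fin: "finite A" and byz: "card (A - H) \<le> f" and big: "2 * f + 1 \<le> card A"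
begin

lemma card_normal_ge:
  assumes "\<And>j. j \<in> A \<inter> H \<Longrightarrow> P j"
  shows "card A \<le> f + card {j\<in>A. P j}"
proof -
  have "card A \<le> card ((A - H) \<union> {j\<in>A. P j})"
    using fin assms by (intro card_mono) auto
  also have "\<dots> \<le> card (A - H) + card {j\<in>A. P j}" by (rule card_Un_le)
  finally show ?thesis using byz by linarith
qed

text \<open>Each of the two averaged entries gets its own bound: more than \<open>f\<close> entries
  are at most \<open>c'\<close>, which bounds the lower one, and all but at most \<open>f\<close>
  Byzantine entries are at most \<open>c\<close>, which bounds the upper one.\<close>

lemma trimmed_mid_le:
  assumes c: "\<And>j. j \<in> A \<inter> H \<Longrightarrow> w j \<le> c" and c': "f < card {j\<in>A. w j \<le> c'}"
  shows "trimmed_mid f (image_mset w (mset_set A)) \<le> (c + c') / 2"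
proof -
  define xs where "xs = sorted_list_of_multiset (image_mset w (mset_set A))"
  have srt: "sorted xs" by (simp add: xs_def)
  have len: "length xs = card A"
    by (metis xs_def mset_sorted_list_of_multiset size_mset size_image_mset size_mset_set)
  have filt: "length (filter P xs) = card {j\<in>A. P (w j)}" for P
    unfolding xs_def by (rule length_filter_sorted_list_of_image_mset[OF fin])
  have "xs ! f \<le> c'" by (rule sorted_nth_le[OF srt]) (use c' in \<open>simp add: filt\<close>)
  moreover have "xs ! (length xs - f - 1) \<le> c"
    by (rule sorted_nth_le[OF srt])
      (use card_normal_ge[of "\<lambda>j. w j \<le> c"] c big in \<open>simp add: filt len\<close>)
  ultimately show ?thesis unfolding trimmed_mid_def xs_def[symmetric] Let_def by simp
qed

lemma trimmed_mid_ge: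
  assumes c: "\<And>j. j \<in> A \<inter> H \<Longrightarrow> c \<le> w j" and c': "f < card {j\<in>A. c' \<le> w j}"
  shows "(c + c') / 2 \<le> trimmed_mid f (image_mset w (mset_set A))"
proof -
  define xs where "xs = sorted_list_of_multiset (image_mset w (mset_set A))"
  have srt: "sorted xs" by (simp add: xs_def)
  have len: "length xs = card A"
    by (metis xs_def mset_sorted_list_of_multiset size_mset size_image_mset size_mset_set)
  have filt: "length (filter P xs) = card {j\<in>A. P (w j)}" for P
    unfolding xs_def by (rule length_filter_sorted_list_of_image_mset[OF fin])
  have "c \<le> xs ! f"
    by (rule sorted_nth_ge[OF srt])
      (use card_normal_ge[of "\<lambda>j. c \<le> w j"] c big in \<open>simp_all add: filt len\<close>)
  moreover have "c' \<le> xs ! (length xs - f - 1)"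
    by (rule sorted_nth_ge[OF srt]) (use c' big in \<open>simp_all add: filt len\<close>)
  ultimately show ?thesis unfolding trimmed_mid_def xs_def[symmetric] Let_def by simp
qed

end

text \<open>
  All that consensus needs to know about the value \<open>m\<close> that an agent with in-neighbors \<open>N\<close>
  selects from data whose entries at normal agents are \<open>x\<close>. The bounds from below are those
  from above for \<open>- x\<close> and \<open>- m\<close>.
\<close>

definition resilient_above :: "nat \<Rightarrow> 'v set \<Rightarrow> 'v set \<Rightarrow> ('v \<Rightarrow> real) \<Rightarrow> real \<Rightarrow> bool" where
  "resilient_above f N H x m \<longleftrightarrow>
     (\<forall>c. (\<forall>j\<in>H. x j \<le> c) \<longrightarrow> m \<le> c) \<and>
     (\<forall>c c'. (\<forall>j\<in>H. x j \<le> c) \<longrightarrow> f < card {j\<in>N \<inter> H. x j \<le> c'} \<longrightarrow> m \<le> (c + c') / 2)"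

lemma avbrd_resilient:
  fixes u w :: "'v \<Rightarrow> real^'n"
  assumes fin: "finite A" and byz: "card (A - H) \<le> f" and big: "f < card A \<Longrightarrow> 2 * f + 1 \<le> card A"
    and i: "i \<in> H" and w: "\<And>j. j \<in> A \<inter> H \<Longrightarrow> w j = u j"
  shows "resilient_above f A H (\<lambda>j. u j $ l) (avbrd f A (u i) w $ l)"
    and "resilient_above f A H (\<lambda>j. - (u j $ l)) (- (avbrd f A (u i) w $ l))"
proof -
  have "resilient_above f A H (\<lambda>j. u j $ l) (avbrd f A (u i) w $ l) \<and>
    resilient_above f A H (\<lambda>j. - (u j $ l)) (- (avbrd f A (u i) w $ l))"
  proof (cases "f < card A")
    \<comment> \<open>The agent uses its own value, which is that of a normal agent; the second
      clause is vacuous because no set of in-neighbors has more than \<open>f\<close>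
      members.\<close>
    case False
    have "\<not> f < card {j\<in>A \<inter> H. P j}" for P
    proof -
      have "card {j\<in>A \<inter> H. P j} \<le> card A" using fin by (intro card_mono) auto
      then show ?thesis using False by simp
    qed
    then show ?thesis using False i by (auto simp: resilient_above_def avbrd_def)
  next
    case True
    note big = big[OF True]
    have card_le: "card {j\<in>A \<inter> H. P (u j $ l)} \<le> card {j\<in>A. P (w j $ l)}" for P
      using fin w by (intro card_mono) auto
    \<comment> \<open>At least \<open>2 * f + 1\<close> entries, at most \<open>f\<close> of them
      Byzantine, leave \<open>f + 1\<close> normal ones.\<close>
    have half: "f < card {j\<in>A. P (w j $ l)}" if "\<And>j. j \<in> A \<inter> H \<Longrightarrow> P (w j $ l)" for P
      using card_normal_ge[OF fin byz big, of "\<lambda>j. P (w j $ l)", OF that] big by simp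
    have av: "avbrd f A (u i) w $ l = trimmed_mid f (image_mset (\<lambda>j. w j $ l) (mset_set A))"
      using True by (simp add: avbrd_def)
    have 1: "avbrd f A (u i) w $ l \<le> c" if "\<forall>j\<in>H. u j $ l \<le> c" for c
      using trimmed_mid_le[OF fin byz big, of "\<lambda>j. w j $ l" c c] half[of "\<lambda>v. v \<le> c"] that w
      by (simp add: av)
    have 2: "avbrd f A (u i) w $ l \<le> (c + c') / 2"
      if "\<forall>j\<in>H. u j $ l \<le> c" "f < card {j\<in>A \<inter> H. u j $ l \<le> c'}" for c c'
      using trimmed_mid_le[OF fin byz big, of "\<lambda>j. w j $ l" c c'] card_le[of "\<lambda>v. v \<le> c'"] that w
      by (simp add: av)
    have 3: "c \<le> avbrd f A (u i) w $ l" if "\<forall>j\<in>H. c \<le> u j $ l" for c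
      using trimmed_mid_ge[OF fin byz big, of c "\<lambda>j. w j $ l" c] half[of "\<lambda>v. c \<le> v"] that w
      by (simp add: av)
    have 4: "(c + c') / 2 \<le> avbrd f A (u i) w $ l"
      if "\<forall>j\<in>H. c \<le> u j $ l" "f < card {j\<in>A \<inter> H. c' \<le> u j $ l}" for c c'
      using trimmed_mid_ge[OF fin byz big, of c "\<lambda>j. w j $ l" c'] card_le[of "\<lambda>v. c' \<le> v"] that w
      by (simp add: av)
    have "- (avbrd f A (u i) w $ l) \<le> c" if "\<forall>j\<in>H. - (u j $ l) \<le> c" for c
    proof -
      have "- c \<le> avbrd f A (u i) w $ l" by (rule 3) (use that in force)
      then show ?thesis by linarith
    qed
    moreover have "- (avbrd f A (u i) w $ l) \<le> (c + c') / 2"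
      if "\<forall>j\<in>H. - (u j $ l) \<le> c" "f < card {j\<in>A \<inter> H. - (u j $ l) \<le> c'}" for c c'
    proof -
      have "(- c + - c') / 2 \<le> avbrd f A (u i) w $ l"
        by (rule 4) (use that in \<open>force, simp add: minus_le_iff\<close>)
      then show ?thesis by (simp add: field_simps)
    qed
    ultimately show ?thesis using 1 2 unfolding resilient_above_def by blast
  qed
  then show "resilient_above f A H (\<lambda>j. u j $ l) (avbrd f A (u i) w $ l)"
    and "resilient_above f A H (\<lambda>j. - (u j $ l)) (- (avbrd f A (u i) w $ l))" by auto
qed

text \<open>Robustness is applied to \<open>{i}\<close> and its complement. For positive
  \<open>f\<close> the complement cannot be the reachable one, since it would need
  \<open>2 * f + 1\<close> in-neighbors inside a single vertex.\<close>

lemma robust_card_in_nbrs: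
  assumes robust: "r_robust E (2 * f + 1)" and "f < card (in_nbrs E i)"
  shows "2 * f + 1 \<le> card (in_nbrs E i)"
proof (cases "f = 0")
  case False
  then have "in_nbrs E i - {i} \<noteq> {}"
    using assms(2) card_mono[of "{i}" "in_nbrs E i"] by fastforce
  then have "UNIV - {i} \<noteq> {}" by blast
  then consider "r_reachable E (2 * f + 1) {i}" | "r_reachable E (2 * f + 1) (UNIV - {i})"
    using robust[unfolded r_robust_def, THEN spec, of "{i}", THEN spec, of "UNIV - {i}"] by auto
  then show ?thesis
  proof cases
    case 1
    then have "2 * f + 1 \<le> card (in_nbrs E i - {i})" by (simp add: r_reachable_def)
    also have "\<dots> \<le> card (in_nbrs E i)" by (intro card_mono) auto
    finally show ?thesis .
  next
    case 2
    then obtain j where "2 * f + 1 \<le> card (in_nbrs E j - (UNIV - {i}))"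
      by (auto simp: r_reachable_def)
    moreover have "card (in_nbrs E j - (UNIV - {i})) \<le> card {i}" by (intro card_mono) auto
    ultimately show ?thesis using False by simp
  qed
qed (use assms(2) in simp)

section \<open>Consensus of one coordinate\<close>

text \<open>\<open>w\<close> is a coordinate of the auxiliary variable, \<open>wh\<close> its held
  value and \<open>wb\<close> the selected one. In the derivative of \<open>G\<close> the
  disturbance counts twice: once for the agent's own held value and once for those of the
  others.\<close>

locale consensus_above =
  fixes E :: "('v::finite \<times> 'v) set" and f :: nat and Byz H :: "'v set"
    and t0 :: real and T :: ereal and \<mu> :: real and \<epsilon> G :: "real \<Rightarrow> real"
    and w wh wb :: "'v \<Rightarrow> real \<Rightarrow> real"
  assumes H: "H = UNIV - Byz" and attack: "f_local E f Byz"
    and mu: "0 < \<mu>"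
    and w: "\<And>i b. i \<in> H \<Longrightarrow> b \<in> horizon t0 T \<Longrightarrow>
      bounded_primitive t0 b (w i) (\<lambda>t. - \<mu> * (wh i t - wb i t))"
    and close: "\<And>i t. i \<in> H \<Longrightarrow> t \<in> horizon t0 T \<Longrightarrow> \<bar>wh i t - w i t\<bar> \<le> \<epsilon> t"
    and above: "\<And>i t. i \<in> H \<Longrightarrow> t \<in> horizon t0 T \<Longrightarrow>
      resilient_above f (in_nbrs E i) H (\<lambda>j. wh j t) (wb i t)"
    and G: "\<And>b. b \<in> horizon t0 T \<Longrightarrow> bounded_primitive t0 b G (\<lambda>t. 2 * \<mu> * \<epsilon> t)"
    and G_nonpos: "\<And>t. t \<in> horizon t0 T \<Longrightarrow> G t \<le> 0"
begin

lemma wb_le: "i \<in> H \<Longrightarrow> t \<in> horizon t0 T \<Longrightarrow> (\<And>j. j \<in> H \<Longrightarrow> wh j t \<le> c) \<Longrightarrow> wb i t \<le> c"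
  using above unfolding resilient_above_def by blast

lemma wh_le: "i \<in> H \<Longrightarrow> t \<in> horizon t0 T \<Longrightarrow> wh i t \<le> w i t + \<epsilon> t"
  and wh_ge: "i \<in> H \<Longrightarrow> t \<in> horizon t0 T \<Longrightarrow> w i t - \<epsilon> t \<le> wh i t"
  using close by (force simp: abs_le_iff)+

text \<open>
  A point of \<open>H \<times> {a..b}\<close> where some \<open>w i - G\<close> is maximal cannot lie above the values at time
  \<open>a\<close>, since the derivative of \<open>w i - G\<close> pulls it below its own maximum.
\<close>

lemma max_growth:
  assumes b: "b \<in> horizon t0 T" and a: "t0 \<le> a" "a \<le> b"
    and m: "\<And>i. i \<in> H \<Longrightarrow> w i a \<le> m" and i: "i \<in> H"
  shows "w i b \<le> m + G b - G a"
proof (rule ccontr)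
  assume contra: "\<not> w i b \<le> m + G b - G a"
  define y where "y i t = w i t - G t" for i t
  have y: "bounded_primitive t0 b (y i) (\<lambda>t. - \<mu> * (wh i t - wb i t) - 2 * \<mu> * \<epsilon> t)" if "i \<in> H" for i
    unfolding y_def using bounded_primitive_diff[OF w G] that b by blast
  have "continuous_on {a..b} (y i)" if "i \<in> H" for i
    using bounded_primitive_continuous_on[OF bounded_primitive_subinterval[OF y[OF that] a(1) order_refl]] .
  then have "\<exists>t\<in>{a..b}. \<forall>s\<in>{a..b}. y i s \<le> y i t" if "i \<in> H" for i
    using continuous_attains_sup[of "{a..b}" "y i"] that a by auto
  then obtain \<tau> where \<tau>: "\<forall>i\<in>H. \<tau> i \<in> {a..b} \<and> (\<forall>s\<in>{a..b}. y i s \<le> y i (\<tau> i))"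
    by metis
  have "Max ((\<lambda>i. y i (\<tau> i)) ` H) \<in> (\<lambda>i. y i (\<tau> i)) ` H" using i by (intro Max_in) auto
  then obtain k where k: "k \<in> H" "y k (\<tau> k) = Max ((\<lambda>i. y i (\<tau> i)) ` H)" by auto
  define p where "p = y k (\<tau> k)"
  have p: "y j s \<le> p" if "j \<in> H" "s \<in> {a..b}" for j s
  proof -
    have "y j s \<le> y j (\<tau> j)" using \<tau> that by blast
    also have "\<dots> \<le> p" unfolding p_def k(2) using that by (intro Max_ge) auto
    finally show ?thesis .
  qed
  have "m - G a < y i b" using contra by (simp add: y_def)
  also have "\<dots> \<le> p" using p[OF i, of b] a by simp
  finally have mp: "m - G a < p" .
  have \<tau>k: "a \<le> \<tau> k" "\<tau> k \<le> b" using \<tau> k(1) by auto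
  \<comment> \<open>The agent relaxes towards \<open>p\<close> at rate \<open>\<mu>\<close> at best;
    starting strictly below \<open>p\<close>, it cannot attain \<open>p\<close> in finite
    time.\<close>
  have "y k (\<tau> k) \<le> p + (y k a - p) * exp (- \<mu> * (\<tau> k - a))"
  proof (rule bounded_primitive_comparison[OF bounded_primitive_subinterval[OF y[OF k(1)] a(1) \<tau>k(2)] \<tau>k(1)])
    fix t assume t: "t \<in> {a..\<tau> k}"
    then have tb: "t \<in> {a..b}" using \<tau>k by auto
    then have "t \<in> {t0..b}" using a by simp
    then have th: "t \<in> horizon t0 T" using Icc_subset_horizon[OF b] by blast
    have "wb k t \<le> p + G t + \<epsilon> t"
    proof (rule wb_le[OF k(1) th])
      fix j assume "j \<in> H"
      then show "wh j t \<le> p + G t + \<epsilon> t" using wh_le[of j t] p[of j t] th tb by (simp add: y_def)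
    qed
    then have "y k t - p \<le> wh k t - wb k t + 2 * \<epsilon> t" using wh_ge[OF k(1) th] by (simp add: y_def)
    then have "\<mu> * (y k t - p) \<le> \<mu> * (wh k t - wb k t + 2 * \<epsilon> t)" using mu by simp
    then show "- \<mu> * (wh k t - wb k t) - 2 * \<mu> * \<epsilon> t \<le> - \<mu> * (y k t - p)"
      by (simp add: algebra_simps)
  qed
  moreover have "y k a < p" using m[OF k(1)] mp by (simp add: y_def)
  ultimately show False unfolding p_def[symmetric]
    by (simp add: mult_less_0_iff not_le[symmetric] zero_le_mult_iff)
qed

lemma bounded_above:
  obtains B where "\<And>i t. i \<in> H \<Longrightarrow> t \<in> horizon t0 T \<Longrightarrow> w i t \<le> B"
proof -
  have "w i t \<le> Max ((\<lambda>i. w i t0) ` H) - G t0" if "i \<in> H" "t \<in> horizon t0 T" for i t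
    using max_growth[OF that(2), of t0 "Max ((\<lambda>i. w i t0) ` H)" i] that G_nonpos[OF that(2)]
    by (auto simp: horizon_def)
  then show ?thesis using that by blast
qed

section \<open>One unit of time below the ceiling \<open>m + \<kappa>\<close>\<close>

context
  fixes a \<kappa> m :: real
  assumes a: "t0 \<le> a" "a + 1 \<in> horizon t0 T" and kappa: "0 \<le> \<kappa>"
    and small: "\<And>t. t \<in> {a..a + 1} \<Longrightarrow> \<epsilon> t \<le> \<kappa>"
    and ceiling: "\<And>i t. i \<in> H \<Longrightarrow> t \<in> {a..a + 1} \<Longrightarrow> w i t \<le> m + \<kappa>"
begin

lemma unit_in_horizon: "t \<in> {a..a + 1} \<Longrightarrow> t \<in> horizon t0 T"
  using Icc_subset_horizon[OF a(2)] a(1) by auto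

lemma wh_le_ceiling: "i \<in> H \<Longrightarrow> t \<in> {a..a + 1} \<Longrightarrow> wh i t \<le> m + 2 * \<kappa>"
  using wh_le[of i t] ceiling[of i t] small[of t] unit_in_horizon[of t] by simp

text \<open>The agent is attracted at worst to \<open>m + 3 * \<kappa>\<close>: one
  \<open>\<kappa>\<close> from the ceiling, one from the held values of the others, one from its
  own. At rate \<open>\<mu>\<close> a gap \<open>c\<close> keeps the fraction
  \<open>exp (- \<mu>)\<close> over a unit of time.\<close>

lemma below_persists:
  assumes i: "i \<in> H" and c: "w i a \<le> m - c" "0 \<le> c" and t: "t \<in> {a..a + 1}"
  shows "w i t \<le> m + 3 * \<kappa> - c * exp (- \<mu>)"
proof -
  have bp: "bounded_primitive a t (w i) (\<lambda>t. - \<mu> * (wh i t - wb i t))"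
    using bounded_primitive_subinterval[OF w[OF i a(2)], of a t] a(1) t by auto
  have at: "a \<le> t" using t by simp
  have "w i t \<le> m + 3 * \<kappa> + (w i a - (m + 3 * \<kappa>)) * exp (- \<mu> * (t - a))"
  proof (rule bounded_primitive_comparison[OF bp at])
    fix s assume "s \<in> {a..t}"
    then have s: "s \<in> {a..a + 1}" using t by auto
    then have sh: "s \<in> horizon t0 T" by (rule unit_in_horizon)
    have "wb i s \<le> m + 2 * \<kappa>" by (rule wb_le[OF i sh]) (use wh_le_ceiling s in auto)
    then have "w i s - (m + 3 * \<kappa>) \<le> wh i s - wb i s" using wh_ge[OF i sh] small[OF s] by simp
    then show "- \<mu> * (wh i s - wb i s) \<le> - \<mu> * (w i s - (m + 3 * \<kappa>))"
      using mu by simp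
  qed
  also have "\<dots> \<le> m + 3 * \<kappa> + (- c) * exp (- \<mu> * (t - a))"
    using c kappa by (intro add_left_mono mult_right_mono) auto
  also have "\<dots> \<le> m + 3 * \<kappa> - c * exp (- \<mu>)"
  proof -
    have "exp (- \<mu>) \<le> exp (- \<mu> * (t - a))" using mu t mult_left_mono[of "t - a" 1 \<mu>] by simp
    then show ?thesis using c(2) by (simp add: mult_left_mono)
  qed
  finally show ?thesis .
qed

text \<open>More than \<open>f\<close> normal in-neighbors stay well below the ceiling for the whole
  unit of time, so one of the two averaged entries is low and the selected value drops by about half
  of their remaining gap.\<close>

lemma pulled_below:
  assumes i: "i \<in> H" and c: "0 \<le> c" and nbrs: "f < card {j\<in>in_nbrs E i \<inter> H. w j a \<le> m - c}"
  shows "w i (a + 1) \<le> m + 5 * \<kappa> - c * exp (- \<mu>) * (1 - exp (- \<mu>)) / 2"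
proof -
  define \<beta> where "\<beta> = exp (- \<mu>)"
  have bp: "bounded_primitive a (a + 1) (w i) (\<lambda>t. - \<mu> * (wh i t - wb i t))"
    using bounded_primitive_subinterval[OF w[OF i a(2)], of a "a + 1"] a(1) by auto
  \<comment> \<open>Half the sum of \<open>m + 2 * \<kappa>\<close> and
    \<open>m + 4 * \<kappa> - c * \<beta>\<close>, plus \<open>\<kappa>\<close> for the agent's own
    held value, rounded up in the multiple of \<open>\<kappa>\<close>.\<close>
  define d where "d = m + 5 * \<kappa> - c * \<beta> / 2"
  have "w i (a + 1) \<le> d + (w i a - d) * exp (- \<mu> * (a + 1 - a))"
  proof (rule bounded_primitive_comparison[OF bp])
    fix s assume s: "s \<in> {a..a + 1}"
    then have sh: "s \<in> horizon t0 T" by (rule unit_in_horizon)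
    have "{j\<in>in_nbrs E i \<inter> H. w j a \<le> m - c} \<subseteq>
        {j\<in>in_nbrs E i \<inter> H. wh j s \<le> m + 4 * \<kappa> - c * \<beta>}"
    proof
      fix j assume j: "j \<in> {j\<in>in_nbrs E i \<inter> H. w j a \<le> m - c}"
      then have "w j s \<le> m + 3 * \<kappa> - c * \<beta>"
        unfolding \<beta>_def using below_persists[of j c s] c s by auto
      then show "j \<in> {j\<in>in_nbrs E i \<inter> H. wh j s \<le> m + 4 * \<kappa> - c * \<beta>}"
        using j wh_le[of j s] small[OF s] sh by auto
    qed
    then have "f < card {j\<in>in_nbrs E i \<inter> H. wh j s \<le> m + 4 * \<kappa> - c * \<beta>}"
      using nbrs card_mono[OF finite] less_le_trans by blast
    moreover have "\<forall>j\<in>H. wh j s \<le> m + 2 * \<kappa>" using wh_le_ceiling s by blast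
    ultimately have "wb i s \<le> ((m + 2 * \<kappa>) + (m + 4 * \<kappa> - c * \<beta>)) / 2"
      using above[OF i sh] unfolding resilient_above_def by blast
    then have "wb i s \<le> m + 3 * \<kappa> - c * \<beta> / 2" by (simp add: field_simps)
    then have "w i s - d \<le> wh i s - wb i s"
      using wh_ge[OF i sh] small[OF s] kappa by (simp add: d_def)
    then show "- \<mu> * (wh i s - wb i s) \<le> - \<mu> * (w i s - d)" using mu by simp
  qed simp
  also have "\<dots> = d + (w i a - d) * \<beta>" by (simp add: \<beta>_def)
  also have "\<dots> \<le> d + (c * \<beta> / 2) * \<beta>"
    using ceiling[OF i, of a] kappa
    by (intro add_left_mono mult_right_mono) (auto simp: d_def \<beta>_def)
  finally show ?thesis by (simp add: d_def \<beta>_def[symmetric] field_simps)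
qed

text \<open>\<open>\<rho>\<close> is half the factor of \<open>c\<close> in
  \<open>pulled_below\<close>: of the gain \<open>2 * \<rho> * c\<close>, one half pays for the
  error \<open>5 * \<kappa>\<close> and the other is the new margin. Since
  \<open>4 * \<rho> \<le> exp (- \<mu>)\<close>, agents outside the set stay outside.\<close>

lemma reachable_loses_agent:
  assumes c: "0 \<le> c"
    and \<kappa>: "5 * \<kappa> \<le> \<rho> * c" and \<rho>: "\<rho> = exp (- \<mu>) * (1 - exp (- \<mu>)) / 4"
  shows "{i\<in>H. m - \<rho> * c < w i (a + 1)} \<subseteq> {i\<in>H. m - c < w i a}"
    and "r_reachable E (2 * f + 1) {i\<in>H. m - c < w i a} \<Longrightarrow>
      {i\<in>H. m - \<rho> * c < w i (a + 1)} \<subset> {i\<in>H. m - c < w i a}"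
proof -
  let ?A = "{i\<in>H. m - c < w i a}" and ?A' = "{i\<in>H. m - \<rho> * c < w i (a + 1)}"
  have e: "0 < exp (- \<mu>)" "exp (- \<mu>) < 1" using mu by auto
  have "4 * \<rho> \<le> exp (- \<mu>)" unfolding \<rho> using e mult_left_mono[of "1 - exp (- \<mu>)" 1 "exp (- \<mu>)"] by simp
  then have *: "4 * \<rho> * c \<le> exp (- \<mu>) * c" using c by (intro mult_right_mono)
  have \<rho>c: "0 \<le> \<rho> * c" using \<kappa> kappa by linarith
  show sub: "?A' \<subseteq> ?A"
  proof
    fix i assume i: "i \<in> ?A'"
    show "i \<in> ?A"
    proof (rule ccontr)
      assume "i \<notin> ?A"
      then have "w i (a + 1) \<le> m + 3 * \<kappa> - c * exp (- \<mu>)"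
        using i c by (intro below_persists) auto
      also have "\<dots> \<le> m - \<rho> * c"
        using * \<kappa> kappa \<rho>c by (simp add: mult.commute[of c])
      finally show False using i by simp
    qed
  qed
  assume "r_reachable E (2 * f + 1) ?A"
  then obtain i where i: "i \<in> ?A" and reach: "2 * f + 1 \<le> card (in_nbrs E i - ?A)"
    by (auto simp: r_reachable_def)
  \<comment> \<open>Of the \<open>2 * f + 1\<close> in-neighbors outside the set at most
    \<open>f\<close> are Byzantine, which leaves more than \<open>f\<close> normal ones with a
    gap.\<close>
  have "in_nbrs E i - ?A \<subseteq> (in_nbrs E i \<inter> Byz) \<union> {j\<in>in_nbrs E i \<inter> H. w j a \<le> m - c}"
    using H by auto
  then have "card (in_nbrs E i - ?A) \<le> card ((in_nbrs E i \<inter> Byz) \<union> {j\<in>in_nbrs E i \<inter> H. w j a \<le> m - c})"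
    by (intro card_mono) auto
  also have "\<dots> \<le> card (in_nbrs E i \<inter> Byz) + card {j\<in>in_nbrs E i \<inter> H. w j a \<le> m - c}"
    by (rule card_Un_le)
  also have "card (in_nbrs E i \<inter> Byz) \<le> f" using attack H i by (auto simp: f_local_def)
  finally have "f < card {j\<in>in_nbrs E i \<inter> H. w j a \<le> m - c}" using reach by linarith
  then have "w i (a + 1) \<le> m + 5 * \<kappa> - c * exp (- \<mu>) * (1 - exp (- \<mu>)) / 2"
    using i c by (intro pulled_below) auto
  also have "\<dots> = m + 5 * \<kappa> - 2 * (\<rho> * c)" by (simp add: \<rho> field_simps)
  also have "\<dots> \<le> m - \<rho> * c" using \<kappa> by simp
  finally have "i \<notin> ?A'" by simp
  then show "?A' \<subset> ?A" using sub i by blast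
qed

end

text \<open>By \<open>max_growth\<close> the maximum minus \<open>G\<close> never increases, and it
  is bounded below because \<open>G\<close> is nonpositive; so it converges to its infimum
  \<open>m\<close>, and so does the maximum since \<open>G\<close> tends to zero.\<close>

lemma limit_of_max:
  assumes T: "T = \<infinity>" and G0: "(G \<longlongrightarrow> 0) at_top" and ne: "H \<noteq> {}"
    and below: "\<And>i t. i \<in> H \<Longrightarrow> t \<in> horizon t0 T \<Longrightarrow> B \<le> w i t"
  obtains m where "\<And>\<kappa>. 0 < \<kappa> \<Longrightarrow>
    \<forall>\<^sub>F t in at_top. (\<forall>i\<in>H. w i t \<le> m + \<kappa>) \<and> (\<exists>i\<in>H. m - \<kappa> < w i t)"
proof -
  have hor: "t \<in> horizon t0 T \<longleftrightarrow> t0 \<le> t" for t by (simp add: horizon_def T)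
  define \<Phi> where "\<Phi> t = Max ((\<lambda>i. w i t) ` H) - G t" for t
  have max: "w i t \<le> \<Phi> t + G t" if "i \<in> H" for i t
    unfolding \<Phi>_def using that by simp
  have attained: "\<exists>i\<in>H. w i t = \<Phi> t + G t" for t
  proof -
    have "Max ((\<lambda>i. w i t) ` H) \<in> (\<lambda>i. w i t) ` H" using ne by (intro Max_in) auto
    then show ?thesis by (auto simp: \<Phi>_def)
  qed
  have mono: "\<Phi> t \<le> \<Phi> s" if "t0 \<le> s" "s \<le> t" for s t
  proof -
    obtain i where i: "i \<in> H" "w i t = \<Phi> t + G t" using attained by blast
    have "w i t \<le> (\<Phi> s + G s) + G t - G s"
      by (rule max_growth[OF _ that(1,2) max i(1)]) (use that hor in auto)
    then show ?thesis using i by simp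
  qed
  have lower: "B \<le> \<Phi> t" if "t0 \<le> t" for t
  proof -
    obtain i where i: "i \<in> H" "w i t = \<Phi> t + G t" using attained by blast
    then show ?thesis using below[of i t] G_nonpos[of t] that hor by auto
  qed
  define m where "m = Inf (\<Phi> ` {t0..})"
  have bdd: "bdd_below (\<Phi> ` {t0..})" using lower by (auto simp: bdd_below_def)
  have m_le: "m \<le> \<Phi> t" if "t0 \<le> t" for t
    unfolding m_def using bdd that by (intro cInf_lower) auto
  have "\<forall>\<^sub>F t in at_top. (\<forall>i\<in>H. w i t \<le> m + \<kappa>) \<and> (\<exists>i\<in>H. m - \<kappa> < w i t)" if \<kappa>: "0 < \<kappa>" for \<kappa>
  proof -
    have "\<exists>s\<in>{t0..}. \<Phi> s < m + \<kappa>"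
      using cInf_lessD[of "\<Phi> ` {t0..}" "m + \<kappa>"] \<kappa> by (auto simp: m_def)
    then obtain s where s: "t0 \<le> s" "\<Phi> s < m + \<kappa>" by auto
    have "\<forall>\<^sub>F t in at_top. - \<kappa> < G t" using order_tendstoD(1)[OF G0, of "- \<kappa>"] \<kappa> by simp
    moreover have "\<forall>\<^sub>F t in at_top. s \<le> t" by (rule eventually_ge_at_top)
    ultimately show ?thesis
    proof eventually_elim
      case (elim t)
      have "w i t \<le> m + \<kappa>" if "i \<in> H" for i
        using max[OF that, of t] mono[of s t] s elim G_nonpos[of t] hor by auto
      moreover obtain i where "i \<in> H" "w i t = \<Phi> t + G t" using attained by blast
      moreover have "m \<le> \<Phi> t" using m_le s elim by auto
      ultimately show ?case using elim by force
    qed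
  qed
  then show ?thesis using that by blast
qed

end

locale consensus = consensus_above +
  assumes robust: "r_robust E (2 * f + 1)"
    and below: "\<And>i t. i \<in> H \<Longrightarrow> t \<in> horizon t0 T \<Longrightarrow>
      resilient_above f (in_nbrs E i) H (\<lambda>j. - wh j t) (- wb i t)"
    and \<epsilon>_limit: "(\<epsilon> \<longlongrightarrow> 0) at_top" and G_limit: "(G \<longlongrightarrow> 0) at_top"
begin

sublocale neg: consensus_above E f Byz H t0 T \<mu> \<epsilon> G "\<lambda>i t. - w i t" "\<lambda>i t. - wh i t" "\<lambda>i t. - wb i t"
proof
  fix i b assume "i \<in> H" "b \<in> horizon t0 T"
  from bounded_primitive_linear[OF w[OF this] bounded_linear_minus[OF bounded_linear_ident]]
  show "bounded_primitive t0 b (\<lambda>t. - w i t) (\<lambda>t. - \<mu> * (- wh i t - - wb i t))"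
    by (simp add: algebra_simps)
next
  fix i t assume "i \<in> H" "t \<in> horizon t0 T"
  then show "\<bar>- wh i t - - w i t\<bar> \<le> \<epsilon> t" using close by (simp add: abs_minus_commute)
qed (use H attack mu below G G_nonpos in auto)

text \<open>\<open>n\<close> is minus the limit of the minimum, so \<open>m + n\<close> is the
  limiting spread. A positive spread would let the sets near the two extremes lose agents at every
  step, although the limits keep both sets nonempty.\<close>

lemma max_limit_le_min_limit:
  assumes T: "T = \<infinity>"
    and m: "\<And>\<kappa>. 0 < \<kappa> \<Longrightarrow> \<forall>\<^sub>F t in at_top. (\<forall>i\<in>H. w i t \<le> m + \<kappa>) \<and> (\<exists>i\<in>H. m - \<kappa> < w i t)"
    and n: "\<And>\<kappa>. 0 < \<kappa> \<Longrightarrow> \<forall>\<^sub>F t in at_top. (\<forall>i\<in>H. - w i t \<le> n + \<kappa>) \<and> (\<exists>i\<in>H. n - \<kappa> < - w i t)"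
  shows "m + n \<le> 0"
proof (rule ccontr)
  assume "\<not> m + n \<le> 0"
  then have D: "0 < m + n" by simp
  define \<rho> where "\<rho> = exp (- \<mu>) * (1 - exp (- \<mu>)) / 4"
  have e: "0 < exp (- \<mu>)" "exp (- \<mu>) < 1" using mu by auto
  have \<rho>: "0 < \<rho>" "\<rho> \<le> 1" using e mult_le_one[of "exp (- \<mu>)" "1 - exp (- \<mu>)"] by (auto simp: \<rho>_def)
  \<comment> \<open>Margins start at half the spread, which keeps the two sets disjoint, and shrink
    by the factor of \<open>reachable_loses_agent\<close>.\<close>
  define c where "c k = \<rho> ^ k * ((m + n) / 2)" for k :: nat
  have c_Suc: "c (Suc k) = \<rho> * c k" for k by (simp add: c_def)
  have c_pos: "0 < c k" for k using \<rho> D by (simp add: c_def)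
  have c_le: "c k \<le> (m + n) / 2" for k
    using mult_right_mono[of "\<rho> ^ k" 1 "(m + n) / 2"] power_le_one[of \<rho> k] \<rho> D by (simp add: c_def)
  \<comment> \<open>One more step than the two sets together have members to lose.\<close>
  define K where "K = 2 * card H + 1"
  \<comment> \<open>The number of steps is fixed beforehand, so one tolerance satisfies
    \<open>5 * \<kappa> \<le> \<rho> * c k\<close> at all of them.\<close>
  define \<kappa> where "\<kappa> = c K / 5"
  have \<kappa>: "0 < \<kappa>" using c_pos by (simp add: \<kappa>_def)
  have c_ge: "5 * \<kappa> \<le> c k" if "k \<le> K" for k
    unfolding \<kappa>_def c_def using power_decreasing[OF that, of \<rho>] \<rho> D by (simp add: mult_right_mono)
  have "\<forall>\<^sub>F t in at_top. \<epsilon> t < \<kappa>" using order_tendstoD(2)[OF \<epsilon>_limit \<kappa>] .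
  with m[OF \<kappa>] n[OF \<kappa>] eventually_ge_at_top[of t0]
  have "\<forall>\<^sub>F t in at_top. (\<forall>i\<in>H. w i t \<le> m + \<kappa>) \<and> (\<exists>i\<in>H. m - \<kappa> < w i t) \<and>
      (\<forall>i\<in>H. - w i t \<le> n + \<kappa>) \<and> (\<exists>i\<in>H. n - \<kappa> < - w i t) \<and> \<epsilon> t < \<kappa> \<and> t0 \<le> t"
    by eventually_elim auto
  then obtain t1 where t1: "\<And>t. t1 \<le> t \<Longrightarrow>
      (\<forall>i\<in>H. w i t \<le> m + \<kappa>) \<and> (\<exists>i\<in>H. m - \<kappa> < w i t) \<and>
      (\<forall>i\<in>H. - w i t \<le> n + \<kappa>) \<and> (\<exists>i\<in>H. n - \<kappa> < - w i t) \<and> \<epsilon> t < \<kappa> \<and> t0 \<le> t"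
    unfolding eventually_at_top_linorder by blast
  define A B where "A k = {i\<in>H. m - c k < w i (t1 + real k)}"
    and "B k = {i\<in>H. n - c k < - w i (t1 + real k)}" for k
  have Suc_t: "t1 + real (Suc k) = t1 + real k + 1" for k by simp
  have decrease: "card (A (Suc k)) + card (B (Suc k)) < card (A k) + card (B k)" if "Suc k \<le> K" for k
  proof -
    have t: "t1 \<le> s" if "s \<in> {t1 + real k..t1 + real k + 1}" for s
      using that by (auto intro: order_trans)
    have h: "t0 \<le> t1 + real k" "t1 + real k + 1 \<in> horizon t0 T"
      using t1[of "t1 + real k"] by (auto simp: horizon_def T)
    have kap: "5 * \<kappa> \<le> \<rho> * c k" using c_ge[OF that] by (simp add: c_Suc)
    note rla = reachable_loses_agent[OF h less_imp_le[OF \<kappa>] _ _ less_imp_le[OF c_pos] kap \<rho>_def,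
        of m, folded c_Suc Suc_t, folded A_def]
      and rlb = neg.reachable_loses_agent[OF h less_imp_le[OF \<kappa>] _ _ less_imp_le[OF c_pos] kap \<rho>_def,
        of n, folded c_Suc Suc_t, folded B_def]
    have A: "A (Suc k) \<subseteq> A k" "r_reachable E (2 * f + 1) (A k) \<Longrightarrow> A (Suc k) \<subset> A k"
      using rla t1 t by (auto simp add: less_imp_le)
    have B: "B (Suc k) \<subseteq> B k" "r_reachable E (2 * f + 1) (B k) \<Longrightarrow> B (Suc k) \<subset> B k"
      using rlb t1 t by (auto simp add: less_imp_le)
    have "\<kappa> < c k" using c_ge[of k] that \<kappa> by simp
    then have "A k \<noteq> {}" "B k \<noteq> {}"
      using t1[of "t1 + real k"] by (fastforce simp: A_def B_def)+
    \<comment> \<open>Members of \<open>A k\<close> lie above the midpoint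
      \<open>(m - n) / 2\<close>, members of \<open>B k\<close> below it.\<close>
    moreover have "A k \<inter> B k = {}"
      using c_le[of k] by (auto simp: A_def B_def)
    ultimately have "r_reachable E (2 * f + 1) (A k) \<or> r_reachable E (2 * f + 1) (B k)"
      using robust unfolding r_robust_def by blast
    then have "A (Suc k) \<subset> A k \<or> B (Suc k) \<subset> B k" using A B by blast
    moreover have "card (A (Suc k)) \<le> card (A k)" "card (B (Suc k)) \<le> card (B k)"
      using A(1) B(1) by (auto intro: card_mono)
    ultimately show ?thesis
      using psubset_card_mono[OF finite, of "A (Suc k)" "A k"]
        psubset_card_mono[OF finite, of "B (Suc k)" "B k"] by linarith
  qed
  have "card (A k) + card (B k) + k \<le> 2 * card H" if "k \<le> K" for k
    using that
  proof (induction k)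
    case 0
    have "card (A 0) \<le> card H" "card (B 0) \<le> card H"
      by (auto simp: A_def B_def intro: card_mono)
    then show ?case by simp
  next
    case (Suc k)
    then show ?case using decrease[of k] by simp
  qed
  from this[of K] show False by (simp add: K_def)
qed

lemma bounded_data:
  obtains B where "\<And>i t. i \<in> H \<Longrightarrow> t \<in> horizon t0 T \<Longrightarrow> \<bar>w i t\<bar> \<le> B"
proof -
  obtain B1 where "\<And>i t. i \<in> H \<Longrightarrow> t \<in> horizon t0 T \<Longrightarrow> w i t \<le> B1" using bounded_above by blast
  moreover obtain B2 where "\<And>i t. i \<in> H \<Longrightarrow> t \<in> horizon t0 T \<Longrightarrow> - w i t \<le> B2"
    using neg.bounded_above by blast
  ultimately have "\<bar>w i t\<bar> \<le> max B1 B2" if "i \<in> H" "t \<in> horizon t0 T" for i t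
    using that by (fastforce simp: abs_le_iff)
  then show ?thesis using that by blast
qed

lemma eventually_close:
  assumes T: "T = \<infinity>" and e: "0 < e"
  shows "\<forall>\<^sub>F t in at_top. \<forall>i\<in>H. (\<forall>j\<in>H. \<bar>w i t - w j t\<bar> < e) \<and> \<bar>wh i t - wb i t\<bar> < e"
proof (cases "H = {}")
  case False
  obtain B where B: "\<And>i t. i \<in> H \<Longrightarrow> t \<in> horizon t0 T \<Longrightarrow> \<bar>w i t\<bar> \<le> B" using bounded_data by blast
  have B': "- B \<le> w i t" "- B \<le> - w i t" if "i \<in> H" "t \<in> horizon t0 T" for i t
    using B[OF that] by (auto simp: abs_le_iff)
  obtain m where m: "\<And>\<kappa>. 0 < \<kappa> \<Longrightarrow>
      \<forall>\<^sub>F t in at_top. (\<forall>i\<in>H. w i t \<le> m + \<kappa>) \<and> (\<exists>i\<in>H. m - \<kappa> < w i t)"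
    using limit_of_max[OF T G_limit False B'(1)] by blast
  obtain n where n: "\<And>\<kappa>. 0 < \<kappa> \<Longrightarrow>
      \<forall>\<^sub>F t in at_top. (\<forall>i\<in>H. - w i t \<le> n + \<kappa>) \<and> (\<exists>i\<in>H. n - \<kappa> < - w i t)"
    using neg.limit_of_max[OF T G_limit False B'(2)] by blast
  have mn: "m + n \<le> 0" by (rule max_limit_le_min_limit[OF T m n])
  \<comment> \<open>All held and selected values end up in an interval of length
    \<open>m + n + 4 * \<kappa>\<close>, which is at most \<open>e / 2\<close>.\<close>
  define \<kappa> where "\<kappa> = e / 8"
  have \<kappa>: "0 < \<kappa>" using e by (simp add: \<kappa>_def)
  have "\<forall>\<^sub>F t in at_top. \<epsilon> t < \<kappa>" using order_tendstoD(2)[OF \<epsilon>_limit \<kappa>] .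
  with m[OF \<kappa>] n[OF \<kappa>] eventually_ge_at_top[of t0]
  show ?thesis
  proof eventually_elim
    case (elim t)
    then have t: "t \<in> horizon t0 T" by (simp add: horizon_def T)
    have wh: "wh j t \<le> m + 2 * \<kappa>" "- wh j t \<le> n + 2 * \<kappa>" if "j \<in> H" for j
      using wh_le[OF that t] neg.wh_le[OF that t] that elim by force+
    have wb: "wb i t \<le> m + 2 * \<kappa>" "- wb i t \<le> n + 2 * \<kappa>" if "i \<in> H" for i
      using wb_le[OF that t] neg.wb_le[OF that t] wh by blast+
    have "\<bar>w i t - w j t\<bar> < e" if "i \<in> H" "j \<in> H" for i j
    proof -
      have "w i t \<le> m + \<kappa>" "w j t \<le> m + \<kappa>" "- w i t \<le> n + \<kappa>" "- w j t \<le> n + \<kappa>"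
        using elim that by auto
      then show ?thesis using mn e by (simp add: \<kappa>_def)
    qed
    moreover have "\<bar>wh i t - wb i t\<bar> < e" if "i \<in> H" for i
      using wh[OF that] wb[OF that] mn e by (simp add: \<kappa>_def)
    ultimately show ?case by blast
  qed
qed simp

end

section \<open>Boundedness and decay\<close>

lemma bounded_linear_comp:
  assumes "bounded_linear h" "bounded (f ` A)"
  shows "bounded ((\<lambda>t. h (f t)) ` A)"
  using bounded_linear_image[OF assms(2,1)] by (simp add: image_image)

lemma bounded_continuous_comp:
  fixes h :: "'a::heine_borel \<Rightarrow> 'b::metric_space"
  assumes "continuous_on UNIV h" "bounded (f ` A)"
  shows "bounded ((\<lambda>t. h (f t)) ` A)"
proof -
  have "compact (closure (f ` A))" using assms(2) by (simp add: compact_closure)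
  then have "compact (h ` closure (f ` A))"
    using assms(1) by (intro compact_continuous_image) (auto intro: continuous_on_subset)
  moreover have "(\<lambda>t. h (f t)) ` A \<subseteq> h ` closure (f ` A)"
    using closure_subset by fastforce
  ultimately show ?thesis by (meson bounded_subset compact_imp_bounded)
qed

lemma bounded_Pair_image:
  assumes "bounded (f ` A)" "bounded (g ` A)"
  shows "bounded ((\<lambda>t. (f t, g t)) ` A)"
  by (rule bounded_subset[OF bounded_Times[OF assms]]) auto

lemma bounded_vec_image:
  fixes f :: "'b \<Rightarrow> 'a::real_normed_vector^'n"
  assumes "\<And>i. bounded ((\<lambda>t. f t $ i) ` A)"
  shows "bounded (f ` A)"
proof -
  have "\<forall>i. \<exists>b. \<forall>t\<in>A. norm (f t $ i) \<le> b" using assms by (auto simp: bounded_iff)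
  then obtain b where b: "\<forall>i. \<forall>t\<in>A. norm (f t $ i) \<le> b i" by metis
  have "norm (f t) \<le> (\<Sum>i\<in>UNIV. b i)" if "t \<in> A" for t
  proof -
    have "norm (f t) \<le> (\<Sum>i\<in>UNIV. norm (f t $ i))" unfolding norm_vec_def by (rule L2_set_le_sum) simp
    also have "\<dots> \<le> (\<Sum>i\<in>UNIV. b i)" using b that by (intro sum_mono) auto
    finally show ?thesis .
  qed
  then show ?thesis by (auto simp: bounded_iff)
qed

lemma bilinear_inner: "bilinear ((\<bullet>) :: 'a::euclidean_space \<Rightarrow> 'a \<Rightarrow> real)"
  by (simp add: bilinear_conv_bounded_bilinear bounded_bilinear_inner)

text \<open>A Barbalat argument: if \<open>s\<close> has norm at least \<open>e\<close> at some
  time, it keeps norm at least \<open>e / 2\<close> for a fixed duration, and \<open>V\<close> loses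
  a fixed amount. This is impossible once \<open>V\<close> is within that amount of its
  infimum.\<close>

lemma tendsto_zero_if_square_integrable_lipschitz:
  fixes s :: "real \<Rightarrow> 'a::euclidean_space" and V :: "real \<Rightarrow> real"
  assumes V: "\<And>b. t0 \<le> b \<Longrightarrow> bounded_primitive t0 b V (\<lambda>t. - k * (s t \<bullet> s t))"
    and V_nonneg: "\<And>t. t0 \<le> t \<Longrightarrow> 0 \<le> V t" and k: "0 < k"
    and L: "\<And>t u. t0 \<le> t \<Longrightarrow> t \<le> u \<Longrightarrow> norm (s u - s t) \<le> L * (u - t)"
  shows "(s \<longlongrightarrow> 0) at_top"
proof (rule tendstoI)
  fix e :: real assume e: "0 < e"
  \<comment> \<open>Within this time the Lipschitz bound allows a change of at most
    \<open>e / 2\<close>.\<close>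
  define \<delta> where "\<delta> = e / (2 * (\<bar>L\<bar> + 1))"
  have \<delta>: "0 < \<delta>" using e by (simp add: \<delta>_def)
  define c where "c = k * (e / 2)\<^sup>2 * \<delta>"
  have c: "0 < c" using e k \<delta> by (simp add: c_def)
  have dec: "V u - V t \<le> - d * (u - t)"
    if "t0 \<le> t" "t \<le> u" "\<And>r. r \<in> {t..u} \<Longrightarrow> d \<le> k * (s r \<bullet> s r)" for t u d
    by (rule bounded_primitive_nonincreasing[OF V that(1,2) order_refl]) (use that in auto)
  define \<nu> where "\<nu> = Inf (V ` {t0..})"
  have bdd: "bdd_below (V ` {t0..})" using V_nonneg by (auto simp: bdd_below_def)
  have \<nu>: "\<nu> \<le> V t" if "t0 \<le> t" for t
    unfolding \<nu>_def using bdd that by (intro cInf_lower) auto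
  have "\<exists>t\<in>{t0..}. V t < \<nu> + c"
    using cInf_lessD[of "V ` {t0..}" "\<nu> + c"] c by (auto simp: \<nu>_def)
  then obtain t1 where t1: "t0 \<le> t1" "V t1 < \<nu> + c" by auto
  have "dist (s t) 0 < e" if t: "t1 \<le> t" for t
  proof (rule ccontr)
    assume "\<not> dist (s t) 0 < e"
    then have big: "e \<le> norm (s t)" by simp
    have t0: "t0 \<le> t" using t t1 by simp
    have "k * (e / 2)\<^sup>2 \<le> k * (s r \<bullet> s r)" if r: "r \<in> {t..t + \<delta>}" for r
    proof -
      have "norm (s r - s t) \<le> L * (r - t)" using L[of t r] t0 r by simp
      also have "\<dots> \<le> \<bar>L\<bar> * \<delta>" using r by (intro mult_mono) auto
      also have "\<dots> \<le> e / 2" unfolding \<delta>_def using e by (simp add: field_simps)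
      finally have "e / 2 \<le> norm (s r)" using big norm_triangle_ineq2[of "s t" "s r"]
        by (simp add: norm_minus_commute)
      then have "(e / 2)\<^sup>2 \<le> (norm (s r))\<^sup>2" using e by (intro power_mono) auto
      then show ?thesis using k by (simp add: power2_norm_eq_inner)
    qed
    then have "V (t + \<delta>) - V t \<le> - (k * (e / 2)\<^sup>2) * (t + \<delta> - t)"
      using dec[of t "t + \<delta>" "k * (e / 2)\<^sup>2"] t0 \<delta> by simp
    moreover have "V t - V t1 \<le> - 0 * (t - t1)"
      by (rule dec) (use t t1 k in auto)
    ultimately have "V (t + \<delta>) < \<nu>" using t1 by (simp add: c_def)
    then show False using \<nu>[of "t + \<delta>"] t0 \<delta> by simp
  qed
  then show "\<forall>\<^sub>F t in at_top. dist (s t) 0 < e"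
    unfolding eventually_at_top_linorder by blast
qed

text \<open>Once \<open>h\<close> has norm below \<open>\<mu> * e / 2\<close>, Young's inequality
  makes the squared norm of \<open>r\<close> relax at rate \<open>\<mu>\<close> to a level of at
  most \<open>e\<^sup>2 / 4\<close>.\<close>

lemma tendsto_zero_of_stable_linear:
  fixes r h :: "real \<Rightarrow> 'a::euclidean_space"
  assumes r: "\<And>b. t0 \<le> b \<Longrightarrow> bounded_primitive t0 b r (\<lambda>t. h t - \<mu> *\<^sub>R r t)"
    and \<mu>: "0 < \<mu>" and h: "(h \<longlongrightarrow> 0) at_top"
  shows "(r \<longlongrightarrow> 0) at_top"
proof (rule tendstoI)
  fix e :: real assume e: "0 < e"
  have "0 < \<mu> * e / 2" using \<mu> e by simp
  from tendstoD[OF h this] obtain t2 where t2: "\<And>t. t2 \<le> t \<Longrightarrow> norm (h t) < \<mu> * e / 2"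
    by (auto simp: eventually_at_top_linorder)
  define t1 where "t1 = max t0 t2"
  define x where "x t = r t \<bullet> r t" for t
  have x: "x t \<le> e\<^sup>2 / 4 + (x t1 - e\<^sup>2 / 4) * exp (- \<mu> * (t - t1))" if t: "t1 \<le> t" for t
  proof (rule bounded_primitive_comparison[OF _ t])
    have "t0 \<le> t" "t0 \<le> t1" using t by (auto simp: t1_def)
    then have "bounded_primitive t1 t r (\<lambda>t. h t - \<mu> *\<^sub>R r t)"
      using bounded_primitive_subinterval[OF r order.trans order_refl] by auto
    from bounded_primitive_bilinear[OF bilinear_inner this this]
    show "bounded_primitive t1 t x (\<lambda>u. (h u - \<mu> *\<^sub>R r u) \<bullet> r u + r u \<bullet> (h u - \<mu> *\<^sub>R r u))"
      unfolding x_def .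
    fix u assume "u \<in> {t1..t}"
    then have "norm (h u) \<le> \<mu> * e / 2" using t2[of u] by (simp add: t1_def)
    then have "(norm (h u))\<^sup>2 \<le> (\<mu> * e / 2)\<^sup>2" by (intro power_mono) auto
    then have hh: "h u \<bullet> h u \<le> \<mu>\<^sup>2 * e\<^sup>2 / 4"
      by (simp add: power2_norm_eq_inner power_mult_distrib power_divide)
    \<comment> \<open>Expanding this square is Young's inequality for
      \<open>h u \<bullet> r u\<close>.\<close>
    have "0 \<le> (h u - \<mu> *\<^sub>R r u) \<bullet> (h u - \<mu> *\<^sub>R r u)" by simp
    also have "\<dots> = h u \<bullet> h u - 2 * \<mu> * (h u \<bullet> r u) + \<mu>\<^sup>2 * x u"
      by (simp add: inner_diff_left inner_diff_right inner_commute x_def power2_eq_square algebra_simps)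
    finally have "\<mu> * (2 * (h u \<bullet> r u)) \<le> \<mu> * (\<mu> * e\<^sup>2 / 4 + \<mu> * x u)"
      using hh by (simp add: power2_eq_square algebra_simps)
    then have "2 * (h u \<bullet> r u) \<le> \<mu> * e\<^sup>2 / 4 + \<mu> * x u" using \<mu> by simp
    then show "(h u - \<mu> *\<^sub>R r u) \<bullet> r u + r u \<bullet> (h u - \<mu> *\<^sub>R r u) \<le> - \<mu> * (x u - e\<^sup>2 / 4)"
      by (simp add: inner_diff_left inner_diff_right inner_commute x_def algebra_simps)
  qed
  have "LIM t at_top. \<mu> * (t - t1) :> at_top"
    using \<mu> by (intro filterlim_tendsto_pos_mult_at_top[OF tendsto_const]
        filterlim_tendsto_add_at_top[of "\<lambda>_. - t1", OF tendsto_const filterlim_ident, simplified]) auto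
  then have "((\<lambda>t. exp (- (\<mu> * (t - t1)))) \<longlongrightarrow> 0) at_top"
    by (intro filterlim_compose[OF exp_at_bot] filterlim_uminus_at_bot_at_top[THEN filterlim_compose])
  then have "((\<lambda>t. e\<^sup>2 / 4 + (x t1 - e\<^sup>2 / 4) * exp (- (\<mu> * (t - t1)))) \<longlongrightarrow> e\<^sup>2 / 4 + (x t1 - e\<^sup>2 / 4) * 0) at_top"
    by (intro tendsto_intros)
  moreover have "e\<^sup>2 / 4 + (x t1 - e\<^sup>2 / 4) * 0 < e\<^sup>2" using e by simp
  ultimately have "\<forall>\<^sub>F t in at_top. e\<^sup>2 / 4 + (x t1 - e\<^sup>2 / 4) * exp (- (\<mu> * (t - t1))) < e\<^sup>2"
    by (rule order_tendstoD)
  then show "\<forall>\<^sub>F t in at_top. dist (r t) 0 < e"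
    using eventually_ge_at_top[of t1]
  proof eventually_elim
    case (elim t)
    then have "(norm (r t))\<^sup>2 < e\<^sup>2" using x[of t] by (simp add: x_def power2_norm_eq_inner)
    then show ?case using e by (simp add: power2_less_imp_less)
  qed
qed

text \<open>The quadratic form attains a positive minimum over the compact product of the closure of
  \<open>Q\<close> with the unit sphere; homogeneity extends the bound to all vectors.\<close>

lemma pos_def_uniform:
  fixes M :: "'a::euclidean_space \<Rightarrow> real^'n^'n"
  assumes cont: "continuous_on UNIV M" and pd: "\<And>x. pos_def (M x)" and Q: "bounded Q"
  obtains m where "0 < m" "\<And>x p. x \<in> Q \<Longrightarrow> m * (p \<bullet> p) \<le> p \<bullet> (M x *v p)"
proof (cases "Q = {}")
  case True
  then show ?thesis using that[of 1] by simp
next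
  case False
  define K where "K = closure Q \<times> sphere (0::real^'n) 1"
  define F where "F z = snd z \<bullet> (M (fst z) *v snd z)" for z :: "'a \<times> (real^'n)"
  have "compact K" unfolding K_def using Q by (intro compact_Times compact_sphere) (simp add: compact_closure)
  moreover have "K \<noteq> {}" using False by (simp add: K_def)
  moreover have "continuous_on K F"
    unfolding F_def
    by (intro continuous_intros bounded_bilinear.continuous_on[OF bounded_bilinear_matrix_vector_mult]
        continuous_on_compose2[OF cont]) auto
  ultimately obtain z where z: "z \<in> K" and zmin: "\<forall>y\<in>K. F z \<le> F y"
    using continuous_attains_inf[of K F] by blast
  have "snd z \<noteq> 0" using z by (auto simp: K_def)
  then have m: "0 < F z" using pd by (auto simp: F_def pos_def_def)
  have "F z * (p \<bullet> p) \<le> p \<bullet> (M x *v p)" if x: "x \<in> Q" for x p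
  proof (cases "p = 0")
    case False
    define u where "u = (1 / norm p) *\<^sub>R p"
    have "(x, u) \<in> K" using x False closure_subset by (auto simp: K_def u_def)
    then have "F z \<le> u \<bullet> (M x *v u)" using zmin by (force simp: F_def)
    then have "F z * (p \<bullet> p) \<le> (u \<bullet> (M x *v u)) * (norm p * norm p)"
      by (simp add: mult_right_mono power2_norm_eq_inner[symmetric] power2_eq_square)
    also have "\<dots> = (norm p *\<^sub>R u) \<bullet> (M x *v (norm p *\<^sub>R u))"
      by (simp add: matrix_vector_mult_scaleR)
    also have "norm p *\<^sub>R u = p" using False by (simp add: u_def)
    finally show ?thesis .
  qed simp
  with m show ?thesis by (rule that)
qed

section \<open>Euler--Lagrange agents\<close>

lemma symmetric_matrix_inner:
  fixes A :: "real^'n^'n"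
  assumes "transpose A = A"
  shows "x \<bullet> (A *v y) = y \<bullet> (A *v x)"
  by (metis assms dot_lmul_matrix inner_commute transpose_matrix_vector)

text \<open>Polarization: an entry is the bilinear form at two axis vectors \<open>a\<close> and
  \<open>b\<close>, and the squared norms of \<open>a + b\<close> and \<open>a - b\<close> sum to
  4.\<close>

lemma symmetric_matrix_entry_le:
  fixes A :: "real^'n^'n"
  assumes sym: "transpose A = A" and c: "\<And>p. \<bar>p \<bullet> (A *v p)\<bar> \<le> c * (p \<bullet> p)"
  shows "\<bar>A $ i $ j\<bar> \<le> c"
proof -
  let ?a = "axis i (1::real) :: real^'n" and ?b = "axis j (1::real) :: real^'n"
  have entry: "A $ i $ j = ?a \<bullet> (A *v ?b)"
    by (simp add: inner_axis' matrix_vector_mult_basis column_def)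
  have "4 * (?a \<bullet> (A *v ?b)) = (?a + ?b) \<bullet> (A *v (?a + ?b)) - (?a - ?b) \<bullet> (A *v (?a - ?b))"
    using symmetric_matrix_inner[OF sym, of ?b ?a]
    by (simp add: matrix_vector_right_distrib matrix_vector_mult_diff_distrib inner_add_left
        inner_add_right inner_diff_left inner_diff_right)
  moreover have "c * ((?a + ?b) \<bullet> (?a + ?b)) + c * ((?a - ?b) \<bullet> (?a - ?b)) = 4 * c"
    by (simp add: inner_add_left inner_add_right inner_diff_left inner_diff_right inner_axis_axis
        inner_commute algebra_simps)
  ultimately have "4 * \<bar>?a \<bullet> (A *v ?b)\<bar> \<le> 4 * c"
    using c[of "?a + ?b"] c[of "?a - ?b"] by linarith
  then show ?thesis using entry by simp
qed

locale el_agent =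
  fixes M :: "real^'n \<Rightarrow> real^'n^'n" and C :: "real^'n \<Rightarrow> real^'n \<Rightarrow> real^'n^'n"
    and g :: "real^'n \<Rightarrow> real^'n"
    and \<Omega> :: "real^'n \<Rightarrow> real^'n \<Rightarrow> real^'n \<Rightarrow> real^'n \<Rightarrow> real^'l^'n"
    and \<phi> :: "real^'l"
  assumes EL: "euler_lagrange M C g \<Omega>"
    and regression: "\<And>x dx y z. M x *v y + C x dx *v z + g x = \<Omega> x dx y z *v \<phi>"
begin

lemma M_symmetric: "transpose (M x) = M x" and M_pos_def: "pos_def (M x)"
  and M_has_derivative: "(M has_derivative frechet_derivative M (at x)) (at x)"
  and skew: "p \<bullet> ((frechet_derivative M (at x) dx - 2 *\<^sub>R C x dx) *v p) = 0"
  and \<Omega>_continuous: "continuous_on UNIV (\<lambda>(x, dx, y, z). \<Omega> x dx y z)"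
  using EL by (auto simp: euler_lagrange_def frechet_derivative_works)

lemma M_continuous: "continuous_on UNIV M"
  unfolding continuous_on_eq_continuous_within
  using has_derivative_continuous[OF M_has_derivative] by blast

text \<open>The skew-symmetry property controls only the quadratic form of this derivative; symmetry
  lets the form control the whole matrix.\<close>

lemma M_derivative_symmetric:
  "transpose (frechet_derivative M (at x) dx) = frechet_derivative M (at x) dx"
proof -
  have "bounded_linear (transpose :: real^'n^'n \<Rightarrow> real^'n^'n)"
    by (simp add: linear_conv_bounded_linear[symmetric] linear_iff transpose_def vec_eq_iff)
  then have "((\<lambda>y. transpose (M y)) has_derivative (\<lambda>dx. transpose (frechet_derivative M (at x) dx))) (at x)"
    using M_has_derivative by (rule bounded_linear.has_derivative)
  then have "(\<lambda>dx. transpose (frechet_derivative M (at x) dx)) = frechet_derivative M (at x)"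
    unfolding M_symmetric using M_has_derivative by (rule has_derivative_unique)
  then show ?thesis by (rule fun_cong)
qed

lemma M_derivative_inner: "p \<bullet> (frechet_derivative M (at x) dx *v p) = 2 * (p \<bullet> (C x dx *v p))"
  using skew[of p x dx]
  by (simp add: matrix_vector_mult_diff_rdistrib inner_diff_right flip: scaleR_matrix_vector_assoc)

lemma \<Omega>_image_bounded:
  assumes "bounded (x ` A)" "bounded (dx ` A)" "bounded (y ` A)" "bounded (z ` A)"
  shows "bounded ((\<lambda>t. \<Omega> (x t) (dx t) (y t) (z t)) ` A)"
  using bounded_continuous_comp[OF \<Omega>_continuous, of "\<lambda>t. (x t, dx t, y t, z t)" A]
    bounded_Pair_image[OF assms(1) bounded_Pair_image[OF assms(2) bounded_Pair_image[OF assms(3,4)]]]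
  by simp

lemma regression_image_bounded:
  assumes "bounded (x ` A)" "bounded (dx ` A)" "bounded (y ` A)" "bounded (z ` A)" "bounded (p ` A)"
  shows "bounded ((\<lambda>t. \<Omega> (x t) (dx t) (y t) (z t) *v p t) ` A)"
  by (intro bounded_bilinear_image[OF bounded_bilinear_matrix_vector_mult] \<Omega>_image_bounded assms)

text \<open>The derivative of \<open>M\<close> is not known to be continuous. Instead,
  \<open>C\<close> is bounded through the regressor, skew symmetry transfers the bound to the
  quadratic form of the derivative, and polarization to its entries.\<close>

lemma M_derivative_image_bounded:
  assumes "bounded (x ` A)" "bounded (dx ` A)"
  shows "bounded ((\<lambda>t. frechet_derivative M (at (x t)) (dx t)) ` A)"
proof -
  have const: "bounded ((\<lambda>t. c) ` A)" for c :: "real^'n" by (auto simp: image_constant_conv)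
  have "bounded ((\<lambda>t. C (x t) (dx t) *v axis j 1) ` A)" for j
  proof -
    \<comment> \<open>A column of \<open>C\<close> is a difference of two regression identities, in
      which \<open>g\<close> cancels.\<close>
    have "C (x t) (dx t) *v axis j 1 = \<Omega> (x t) (dx t) 0 (axis j 1) *v \<phi> - \<Omega> (x t) (dx t) 0 0 *v \<phi>" for t
      by (simp flip: regression)
    then show ?thesis
      by (simp, intro bounded_minus_comp regression_image_bounded assms const)
        (auto simp: image_constant_conv)
  qed
  then have "bounded ((\<lambda>t. (C (x t) (dx t) *v axis j 1) $ i) ` A)" for i j
    using bounded_linear_comp[OF bounded_linear_vec_nth] by blast
  then have "bounded ((\<lambda>t. C (x t) (dx t) $ i $ j) ` A)" for i j
    by (simp add: matrix_vector_mult_basis column_def)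
  then have "bounded ((\<lambda>t. C (x t) (dx t)) ` A)" by (intro bounded_vec_image)
  then obtain c where c: "\<forall>t\<in>A. norm (C (x t) (dx t)) \<le> c" by (auto simp: bounded_iff)
  obtain K where K: "0 < K" "\<And>(B :: real^'n^'n) y. norm (B *v y) \<le> norm B * norm y * K"
    using bounded_bilinear.pos_bounded[OF bounded_bilinear_matrix_vector_mult] by blast
  have entry: "\<bar>frechet_derivative M (at (x t)) (dx t) $ i $ j\<bar> \<le> 2 * (c * K)" if t: "t \<in> A" for t i j
  proof (rule symmetric_matrix_entry_le[OF M_derivative_symmetric])
    fix p :: "real^'n"
    have "\<bar>p \<bullet> (C (x t) (dx t) *v p)\<bar> \<le> norm p * norm (C (x t) (dx t) *v p)"
      by (rule Cauchy_Schwarz_ineq2)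
    also have "\<dots> \<le> norm p * (norm (C (x t) (dx t)) * norm p * K)" by (intro mult_left_mono K) auto
    also have "\<dots> \<le> norm p * (c * norm p * K)"
      using c t K(1) by (intro mult_left_mono mult_right_mono) auto
    also have "\<dots> = (c * K) * (p \<bullet> p)" by (simp add: power2_norm_eq_inner[symmetric] power2_eq_square)
    finally show "\<bar>p \<bullet> (frechet_derivative M (at (x t)) (dx t) *v p)\<bar> \<le> 2 * (c * K) * (p \<bullet> p)"
      by (simp add: M_derivative_inner)
  qed
  show ?thesis
    by (intro bounded_vec_image) (use entry in \<open>auto simp: bounded_iff\<close>)
qed

end

text \<open>
  \<open>e\<close> is the deviation of the observer from the internal model \<open>\<eta>' = S \<eta>\<close>. Positive definiteness
  of the inertia matrix is only pointwise, so the Lyapunov function \<open>V\<close> bounds \<open>s\<close> on a bounded set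
  of positions only; therefore \<open>q - \<eta>\<close> is bounded first, by adding a multiple of \<open>V\<close> that absorbs
  the input \<open>s\<close> of its dynamics.
\<close>

locale el_tracking = el_agent M C g \<Omega> \<phi>
  for M :: "real^'n \<Rightarrow> real^'n^'n" and C g and \<Omega> :: "real^'n \<Rightarrow> real^'n \<Rightarrow> real^'n \<Rightarrow> real^'n \<Rightarrow> real^'l^'n"
    and \<phi> +
  fixes S :: "real^'n^'n" and \<mu> k F t0 :: real and T :: ereal
    and q dq ddq \<eta> d\<eta> v dv s \<tau> :: "real \<Rightarrow> real^'n" and \<phi>h d\<phi>h :: "real \<Rightarrow> real^'l"
  assumes gains: "0 < \<mu>" "0 < k" "0 < F"
    and q: "\<And>t. t \<in> horizon t0 T \<Longrightarrow> (q has_vector_derivative dq t) (at t within horizon t0 T)"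
    and dq: "caratheodory_deriv t0 T dq ddq"
    and plant: "\<And>t. t \<in> horizon t0 T \<Longrightarrow>
      M (q t) *v ddq t + C (q t) (dq t) *v dq t + g (q t) = \<tau> t"
    and \<eta>: "\<And>b. b \<in> horizon t0 T \<Longrightarrow> bounded_primitive t0 b \<eta> d\<eta>"
    and v: "\<And>t. t \<in> horizon t0 T \<Longrightarrow> v t = S *v \<eta> t - \<mu> *\<^sub>R (q t - \<eta> t)"
    and dv: "\<And>t. t \<in> horizon t0 T \<Longrightarrow> dv t = S *v d\<eta> t - \<mu> *\<^sub>R (dq t - d\<eta> t)"
    and s: "\<And>t. t \<in> horizon t0 T \<Longrightarrow> s t = dq t - v t"
    and \<tau>: "\<And>t. t \<in> horizon t0 T \<Longrightarrow>
      \<tau> t = - k *\<^sub>R s t + \<Omega> (q t) (dq t) (dv t) (v t) *v \<phi>h t"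
    and \<phi>h: "caratheodory_deriv t0 T \<phi>h d\<phi>h"
    and adaptation: "\<And>t. t \<in> horizon t0 T \<Longrightarrow>
      d\<phi>h t = - F *\<^sub>R (transpose (\<Omega> (q t) (dq t) (dv t) (v t)) *v s t)"
    and \<eta>_bounded: "bounded (\<eta> ` horizon t0 T)"
    and e_bounded: "bounded ((\<lambda>t. d\<eta> t - S *v \<eta> t) ` horizon t0 T)"
begin

abbreviation "I \<equiv> horizon t0 T"

lemma v_dv_bounded:
  assumes "A \<subseteq> I" "bounded (q ` A)" "bounded (dq ` A)" "bounded (\<eta> ` A)" "bounded (d\<eta> ` A)"
  shows "bounded (v ` A)" "bounded (dv ` A)"
proof -
  have S: "bounded_linear ((*v) S)" by simp
  have "bounded ((\<lambda>t. S *v \<eta> t - \<mu> *\<^sub>R (q t - \<eta> t)) ` A)"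
    by (intro bounded_minus_comp bounded_scaleR_comp bounded_linear_comp[OF S] assms)
  moreover have "v ` A = (\<lambda>t. S *v \<eta> t - \<mu> *\<^sub>R (q t - \<eta> t)) ` A"
    using v assms(1) by (intro image_cong) auto
  ultimately show "bounded (v ` A)" by simp
  have "bounded ((\<lambda>t. S *v d\<eta> t - \<mu> *\<^sub>R (dq t - d\<eta> t)) ` A)"
    by (intro bounded_minus_comp bounded_scaleR_comp bounded_linear_comp[OF S] assms)
  moreover have "dv ` A = (\<lambda>t. S *v d\<eta> t - \<mu> *\<^sub>R (dq t - d\<eta> t)) ` A"
    using dv assms(1) by (intro image_cong) auto
  ultimately show "bounded (dv ` A)" by simp
qed

text \<open>The plant equation gives \<open>M (q t) *v ddq t\<close> as a bounded expression.
  Pairing it with \<open>ddq t\<close> and using uniform positive definiteness on the bounded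
  positions inverts \<open>M\<close> without a bound on its inverse.\<close>

lemma ddq_bounded:
  assumes A: "A \<subseteq> I" "bounded (q ` A)" "bounded (dq ` A)" "bounded (\<eta> ` A)" "bounded (d\<eta> ` A)"
    and \<phi>hA: "bounded (\<phi>h ` A)"
  shows "bounded (ddq ` A)"
proof -
  note vdv = v_dv_bounded[OF A]
  define R where "R t = - k *\<^sub>R (dq t - v t) + \<Omega> (q t) (dq t) (dv t) (v t) *v \<phi>h t
      - \<Omega> (q t) (dq t) 0 (dq t) *v \<phi>" for t
  have "bounded (R ` A)"
    unfolding R_def
    by (intro bounded_minus_comp bounded_plus_comp bounded_scaleR_comp regression_image_bounded
        assms vdv) (auto simp: image_constant_conv)
  then obtain r where r: "\<forall>t\<in>A. norm (R t) \<le> r" by (auto simp: bounded_iff)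
  have R: "M (q t) *v ddq t = R t" if "t \<in> A" for t
  proof -
    have t: "t \<in> I" using that A(1) by auto
    have "M (q t) *v ddq t = \<tau> t - (C (q t) (dq t) *v dq t + g (q t))"
      using plant[OF t] by (simp add: algebra_simps)
    also have "C (q t) (dq t) *v dq t + g (q t) = \<Omega> (q t) (dq t) 0 (dq t) *v \<phi>"
      using regression[of "q t" 0 "dq t" "dq t"] by simp
    finally show ?thesis by (simp add: R_def \<tau>[OF t] s[OF t])
  qed
  obtain m where m: "0 < m" "\<And>x p. x \<in> q ` A \<Longrightarrow> m * (p \<bullet> p) \<le> p \<bullet> (M x *v p)"
    using pos_def_uniform[OF M_continuous M_pos_def A(2)] by blast
  have "norm (ddq t) \<le> r / m" if t: "t \<in> A" for t
  proof (cases "ddq t = 0")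
    case False
    have "m * (norm (ddq t) * norm (ddq t)) \<le> ddq t \<bullet> R t"
      using m(2)[of "q t" "ddq t"] R[OF t] t
      by (simp add: power2_norm_eq_inner[symmetric] power2_eq_square)
    also have "\<dots> \<le> norm (ddq t) * norm (R t)" by (rule norm_cauchy_schwarz)
    also have "\<dots> \<le> norm (ddq t) * r" using r t by (intro mult_left_mono) auto
    finally have "norm (ddq t) * (m * norm (ddq t)) \<le> norm (ddq t) * r" by (simp add: mult_ac)
    then have "m * norm (ddq t) \<le> r" using False by simp
    then show ?thesis using m(1) by (simp add: field_simps)
  next
    case True
    have "0 \<le> r" using r t norm_ge_zero order_trans by blast
    then show ?thesis using True m(1) by simp
  qed
  then show ?thesis by (auto simp: bounded_iff)
qed

context
  fixes b assumes b: "b \<in> I"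
begin

lemma Icc_subset: "{t0..b} \<subseteq> I"
  using Icc_subset_horizon[OF b] .

lemma in_I: "t \<in> {t0..b} \<Longrightarrow> t \<in> I"
  using Icc_subset by blast

lemma q_derivative: "t \<in> {t0..b} \<Longrightarrow> (q has_vector_derivative dq t) (at t within {t0..b})"
  using q in_I Icc_subset has_vector_derivative_within_subset by blast

lemma image_bounded_if_continuous: "continuous_on {t0..b} x \<Longrightarrow> bounded (x ` {t0..b})"
  for x :: "real \<Rightarrow> 'c::euclidean_space"
  by (auto intro: compact_imp_bounded compact_continuous_image)

lemma caratheodory_integral: "caratheodory_deriv t0 T x dx \<Longrightarrow> t \<in> {t0..b} \<Longrightarrow>
    (dx has_integral (x t - x t0)) {t0..t}"
  using in_I by (auto simp: caratheodory_deriv_def)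

text \<open>On a compact interval continuity suffices, except for \<open>d\<eta>\<close>, whose
  bound is assumed. This opens the calculus of bounded primitives before any global bound on the
  plant is known.\<close>

lemma local_bounds:
  "bounded (q ` {t0..b})" "bounded (dq ` {t0..b})" "bounded (\<eta> ` {t0..b})" "bounded (d\<eta> ` {t0..b})"
  "bounded (\<phi>h ` {t0..b})"
proof -
  have "continuous_on {t0..b} q"
    unfolding continuous_on_eq_continuous_within
    using has_vector_derivative_continuous[OF q_derivative] by blast
  then show "bounded (q ` {t0..b})" by (rule image_bounded_if_continuous)
  show "bounded (dq ` {t0..b})" "bounded (\<phi>h ` {t0..b})"
    using primitive_continuous_on[OF caratheodory_integral[OF dq]]
      primitive_continuous_on[OF caratheodory_integral[OF \<phi>h]] image_bounded_if_continuous by auto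
  show "bounded (\<eta> ` {t0..b})"
    by (intro image_bounded_if_continuous bounded_primitive_continuous_on[OF \<eta>[OF b]])
  show "bounded (d\<eta> ` {t0..b})" using \<eta>[OF b] by (simp add: bounded_primitive_def)
qed

lemmas local_v_dv_bounded = v_dv_bounded[OF Icc_subset local_bounds(1-4)]

lemma q_primitive: "bounded_primitive t0 b q dq"
  using q_derivative local_bounds(2) by (rule bounded_primitive_vector_derivative)

lemma dq_primitive: "bounded_primitive t0 b dq ddq"
  using caratheodory_integral[OF dq] ddq_bounded[OF Icc_subset local_bounds]
  by (simp add: bounded_primitive_def)

lemma s_primitive: "bounded_primitive t0 b s (\<lambda>t. ddq t - dv t)"
proof -
  have S: "bounded_linear ((*v) S)" by simp
  have "bounded_primitive t0 b (\<lambda>t. dq t - (S *v \<eta> t - \<mu> *\<^sub>R (q t - \<eta> t)))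
      (\<lambda>t. ddq t - (S *v d\<eta> t - \<mu> *\<^sub>R (dq t - d\<eta> t)))"
    by (intro bounded_primitive_diff dq_primitive bounded_primitive_linear[OF \<eta>[OF b] S]
        bounded_primitive_linear[OF _ bounded_linear_scaleR_right] q_primitive \<eta>[OF b])
  then show ?thesis by (rule bounded_primitive_cong) (use in_I s v dv in auto)
qed

lemma M_primitive:
  "bounded_primitive t0 b (\<lambda>t. M (q t)) (\<lambda>t. frechet_derivative M (at (q t)) (dq t))"
proof (rule bounded_primitive_vector_derivative)
  fix t assume "t \<in> {t0..b}"
  then have "((M \<circ> q) has_vector_derivative frechet_derivative M (at (q t)) (dq t)) (at t within {t0..b})"
    by (rule vector_derivative_diff_chain_within[OF q_derivative has_derivative_at_withinI[OF M_has_derivative]])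
  then show "((\<lambda>t. M (q t)) has_vector_derivative frechet_derivative M (at (q t)) (dq t)) (at t within {t0..b})"
    by (simp add: o_def)
qed (intro M_derivative_image_bounded local_bounds)

lemma \<phi>h_primitive: "bounded_primitive t0 b \<phi>h d\<phi>h"
proof -
  have sb: "bounded (s ` {t0..b})"
    by (intro image_bounded_if_continuous bounded_primitive_continuous_on[OF s_primitive])
  have "bounded_linear (transpose :: real^'l^'n \<Rightarrow> real^'n^'l)"
    by (simp add: linear_conv_bounded_linear[symmetric] linear_iff transpose_def vec_eq_iff)
  then have "bounded ((\<lambda>t. - F *\<^sub>R (transpose (\<Omega> (q t) (dq t) (dv t) (v t)) *v s t)) ` {t0..b})"
    by (intro bounded_scaleR_comp bounded_bilinear_image[OF bounded_bilinear_matrix_vector_mult]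
        bounded_linear_comp[of transpose] \<Omega>_image_bounded local_bounds local_v_dv_bounded sb)
  moreover have "d\<phi>h ` {t0..b} = (\<lambda>t. - F *\<^sub>R (transpose (\<Omega> (q t) (dq t) (dv t) (v t)) *v s t)) ` {t0..b}"
    by (intro image_cong refl adaptation in_I)
  ultimately show ?thesis
    using caratheodory_integral[OF \<phi>h] by (simp add: bounded_primitive_def)
qed

end

definition V :: "real \<Rightarrow> real" where
  "V t = 1 / 2 * (s t \<bullet> (M (q t) *v s t)) + 1 / (2 * F) * ((\<phi>h t - \<phi>) \<bullet> (\<phi>h t - \<phi>))"

text \<open>Two cancellations leave only the damping: skew symmetry matches half the derivative of
  \<open>M\<close> with \<open>C\<close>, and the weight \<open>1 / (2 * F)\<close> makes the
  adaptation term cancel the regressor acting on the parameter error.\<close>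

lemma V_primitive:
  assumes b: "b \<in> I"
  shows "bounded_primitive t0 b V (\<lambda>t. - k * (s t \<bullet> s t))"
proof -
  have Ms: "bounded_primitive t0 b (\<lambda>t. M (q t) *v s t)
      (\<lambda>t. frechet_derivative M (at (q t)) (dq t) *v s t + M (q t) *v (ddq t - dv t))"
    by (rule bounded_primitive_bilinear[OF bilinear_matrix_vector_mult M_primitive[OF b] s_primitive[OF b]])
  have \<phi>: "bounded_primitive t0 b (\<lambda>t. \<phi>h t - \<phi>) (\<lambda>t. d\<phi>h t - 0)"
    by (intro bounded_primitive_diff \<phi>h_primitive[OF b] bounded_primitive_const)
  have "bounded_primitive t0 b V (\<lambda>t.
      1 / 2 * ((ddq t - dv t) \<bullet> (M (q t) *v s t) +
        s t \<bullet> (frechet_derivative M (at (q t)) (dq t) *v s t + M (q t) *v (ddq t - dv t))) +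
      1 / (2 * F) * ((d\<phi>h t - 0) \<bullet> (\<phi>h t - \<phi>) + (\<phi>h t - \<phi>) \<bullet> (d\<phi>h t - 0)))"
    unfolding V_def
    by (intro bounded_primitive_add bounded_primitive_linear[OF _ bounded_linear_mult_right]
        bounded_primitive_bilinear[OF bilinear_inner] s_primitive[OF b] Ms \<phi>)
  then show ?thesis
  proof (rule bounded_primitive_cong)
    fix t assume "t \<in> {t0..b}"
    then have t: "t \<in> I" by (rule in_I[OF b])
    define W where "W = \<Omega> (q t) (dq t) (dv t) (v t)"
    \<comment> \<open>The regression identity at the reference signals \<open>dv\<close> and
      \<open>v\<close> is subtracted from the plant equation.\<close>
    have "M (q t) *v (ddq t - dv t) + C (q t) (dq t) *v s t = \<tau> t - W *v \<phi>"
    proof -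
      have W: "M (q t) *v dv t + C (q t) (dq t) *v v t + g (q t) = W *v \<phi>"
        unfolding W_def by (rule regression)
      show ?thesis
        unfolding s[OF t] plant[OF t, symmetric] W[symmetric]
        by (simp add: matrix_vector_mult_diff_distrib)
    qed
    also have "\<dots> = - k *\<^sub>R s t + W *v (\<phi>h t - \<phi>)"
      by (simp add: \<tau>[OF t] W_def matrix_vector_mult_diff_distrib)
    finally have dyn: "s t \<bullet> (M (q t) *v (ddq t - dv t)) + s t \<bullet> (C (q t) (dq t) *v s t)
        = - k * (s t \<bullet> s t) + s t \<bullet> (W *v (\<phi>h t - \<phi>))"
      by (metis inner_add_right inner_scaleR_right)
    have "d\<phi>h t \<bullet> (\<phi>h t - \<phi>) = - F * (s t \<bullet> (W *v (\<phi>h t - \<phi>)))"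
      by (simp add: adaptation[OF t] W_def dot_lmul_matrix)
    then have ad: "1 / (2 * F) * ((d\<phi>h t - 0) \<bullet> (\<phi>h t - \<phi>) + (\<phi>h t - \<phi>) \<bullet> (d\<phi>h t - 0))
        = - (s t \<bullet> (W *v (\<phi>h t - \<phi>)))"
      using gains(3) by (simp add: inner_commute[of "\<phi>h t - \<phi>"] field_simps)
    have kin: "1 / 2 * ((ddq t - dv t) \<bullet> (M (q t) *v s t) +
        s t \<bullet> (frechet_derivative M (at (q t)) (dq t) *v s t + M (q t) *v (ddq t - dv t)))
        = s t \<bullet> (M (q t) *v (ddq t - dv t)) + s t \<bullet> (C (q t) (dq t) *v s t)"
      using symmetric_matrix_inner[OF M_symmetric, of "ddq t - dv t" "q t" "s t"]
      by (simp add: inner_add_right M_derivative_inner)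
    show "- k * (s t \<bullet> s t) = 1 / 2 * ((ddq t - dv t) \<bullet> (M (q t) *v s t) +
        s t \<bullet> (frechet_derivative M (at (q t)) (dq t) *v s t + M (q t) *v (ddq t - dv t))) +
      1 / (2 * F) * ((d\<phi>h t - 0) \<bullet> (\<phi>h t - \<phi>) + (\<phi>h t - \<phi>) \<bullet> (d\<phi>h t - 0))"
      unfolding kin ad dyn by simp
  qed simp
qed

lemma M_inner_nonneg: "0 \<le> p \<bullet> (M x *v p)"
  using M_pos_def[of x] by (cases "p = 0") (auto simp: pos_def_def less_imp_le)

lemma V_ge: "1 / 2 * (s t \<bullet> (M (q t) *v s t)) \<le> V t"
  "1 / (2 * F) * ((\<phi>h t - \<phi>) \<bullet> (\<phi>h t - \<phi>)) \<le> V t"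
  using M_inner_nonneg[of "s t" "q t"] gains(3) by (auto simp: V_def)

lemma V_nonneg: "0 \<le> V t"
  using V_ge(1)[of t] M_inner_nonneg[of "s t" "q t"] by linarith

lemma V_le_initial:
  assumes "t \<in> I"
  shows "V t \<le> V t0"
proof -
  have "V t - V t0 \<le> 0 * (t - t0)"
    using assms gains by (intro bounded_primitive_nonincreasing[OF V_primitive[OF assms]])
      (auto simp: horizon_def)
  then show ?thesis by simp
qed

lemma r_primitive:
  assumes b: "b \<in> I"
  shows "bounded_primitive t0 b (\<lambda>t. q t - \<eta> t)
    (\<lambda>t. (s t - (d\<eta> t - S *v \<eta> t)) - \<mu> *\<^sub>R (q t - \<eta> t))"
  by (rule bounded_primitive_cong[OF bounded_primitive_diff[OF q_primitive[OF b] \<eta>[OF b]]])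
    (use in_I[OF b] in \<open>auto simp: s v\<close>)

lemma q_minus_\<eta>_bounded: "bounded ((\<lambda>t. q t - \<eta> t) ` I)"
proof -
  obtain U where U: "\<forall>t\<in>I. norm (d\<eta> t - S *v \<eta> t) \<le> U" using e_bounded by (auto simp: bounded_iff)
  define r e where "r t = q t - \<eta> t" and "e t = d\<eta> t - S *v \<eta> t" for t
  \<comment> \<open>With this weight the derivative of the \<open>V\<close> term is
    \<open>- (2 / \<mu>) * (s t \<bullet> s t)\<close>, exactly what Young's inequality produces
    from the input \<open>s\<close>.\<close>
  define x where "x t = r t \<bullet> r t + 2 / (\<mu> * k) * V t" for t
  \<comment> \<open>The first term compensates for \<open>V\<close> inside \<open>x\<close>, since
    \<open>V t \<le> V t0\<close>; the second absorbs the observer deviation.\<close>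
  define c where "c = 2 / (\<mu> * k) * V t0 + 2 * U\<^sup>2 / \<mu>\<^sup>2"
  have x_le: "x b \<le> c + \<bar>x t0 - c\<bar>" if b: "b \<in> I" for b
  proof -
    have r: "bounded_primitive t0 b r (\<lambda>t. (s t - e t) - \<mu> *\<^sub>R r t)"
      unfolding r_def e_def by (rule r_primitive[OF b])
    have x: "bounded_primitive t0 b x (\<lambda>t. (((s t - e t) - \<mu> *\<^sub>R r t) \<bullet> r t +
        r t \<bullet> ((s t - e t) - \<mu> *\<^sub>R r t)) + 2 / (\<mu> * k) * (- k * (s t \<bullet> s t)))"
      unfolding x_def
      by (intro bounded_primitive_add bounded_primitive_linear[OF _ bounded_linear_mult_right]
          bounded_primitive_bilinear[OF bilinear_inner] r V_primitive[OF b])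
    have tb: "t0 \<le> b" using b by (simp add: horizon_def)
    have "x b \<le> c + (x t0 - c) * exp (- \<mu> * (b - t0))"
    proof (rule bounded_primitive_comparison[OF x tb])
      fix t assume "t \<in> {t0..b}"
      then have t: "t \<in> I" by (rule in_I[OF b])
      have young: "2 * (a \<bullet> r t) \<le> \<mu> / 2 * (r t \<bullet> r t) + 2 / \<mu> * (a \<bullet> a)" for a
      proof -
        have "0 \<le> (2 *\<^sub>R a - \<mu> *\<^sub>R r t) \<bullet> (2 *\<^sub>R a - \<mu> *\<^sub>R r t)" by simp
        also have "\<dots> = 2 * \<mu> * (\<mu> / 2 * (r t \<bullet> r t) + 2 / \<mu> * (a \<bullet> a) - 2 * (a \<bullet> r t))"
          using gains(1) by (simp add: inner_diff_left inner_diff_right inner_commute field_simps)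
        finally show ?thesis using gains(1) by (simp add: zero_le_mult_iff)
      qed
      have "(norm (e t))\<^sup>2 \<le> U\<^sup>2" using U t by (intro power_mono) (auto simp: e_def)
      then have eU: "2 / \<mu> * (e t \<bullet> e t) \<le> 2 / \<mu> * U\<^sup>2"
        using gains(1) by (intro mult_left_mono) (auto simp: power2_norm_eq_inner)
      have "2 / k * V t \<le> 2 / k * V t0"
        using V_le_initial[OF t] gains(2) by (intro mult_left_mono) auto
      moreover have "- \<mu> * (x t - c) = - \<mu> * (r t \<bullet> r t) - 2 / k * V t + 2 / k * V t0 + 2 / \<mu> * U\<^sup>2"
        using gains by (simp add: x_def c_def field_simps power2_eq_square)
      moreover have "2 / (\<mu> * k) * (- k * (s t \<bullet> s t)) = - (2 / \<mu> * (s t \<bullet> s t))"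
        using gains by (simp add: field_simps)
      moreover have "((s t - e t) - \<mu> *\<^sub>R r t) \<bullet> r t + r t \<bullet> ((s t - e t) - \<mu> *\<^sub>R r t)
          = 2 * (s t \<bullet> r t) + 2 * ((- e t) \<bullet> r t) - 2 * \<mu> * (r t \<bullet> r t)"
        by (simp add: inner_diff_left inner_diff_right inner_commute)
      ultimately show "(((s t - e t) - \<mu> *\<^sub>R r t) \<bullet> r t + r t \<bullet> ((s t - e t) - \<mu> *\<^sub>R r t)) +
          2 / (\<mu> * k) * (- k * (s t \<bullet> s t)) \<le> - \<mu> * (x t - c)"
        using young[of "s t"] young[of "- e t"] eU by simp
    qed
    also have "(x t0 - c) * exp (- \<mu> * (b - t0)) \<le> \<bar>x t0 - c\<bar> * exp (- \<mu> * (b - t0))"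
      by (intro mult_right_mono) auto
    also have "\<dots> \<le> \<bar>x t0 - c\<bar> * 1" using gains(1) tb by (intro mult_left_mono) auto
    finally show ?thesis by simp
  qed
  have "norm (r t) \<le> sqrt (c + \<bar>x t0 - c\<bar>)" if t: "t \<in> I" for t
  proof (rule real_le_rsqrt)
    have "0 \<le> 2 / (\<mu> * k) * V t" using gains V_nonneg by simp
    then show "(norm (r t))\<^sup>2 \<le> c + \<bar>x t0 - c\<bar>"
      using x_le[OF t] by (simp add: x_def power2_norm_eq_inner)
  qed
  then show ?thesis by (auto simp: bounded_iff r_def)
qed

lemma q_bounded: "bounded (q ` I)"
  using bounded_plus_comp[OF q_minus_\<eta>_bounded \<eta>_bounded] by simp

lemma d\<eta>_bounded: "bounded (d\<eta> ` I)"
  using bounded_plus_comp[OF e_bounded bounded_linear_comp[of "(*v) S", OF _ \<eta>_bounded]] by simp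

text \<open>Positions are bounded by now, so the inertia matrix is uniformly positive definite along
  the motion and \<open>V\<close> controls \<open>s\<close>.\<close>

lemma s_bounded: "bounded (s ` I)"
proof -
  obtain m where m: "0 < m" "\<And>x p. x \<in> q ` I \<Longrightarrow> m * (p \<bullet> p) \<le> p \<bullet> (M x *v p)"
    using pos_def_uniform[OF M_continuous M_pos_def q_bounded] by blast
  have "norm (s t) \<le> sqrt (2 * V t0 / m)" if t: "t \<in> I" for t
  proof (rule real_le_rsqrt)
    have "m * (s t \<bullet> s t) \<le> s t \<bullet> (M (q t) *v s t)" using m(2) t by blast
    also have "\<dots> \<le> 2 * V t0" using V_ge(1)[of t] V_le_initial[OF t] by simp
    finally show "(norm (s t))\<^sup>2 \<le> 2 * V t0 / m"
      using m(1) by (simp add: power2_norm_eq_inner field_simps)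
  qed
  then show ?thesis by (auto simp: bounded_iff)
qed

lemma \<phi>h_bounded: "bounded (\<phi>h ` I)"
proof -
  have "norm (\<phi>h t - \<phi>) \<le> sqrt (2 * F * V t0)" if t: "t \<in> I" for t
  proof (rule real_le_rsqrt)
    have "1 / (2 * F) * ((\<phi>h t - \<phi>) \<bullet> (\<phi>h t - \<phi>)) \<le> V t0"
      using V_ge(2)[of t] V_le_initial[OF t] by simp
    then show "(norm (\<phi>h t - \<phi>))\<^sup>2 \<le> 2 * F * V t0"
      using gains(3) by (simp add: power2_norm_eq_inner field_simps)
  qed
  then have "bounded ((\<lambda>t. \<phi>h t - \<phi>) ` I)" by (auto simp: bounded_iff)
  moreover have "bounded ((\<lambda>t. \<phi>) ` I)" by (auto simp: image_constant_conv)
  ultimately show ?thesis using bounded_plus_comp[of "\<lambda>t. \<phi>h t - \<phi>" I "\<lambda>t. \<phi>"] by simp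
qed

lemma dq_bounded: "bounded (dq ` I)"
proof -
  have "bounded ((\<lambda>t. s t + (S *v \<eta> t - \<mu> *\<^sub>R (q t - \<eta> t))) ` I)"
    by (intro bounded_plus_comp bounded_minus_comp bounded_scaleR_comp s_bounded q_bounded \<eta>_bounded
        bounded_linear_comp[of "(*v) S"]) simp
  moreover have "dq ` I = (\<lambda>t. s t + (S *v \<eta> t - \<mu> *\<^sub>R (q t - \<eta> t))) ` I"
    by (intro image_cong refl) (simp add: s v)
  ultimately show ?thesis by simp
qed

lemma s_tendsto_zero:
  assumes T: "T = \<infinity>"
  shows "(s \<longlongrightarrow> 0) at_top"
proof -
  have I: "t \<in> I \<longleftrightarrow> t0 \<le> t" for t by (simp add: horizon_def T)
  have "bounded ((\<lambda>t. ddq t - dv t) ` I)"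
    by (intro bounded_minus_comp ddq_bounded v_dv_bounded order_refl q_bounded dq_bounded \<eta>_bounded
        d\<eta>_bounded \<phi>h_bounded)
  then obtain L where L: "\<forall>t\<in>I. norm (ddq t - dv t) \<le> L" by (auto simp: bounded_iff)
  show ?thesis
  proof (rule tendsto_zero_if_square_integrable_lipschitz)
    show "bounded_primitive t0 b V (\<lambda>t. - k * (s t \<bullet> s t))" if "t0 \<le> b" for b
      using that by (intro V_primitive) (simp add: I)
    show "norm (s u - s t) \<le> L * (u - t)" if "t0 \<le> t" "t \<le> u" for t u
    proof -
      have "u \<in> I" using that by (simp add: I)
      from s_primitive[OF this] that(1,2) order_refl show ?thesis
        by (rule bounded_primitive_norm_diff_le) (use L that I in auto)
    qed
  qed (use V_nonneg gains in auto)
qed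

lemma q_minus_\<eta>_tendsto_zero:
  assumes T: "T = \<infinity>" and e: "((\<lambda>t. d\<eta> t - S *v \<eta> t) \<longlongrightarrow> 0) at_top"
  shows "((\<lambda>t. q t - \<eta> t) \<longlongrightarrow> 0) at_top"
proof (rule tendsto_zero_of_stable_linear)
  show "bounded_primitive t0 b (\<lambda>t. q t - \<eta> t)
      (\<lambda>t. (s t - (d\<eta> t - S *v \<eta> t)) - \<mu> *\<^sub>R (q t - \<eta> t))" if "t0 \<le> b" for b
    using that by (intro r_primitive) (simp add: horizon_def T)
  show "((\<lambda>t. s t - (d\<eta> t - S *v \<eta> t)) \<longlongrightarrow> 0) at_top"
    using tendsto_diff[OF s_tendsto_zero[OF T] e] by simp
qed (use gains in auto)

end

section \<open>The network of observers\<close>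

context
  fixes \<alpha>\<^sub>1 \<alpha>\<^sub>2 \<alpha>\<^sub>3 t0 :: real
  assumes gains: "0 < \<alpha>\<^sub>1" "1 < \<alpha>\<^sub>2" "1 < \<alpha>\<^sub>3"
begin

lemma threshold_pos: "t0 \<le> t \<Longrightarrow> 0 < threshold \<alpha>\<^sub>1 \<alpha>\<^sub>2 \<alpha>\<^sub>3 t0 t"
  using gains by (simp add: threshold_def)

lemma threshold_antimono:
  "t0 \<le> r \<Longrightarrow> r \<le> t \<Longrightarrow> threshold \<alpha>\<^sub>1 \<alpha>\<^sub>2 \<alpha>\<^sub>3 t0 t \<le> threshold \<alpha>\<^sub>1 \<alpha>\<^sub>2 \<alpha>\<^sub>3 t0 r"
  unfolding threshold_def using gains by (intro divide_left_mono powr_mono2) auto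

lemma threshold_continuous: "continuous_on {t0..} (threshold \<alpha>\<^sub>1 \<alpha>\<^sub>2 \<alpha>\<^sub>3 t0)"
  unfolding threshold_def using gains by (intro continuous_intros) auto

lemma shifted_powr_limit:
  assumes "p < 0"
  shows "((\<lambda>t. c * (t - t0 + \<alpha>\<^sub>2) powr p) \<longlongrightarrow> 0) at_top"
proof -
  have "LIM t at_top. (\<alpha>\<^sub>2 - t0) + t :> at_top"
    by (intro filterlim_tendsto_add_at_top[OF tendsto_const filterlim_ident])
  then have "LIM t at_top. t - t0 + \<alpha>\<^sub>2 :> at_top" by (simp add: algebra_simps)
  then show ?thesis
    by (intro tendsto_mult_right_zero tendsto_neg_powr assms)
qed

lemma threshold_limit: "(threshold \<alpha>\<^sub>1 \<alpha>\<^sub>2 \<alpha>\<^sub>3 t0 \<longlongrightarrow> 0) at_top"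
  using shifted_powr_limit[of "- \<alpha>\<^sub>3" \<alpha>\<^sub>1] gains
  by (simp add: threshold_def[abs_def] powr_minus_divide)

text \<open>The antiderivative normalized to vanish at infinity, which is possible because the
  exponent \<open>1 - \<alpha>\<^sub>3\<close> is negative; this makes it nonpositive.\<close>

definition threshold_primitive :: "real \<Rightarrow> real" where
  "threshold_primitive t = - \<alpha>\<^sub>1 / (\<alpha>\<^sub>3 - 1) * (t - t0 + \<alpha>\<^sub>2) powr (1 - \<alpha>\<^sub>3)"

lemma threshold_primitive_nonpos: "threshold_primitive t \<le> 0"
  using gains by (simp add: threshold_primitive_def)

lemma threshold_primitive_limit: "(threshold_primitive \<longlongrightarrow> 0) at_top"
  using shifted_powr_limit[of "1 - \<alpha>\<^sub>3" "- \<alpha>\<^sub>1 / (\<alpha>\<^sub>3 - 1)"] gains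
  by (simp add: threshold_primitive_def[abs_def])

lemma threshold_primitive:
  "bounded_primitive t0 b threshold_primitive (threshold \<alpha>\<^sub>1 \<alpha>\<^sub>2 \<alpha>\<^sub>3 t0)"
proof (rule bounded_primitive_vector_derivative)
  fix t assume "t \<in> {t0..b}"
  then have pos: "0 < t - t0 + \<alpha>\<^sub>2" using gains by simp
  have "(threshold_primitive has_real_derivative
      - \<alpha>\<^sub>1 / (\<alpha>\<^sub>3 - 1) * ((1 - \<alpha>\<^sub>3) * (t - t0 + \<alpha>\<^sub>2) powr (1 - \<alpha>\<^sub>3 - 1))) (at t within {t0..b})"
    unfolding threshold_primitive_def using pos gains
    by (auto intro!: derivative_eq_intros)
  also have "- \<alpha>\<^sub>1 / (\<alpha>\<^sub>3 - 1) * ((1 - \<alpha>\<^sub>3) * (t - t0 + \<alpha>\<^sub>2) powr (1 - \<alpha>\<^sub>3 - 1)) = threshold \<alpha>\<^sub>1 \<alpha>\<^sub>2 \<alpha>\<^sub>3 t0 t"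
  proof -
    have "- \<alpha>\<^sub>1 / (\<alpha>\<^sub>3 - 1) * (1 - \<alpha>\<^sub>3) = \<alpha>\<^sub>1" using gains by (simp add: field_simps)
    then show ?thesis using pos by (simp add: threshold_def powr_minus_divide mult.assoc[symmetric])
  qed
  finally show "(threshold_primitive has_vector_derivative threshold \<alpha>\<^sub>1 \<alpha>\<^sub>2 \<alpha>\<^sub>3 t0 t) (at t within {t0..b})"
    by (simp add: has_real_derivative_iff_has_vector_derivative)
next
  have "continuous_on {t0..b} (threshold \<alpha>\<^sub>1 \<alpha>\<^sub>2 \<alpha>\<^sub>3 t0)"
    using threshold_continuous by (rule continuous_on_subset) auto
  then show "bounded (threshold \<alpha>\<^sub>1 \<alpha>\<^sub>2 \<alpha>\<^sub>3 t0 ` {t0..b})"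
    by (auto intro: compact_imp_bounded compact_continuous_image)
qed

end

text \<open>The observers with held values expressed in the auxiliary variable. Entries of
  \<open>data\<close> from Byzantine agents are unconstrained, even in their time dependence;
  integrability enters only through the solution property of \<open>\<eta>\<close>.\<close>

locale observer_network =
  fixes E :: "('v::finite \<times> 'v) set" and f :: nat and Byz H :: "'v set"
    and S :: "real^'n^'n" and \<mu> \<alpha>\<^sub>1 \<alpha>\<^sub>2 \<alpha>\<^sub>3 t0 :: real and T :: ereal
    and \<eta> d\<eta> U :: "'v \<Rightarrow> real \<Rightarrow> real^'n" and data :: "'v \<Rightarrow> real \<Rightarrow> 'v \<Rightarrow> real^'n"
  assumes H: "H = UNIV - Byz" and attack: "f_local E f Byz" and robust: "r_robust E (2 * f + 1)"
    and S: "semisimple_matrix S" and S_spectrum: "\<And>z. complex_eigenvalue S z \<Longrightarrow> Re z = 0"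
    and gains: "0 < \<mu>" "0 < \<alpha>\<^sub>1" "1 < \<alpha>\<^sub>2" "1 < \<alpha>\<^sub>3" and T: "ereal t0 < T"
    and \<eta>: "\<And>i. i \<in> H \<Longrightarrow> caratheodory_deriv t0 T (\<eta> i) (d\<eta> i)"
    and U: "\<And>i t. i \<in> H \<Longrightarrow> t \<in> horizon t0 T \<Longrightarrow>
      U i t = mat_exp ((- last_trigger S (threshold \<alpha>\<^sub>1 \<alpha>\<^sub>2 \<alpha>\<^sub>3 t0) t0 T (\<eta> i) t) *\<^sub>R S) *v
        \<eta> i (last_trigger S (threshold \<alpha>\<^sub>1 \<alpha>\<^sub>2 \<alpha>\<^sub>3 t0) t0 T (\<eta> i) t)"
    and data: "\<And>i j t. i \<in> H \<Longrightarrow> j \<in> in_nbrs E i \<inter> H \<Longrightarrow> t \<in> horizon t0 T \<Longrightarrow> data i t j = U j t"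
    and observer: "\<And>i t. i \<in> H \<Longrightarrow> t \<in> horizon t0 T \<Longrightarrow>
      d\<eta> i t = S *v \<eta> i t - \<mu> *\<^sub>R (mat_exp (t *\<^sub>R S) *v (U i t - avbrd f (in_nbrs E i) (U i t) (data i t)))"
begin

abbreviation "I \<equiv> horizon t0 T"
abbreviation "\<theta> \<equiv> threshold \<alpha>\<^sub>1 \<alpha>\<^sub>2 \<alpha>\<^sub>3 t0"
abbreviation "tlast i \<equiv> last_trigger S \<theta> t0 T (\<eta> i)"

definition W :: "'v \<Rightarrow> real \<Rightarrow> real^'n" where
  "W i t = mat_exp ((- t) *\<^sub>R S) *v \<eta> i t"

definition selected :: "'v \<Rightarrow> real \<Rightarrow> real^'n" where
  "selected i t = avbrd f (in_nbrs E i) (U i t) (data i t)"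

lemma \<eta>_continuous: "i \<in> H \<Longrightarrow> b \<in> I \<Longrightarrow> continuous_on {t0..b} (\<eta> i)"
  by (rule primitive_continuous_on[of _ _ "d\<eta> i"])
    (use \<eta> Icc_subset_horizon[of b t0 T] in \<open>auto simp: caratheodory_deriv_def\<close>)

lemma event_trigger: "i \<in> H \<Longrightarrow> event_trigger S \<theta> t0 T (\<eta> i)"
  by unfold_locales
    (use S T \<eta>_continuous threshold_continuous threshold_pos threshold_antimono gains in auto)

lemma tlast_bounds: "i \<in> H \<Longrightarrow> t \<in> I \<Longrightarrow> tlast i t \<in> {t0..t}"
  using event_trigger.last_trigger_bounds[OF event_trigger] .

lemma tlast_in: "i \<in> H \<Longrightarrow> t \<in> I \<Longrightarrow> tlast i t \<in> I"
  using tlast_bounds Icc_subset_horizon by blast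

lemma U_eq: "i \<in> H \<Longrightarrow> t \<in> I \<Longrightarrow> U i t = W i (tlast i t)"
  by (simp add: U W_def)

lemma \<eta>_eq: "\<eta> i t = mat_exp (t *\<^sub>R S) *v W i t"
  unfolding W_def mat_exp_cancel[OF S] ..

lemma selected_resilient:
  assumes i: "i \<in> H" and t: "t \<in> I"
  shows "resilient_above f (in_nbrs E i) H (\<lambda>j. U j t $ l) (selected i t $ l)"
    and "resilient_above f (in_nbrs E i) H (\<lambda>j. - (U j t $ l)) (- (selected i t $ l))"
proof -
  have "in_nbrs E i - H = in_nbrs E i \<inter> Byz" using H by auto
  then have "card (in_nbrs E i - H) \<le> f" using attack H i by (simp add: f_local_def)
  from avbrd_resilient[OF finite this robust_card_in_nbrs[OF robust] i data[OF i _ t]]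
  show "resilient_above f (in_nbrs E i) H (\<lambda>j. U j t $ l) (selected i t $ l)"
    and "resilient_above f (in_nbrs E i) H (\<lambda>j. - (U j t $ l)) (- (selected i t $ l))"
    unfolding selected_def by auto
qed

lemma correction_bound:
  assumes i: "i \<in> H" and t: "t \<in> I" and B: "\<And>j l. j \<in> H \<Longrightarrow> \<bar>U j t $ l\<bar> \<le> B"
  shows "norm (U i t - selected i t) \<le> real (CARD('n)) * (2 * B)"
proof -
  have "\<bar>(U i t - selected i t) $ l\<bar> \<le> 2 * B" for l
  proof -
    have "\<forall>j\<in>H. U j t $ l \<le> B" "\<forall>j\<in>H. - (U j t $ l) \<le> B"
      using B abs_le_iff by blast+
    then have "selected i t $ l \<le> B" "- (selected i t $ l) \<le> B"
      using selected_resilient[OF i t] unfolding resilient_above_def by blast+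
    then show ?thesis using B[OF i, of l] by simp
  qed
  then have "(\<Sum>l\<in>UNIV. \<bar>(U i t - selected i t) $ l\<bar>) \<le> (\<Sum>l\<in>(UNIV :: 'n set). 2 * B)"
    by (intro sum_mono)
  then show ?thesis
    using norm_le_l1_cart[of "U i t - selected i t"] by simp
qed

lemma mat_exp_uminus_has_vector_derivative:
  "((\<lambda>t. mat_exp ((- t) *\<^sub>R S)) has_vector_derivative - (S ** mat_exp ((- t) *\<^sub>R S))) (at t within A)"
proof -
  have "((\<lambda>t. - t) has_vector_derivative - 1) (at t within A)"
    by (auto intro!: derivative_eq_intros simp flip: has_real_derivative_iff_has_vector_derivative)
  from vector_diff_chain_within[OF this mat_exp_has_vector_derivative[OF S]]
  show ?thesis by (simp add: o_def)
qed

text \<open>Held values are values of the continuous \<open>W\<close> at earlier times of the same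
  compact interval, even if instants accumulate, and the selection stays within the bounds of the
  normal ones. Hence the correction is bounded, and with it \<open>d\<eta>\<close>.\<close>

lemma local_primitives:
  assumes i: "i \<in> H" and b: "b \<in> I"
  shows "bounded_primitive t0 b (\<eta> i) (d\<eta> i)"
    and "bounded_primitive t0 b (W i) (\<lambda>t. - \<mu> *\<^sub>R (U i t - selected i t))"
proof -
  note in_I = subsetD[OF Icc_subset_horizon[OF b]]
  have X: "continuous_on {t0..b} (\<lambda>t. mat_exp (c t *\<^sub>R S))" if "continuous_on {t0..b} c" for c
    using continuous_on_mat_exp[OF S that] .
  have "continuous_on {t0..b} (W j)" if "j \<in> H" for j
    unfolding W_def
    by (intro bounded_bilinear.continuous_on[OF bounded_bilinear_matrix_vector_mult] X \<eta>_continuous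
        that b continuous_intros)
  then have "bounded (\<Union>j\<in>H. W j ` {t0..b})"
    by (intro bounded_UN) (auto intro: compact_imp_bounded compact_continuous_image)
  then obtain B where B: "\<forall>x\<in>(\<Union>j\<in>H. W j ` {t0..b}). norm x \<le> B" by (auto simp: bounded_iff)
  have "\<bar>U j t $ l\<bar> \<le> B" if "j \<in> H" "t \<in> {t0..b}" for j t l
  proof -
    have "tlast j t \<in> {t0..b}" using tlast_bounds[OF that(1) in_I[OF that(2)]] that(2) by auto
    then have "norm (W j (tlast j t)) \<le> B" using B that(1) by blast
    then show ?thesis
      using component_le_norm_cart[of "U j t" l] U_eq[OF that(1) in_I[OF that(2)]] by simp
  qed
  then have "\<forall>t\<in>{t0..b}. norm (U i t - selected i t) \<le> real (CARD('n)) * (2 * B)"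
    using correction_bound[OF i in_I] by blast
  then have bnd: "bounded ((\<lambda>t. U i t - selected i t) ` {t0..b})" by (auto simp: bounded_iff)
  have Sl: "bounded_linear ((*v) S)" by simp
  have "bounded ((\<lambda>t. S *v \<eta> i t - \<mu> *\<^sub>R (mat_exp (t *\<^sub>R S) *v (U i t - selected i t))) ` {t0..b})"
    by (intro bounded_minus_comp bounded_scaleR_comp bounded_linear_comp[OF Sl] bnd
        bounded_bilinear_image[OF bounded_bilinear_matrix_vector_mult]
        compact_imp_bounded[OF compact_continuous_image] X \<eta>_continuous[OF i b] compact_Icc
        continuous_intros)
  moreover have "d\<eta> i ` {t0..b} = (\<lambda>t. S *v \<eta> i t - \<mu> *\<^sub>R (mat_exp (t *\<^sub>R S) *v (U i t - selected i t))) ` {t0..b}"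
    by (intro image_cong refl) (simp add: observer[OF i in_I] selected_def)
  ultimately show \<eta>p: "bounded_primitive t0 b (\<eta> i) (d\<eta> i)"
    using \<eta>[OF i] in_I by (auto simp: bounded_primitive_def caratheodory_deriv_def)
  have "bounded_primitive t0 b (\<lambda>t. mat_exp ((- t) *\<^sub>R S)) (\<lambda>t. - (S ** mat_exp ((- t) *\<^sub>R S)))"
  proof (rule bounded_primitive_vector_derivative[OF mat_exp_uminus_has_vector_derivative])
    have "bounded_linear (\<lambda>A. - (S ** A) :: real^'n^'n)"
      by (simp add: linear_conv_bounded_linear[symmetric] linear_iff vec_eq_iff
          matrix_matrix_mult_def sum.distrib sum_distrib_left algebra_simps)
    then show "bounded ((\<lambda>t. - (S ** mat_exp ((- t) *\<^sub>R S))) ` {t0..b})"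
      by (rule bounded_linear_comp)
        (intro compact_imp_bounded[OF compact_continuous_image] X compact_Icc continuous_intros)
  qed
  \<comment> \<open>In the product rule the two terms with \<open>S\<close> cancel because
    \<open>S\<close> commutes with its exponential; only the correction remains.\<close>
  from bounded_primitive_bilinear[OF bilinear_matrix_vector_mult this \<eta>p]
  show "bounded_primitive t0 b (W i) (\<lambda>t. - \<mu> *\<^sub>R (U i t - selected i t))"
  proof (rule bounded_primitive_cong)
    fix t assume "t \<in> {t0..b}"
    then have t: "t \<in> I" by (rule in_I)
    let ?X = "mat_exp ((- t) *\<^sub>R S)"
    have "- (S ** ?X) *v \<eta> i t = - (?X *v (S *v \<eta> i t))"
    proof -
      have "- A *v y = - (A *v y)" for A :: "real^'n^'n" and y
        by (simp add: vec_eq_iff matrix_vector_mult_def sum_negf)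
      then show ?thesis by (simp only: matrix_vector_mul_assoc mat_exp_commute[OF S])
    qed
    moreover have "?X *v d\<eta> i t = ?X *v (S *v \<eta> i t) - \<mu> *\<^sub>R (U i t - selected i t)"
      unfolding observer[OF i t] matrix_vector_mult_diff_distrib[of _ "S *v \<eta> i t"] matrix_vector_mult_scaleR
        mat_exp_cancel(2)[OF S] selected_def ..
    ultimately show "- \<mu> *\<^sub>R (U i t - selected i t) = - (S ** ?X) *v \<eta> i t + ?X *v d\<eta> i t" by simp
  qed (simp add: W_def)
qed

text \<open>A fixed choice rather than an obtained witness, because \<open>K\<close> has to appear
  in the parameters of the sublocale for the coordinates.\<close>

definition K :: real where
  "K = (SOME K. 0 < K \<and> (\<forall>t x. norm (mat_exp (t *\<^sub>R S) *v x) \<le> K * norm x))"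

lemma K: "0 < K" "norm (mat_exp (t *\<^sub>R S) *v x) \<le> K * norm x"
proof -
  have "\<exists>K. 0 < K \<and> (\<forall>t x. norm (mat_exp (t *\<^sub>R S) *v x) \<le> K * norm x)"
    using mat_exp_norm_bounded[OF S S_spectrum] by metis
  then have "0 < K \<and> (\<forall>t x. norm (mat_exp (t *\<^sub>R S) *v x) \<le> K * norm x)"
    unfolding K_def by (rule someI_ex)
  then show "0 < K" "norm (mat_exp (t *\<^sub>R S) *v x) \<le> K * norm x" by auto
qed

text \<open>Applied twice: with a bound up to \<open>t\<close> to get the error estimate at
  \<open>t\<close>, and with the uniform bound to exclude accumulation at the end of the
  horizon.\<close>

lemma finite_triggers_if_bounded_correction:
  assumes i: "i \<in> H" and D: "\<And>t. t \<in> I \<Longrightarrow> t \<le> b \<Longrightarrow> norm (U i t - selected i t) \<le> D"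
  shows "finite {k. trigger S \<theta> t0 T (\<eta> i) k \<le> ereal b}"
proof (rule event_trigger.finite_triggers[OF event_trigger[OF i] K])
  fix r t assume rt: "t0 \<le> r" "r \<le> t" "t \<le> b" "t \<in> I"
  have "norm (W i t - W i r) \<le> (\<mu> * D) * (t - r)"
  proof (rule bounded_primitive_norm_diff_le[OF local_primitives(2)[OF i rt(4)] rt(1,2) order_refl])
    fix s assume "s \<in> {r..t}"
    then have "s \<in> I" "s \<le> b" using Icc_subset_horizon[OF rt(4)] rt by auto
    then show "norm (- \<mu> *\<^sub>R (U i s - selected i s)) \<le> \<mu> * D"
      using D[of s] gains(1) by simp
  qed
  then show "norm (mat_exp ((- t) *\<^sub>R S) *v \<eta> i t - mat_exp ((- r) *\<^sub>R S) *v \<eta> i r) \<le> \<mu> * D * (t - r)"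
    by (simp only: W_def)
qed

text \<open>This breaks the circularity: the local bound \<open>L\<close> serves only to show that
  finitely many instants precede \<open>t\<close>, and it disappears from the estimate. The factor
  \<open>K\<close> comes from transforming the error to the auxiliary variable.\<close>

lemma U_close:
  assumes i: "i \<in> H" and t: "t \<in> I"
  shows "norm (U i t - W i t) \<le> K * \<theta> t"
proof -
  have in_I: "s \<in> {t0..t}" if "s \<in> I" "s \<le> t" for s using that by (simp add: horizon_def)
  obtain L where L: "\<forall>s\<in>{t0..t}. norm (- \<mu> *\<^sub>R (U i s - selected i s)) \<le> L"
    using local_primitives(2)[OF i t] unfolding bounded_primitive_def bounded_iff by blast
  have "norm (U i s - selected i s) \<le> L / \<mu>" if "s \<in> I" "s \<le> t" for s
    using L[rule_format, OF in_I[OF that]] gains(1) unfolding norm_scaleR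
    by (simp add: le_divide_eq mult.commute)
  then have "finite {k. trigger S \<theta> t0 T (\<eta> i) k \<le> ereal t}"
    by (rule finite_triggers_if_bounded_correction[OF i])
  then have err: "norm (open_loop S (\<eta> i (tlast i t), tlast i t) t - \<eta> i t) < \<theta> t"
    using event_trigger.err_last_trigger_less[OF event_trigger[OF i] t]
    unfolding event_trigger.err_def[OF event_trigger[OF i]] by blast
  have "U i t = mat_exp ((- t) *\<^sub>R S) *v open_loop S (\<eta> i (tlast i t), tlast i t) t"
    unfolding open_loop_def fst_conv snd_conv mat_exp_add_vector[OF S] U[OF i t] by simp
  then have "U i t - W i t = mat_exp ((- t) *\<^sub>R S) *v
      (open_loop S (\<eta> i (tlast i t), tlast i t) t - \<eta> i t)"
    by (simp only: W_def matrix_vector_mult_diff_distrib)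
  then have "norm (U i t - W i t) \<le> K * norm (open_loop S (\<eta> i (tlast i t), tlast i t) t - \<eta> i t)"
    by (simp only: K(2))
  also have "\<dots> \<le> K * \<theta> t" using err K(1) by simp
  finally show ?thesis .
qed

sublocale coord: consensus E f Byz H t0 T \<mu> "\<lambda>t. K * \<theta> t"
  "\<lambda>t. (2 * \<mu> * K) * threshold_primitive \<alpha>\<^sub>1 \<alpha>\<^sub>2 \<alpha>\<^sub>3 t0 t"
  "\<lambda>i t. W i t $ l" "\<lambda>i t. U i t $ l" "\<lambda>i t. selected i t $ l" for l
proof
  fix i b assume ib: "i \<in> H" "b \<in> I"
  from bounded_primitive_linear[OF local_primitives(2)[OF this] bounded_linear_vec_nth]
  show "bounded_primitive t0 b (\<lambda>t. W i t $ l) (\<lambda>t. - \<mu> * (U i t $ l - selected i t $ l))" by simp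
next
  fix i t assume it: "i \<in> H" "t \<in> I"
  show "\<bar>U i t $ l - W i t $ l\<bar> \<le> K * \<theta> t"
    using component_le_norm_cart[of "U i t - W i t" l] U_close[OF it] by simp
next
  fix b
  from bounded_primitive_linear[OF threshold_primitive[OF gains(2-4), of t0 b]
      bounded_linear_mult_right[of "2 * \<mu> * K"]]
  show "bounded_primitive t0 b (\<lambda>t. (2 * \<mu> * K) * threshold_primitive \<alpha>\<^sub>1 \<alpha>\<^sub>2 \<alpha>\<^sub>3 t0 t) (\<lambda>t. 2 * \<mu> * (K * \<theta> t))"
    by (simp add: mult.assoc)
next
  fix t
  show "(2 * \<mu> * K) * threshold_primitive \<alpha>\<^sub>1 \<alpha>\<^sub>2 \<alpha>\<^sub>3 t0 t \<le> 0"
    using threshold_primitive_nonpos[OF gains(2-4), of t0 t] gains K(1)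
    by (intro mult_nonneg_nonpos) auto
next
  show "((\<lambda>t. K * \<theta> t) \<longlongrightarrow> 0) at_top"
    using tendsto_mult_right_zero[OF threshold_limit[OF gains(2-4)]] .
  show "((\<lambda>t. (2 * \<mu> * K) * threshold_primitive \<alpha>\<^sub>1 \<alpha>\<^sub>2 \<alpha>\<^sub>3 t0 t) \<longlongrightarrow> 0) at_top"
    using tendsto_mult_right_zero[OF threshold_primitive_limit[OF gains(2-4)]] .
qed (use H attack robust gains selected_resilient in auto)

lemma W_bounded:
  obtains B where "\<And>i t l. i \<in> H \<Longrightarrow> t \<in> I \<Longrightarrow> \<bar>W i t $ l\<bar> \<le> B"
proof -
  have "\<forall>l. \<exists>B. \<forall>i\<in>H. \<forall>t\<in>I. \<bar>W i t $ l\<bar> \<le> B" using coord.bounded_data by metis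
  then obtain B where B: "\<forall>l. \<forall>i\<in>H. \<forall>t\<in>I. \<bar>W i t $ l\<bar> \<le> B l" by metis
  have "\<bar>W i t $ l\<bar> \<le> Max (range B)" if "i \<in> H" "t \<in> I" for i t l
    using B that Max_ge[of "range B" "B l"] by (force intro: order_trans)
  then show ?thesis using that by blast
qed

lemma correction_bounded:
  obtains D where "\<And>i t. i \<in> H \<Longrightarrow> t \<in> I \<Longrightarrow> norm (U i t - selected i t) \<le> D"
proof -
  obtain B where B: "\<And>i t l. i \<in> H \<Longrightarrow> t \<in> I \<Longrightarrow> \<bar>W i t $ l\<bar> \<le> B" using W_bounded by blast
  have "\<bar>U i t $ l\<bar> \<le> B" if "i \<in> H" "t \<in> I" for i t l
    using B[OF that(1) tlast_in[OF that]] U_eq[OF that] by simp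
  then have "norm (U i t - selected i t) \<le> real (CARD('n)) * (2 * B)" if "i \<in> H" "t \<in> I" for i t
    using correction_bound that by blast
  then show ?thesis using that by blast
qed

text \<open>Local bounds would not do here: with a finite \<open>T\<close> and
  \<open>b \<ge> T\<close> the instants could accumulate at \<open>T\<close>. The correction bound
  obtained from the consensus estimates is uniform on the horizon.\<close>

lemma no_zeno: "i \<in> H \<Longrightarrow> finite {k. trigger S \<theta> t0 T (\<eta> i) k \<le> ereal b}"
  using correction_bounded finite_triggers_if_bounded_correction by metis

lemma \<eta>_bounded:
  assumes i: "i \<in> H"
  shows "bounded (\<eta> i ` I)"
proof -
  obtain B where B: "\<And>i t l. i \<in> H \<Longrightarrow> t \<in> I \<Longrightarrow> \<bar>W i t $ l\<bar> \<le> B" using W_bounded by blast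
  have "norm (\<eta> i t) \<le> K * (real (CARD('n)) * B)" if t: "t \<in> I" for t
  proof -
    have "norm (W i t) \<le> (\<Sum>l\<in>UNIV. \<bar>W i t $ l\<bar>)" by (rule norm_le_l1_cart)
    also have "\<dots> \<le> (\<Sum>l\<in>(UNIV :: 'n set). B)" by (intro sum_mono B i t)
    finally have "norm (W i t) \<le> real (CARD('n)) * B" by simp
    then have "K * norm (W i t) \<le> K * (real (CARD('n)) * B)" using K(1) by simp
    then show ?thesis unfolding \<eta>_eq[of i t] by (rule order_trans[OF K(2)])
  qed
  then show ?thesis by (auto simp: bounded_iff)
qed

lemma deviation_eq:
  "i \<in> H \<Longrightarrow> t \<in> I \<Longrightarrow> d\<eta> i t - S *v \<eta> i t = - \<mu> *\<^sub>R (mat_exp (t *\<^sub>R S) *v (U i t - selected i t))"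
  by (simp add: observer selected_def)

lemma deviation_le:
  assumes "i \<in> H" "t \<in> I"
  shows "norm (d\<eta> i t - S *v \<eta> i t) \<le> \<mu> * K * norm (U i t - selected i t)"
  using mult_left_mono[OF K(2)[of t "U i t - selected i t"], of \<mu>] gains(1)
  by (simp add: deviation_eq[OF assms] mult.assoc)

lemma deviation_bounded:
  assumes i: "i \<in> H"
  shows "bounded ((\<lambda>t. d\<eta> i t - S *v \<eta> i t) ` I)"
proof -
  obtain D where D: "\<And>i t. i \<in> H \<Longrightarrow> t \<in> I \<Longrightarrow> norm (U i t - selected i t) \<le> D"
    using correction_bounded by blast
  have "norm (d\<eta> i t - S *v \<eta> i t) \<le> \<mu> * K * D" if t: "t \<in> I" for t
    by (rule order_trans[OF deviation_le[OF i t] mult_left_mono[OF D[OF i t]]])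
      (use gains(1) K(1) in simp)
  then show ?thesis by (auto simp: bounded_iff)
qed

lemma coordinates_tendsto:
  assumes T: "T = \<infinity>" and ij: "i \<in> H" "j \<in> H"
  shows "((\<lambda>t. W j t - W i t) \<longlongrightarrow> 0) at_top" "((\<lambda>t. U i t - selected i t) \<longlongrightarrow> 0) at_top"
proof -
  have ev: "\<forall>\<^sub>F t in at_top. \<forall>i\<in>H. (\<forall>j\<in>H. \<bar>W i t $ l - W j t $ l\<bar> < e) \<and>
      \<bar>U i t $ l - selected i t $ l\<bar> < e" if "0 < e" for e l
    using coord.eventually_close[OF T that] .
  have "((\<lambda>t. (W j t - W i t) $ l) \<longlongrightarrow> 0 $ l) at_top" for l
  proof (rule tendstoI)
    fix e :: real assume "0 < e"
    from ev[OF this, of l] show "\<forall>\<^sub>F t in at_top. dist ((W j t - W i t) $ l) (0 $ l) < e"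
      by (rule eventually_mono) (use ij in \<open>auto simp: dist_real_def\<close>)
  qed
  then show "((\<lambda>t. W j t - W i t) \<longlongrightarrow> 0) at_top" by (rule vec_tendstoI)
  have "((\<lambda>t. (U i t - selected i t) $ l) \<longlongrightarrow> 0 $ l) at_top" for l
  proof (rule tendstoI)
    fix e :: real assume "0 < e"
    from ev[OF this, of l] show "\<forall>\<^sub>F t in at_top. dist ((U i t - selected i t) $ l) (0 $ l) < e"
      by (rule eventually_mono) (use ij in \<open>auto simp: dist_real_def\<close>)
  qed
  then show "((\<lambda>t. U i t - selected i t) \<longlongrightarrow> 0) at_top" by (rule vec_tendstoI)
qed

lemma \<eta>_consensus:
  assumes T: "T = \<infinity>" and ij: "i \<in> H" "j \<in> H"
  shows "((\<lambda>t. \<eta> j t - \<eta> i t) \<longlongrightarrow> 0) at_top"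
proof (rule Lim_null_comparison)
  show "\<forall>\<^sub>F t in at_top. norm (\<eta> j t - \<eta> i t) \<le> K * norm (W j t - W i t)"
  proof (rule always_eventually, rule allI)
    fix t
    have "\<eta> j t - \<eta> i t = mat_exp (t *\<^sub>R S) *v (W j t - W i t)"
      by (simp only: \<eta>_eq[of j t] \<eta>_eq[of i t] matrix_vector_mult_diff_distrib)
    then show "norm (\<eta> j t - \<eta> i t) \<le> K * norm (W j t - W i t)" using K(2) by simp
  qed
  show "((\<lambda>t. K * norm (W j t - W i t)) \<longlongrightarrow> 0) at_top"
    by (intro tendsto_mult_right_zero tendsto_norm_zero coordinates_tendsto T ij)
qed

lemma deviation_tendsto:
  assumes T: "T = \<infinity>" and i: "i \<in> H"
  shows "((\<lambda>t. d\<eta> i t - S *v \<eta> i t) \<longlongrightarrow> 0) at_top"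
proof (rule Lim_null_comparison)
  show "\<forall>\<^sub>F t in at_top. norm (d\<eta> i t - S *v \<eta> i t) \<le> \<mu> * K * norm (U i t - selected i t)"
    using eventually_ge_at_top[of t0]
  proof (rule eventually_mono)
    fix t assume "t0 \<le> t"
    then have "t \<in> I" by (simp add: horizon_def T)
    then show "norm (d\<eta> i t - S *v \<eta> i t) \<le> \<mu> * K * norm (U i t - selected i t)"
      by (rule deviation_le[OF i])
  qed
  show "((\<lambda>t. \<mu> * K * norm (U i t - selected i t)) \<longlongrightarrow> 0) at_top"
    by (intro tendsto_mult_right_zero tendsto_norm_zero coordinates_tendsto(2)[OF T i i])
qed

end

theorem theorem3p1:
  fixes E :: "('v::finite \<times> 'v) set"
    and f :: nat
    and Byz H :: "'v set"
    and S :: "real^'n^'n"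
    and M :: "'v \<Rightarrow> real^'n \<Rightarrow> real^'n^'n"
    and C :: "'v \<Rightarrow> real^'n \<Rightarrow> real^'n \<Rightarrow> real^'n^'n"
    and g :: "'v \<Rightarrow> real^'n \<Rightarrow> real^'n"
    and \<Omega> :: "'v \<Rightarrow> real^'n \<Rightarrow> real^'n \<Rightarrow> real^'n \<Rightarrow> real^'n \<Rightarrow> real^'l^'n"
    and \<mu>\<^sub>1 \<mu>\<^sub>2 \<alpha>\<^sub>1 \<alpha>\<^sub>2 \<alpha>\<^sub>3 :: real
    and k F :: "'v \<Rightarrow> real"
    and t0 :: real and T :: ereal
    and q dq ddq \<eta> d\<eta> \<eta>_hat \<eta>_bar v dv s \<tau> :: "'v \<Rightarrow> real \<Rightarrow> real^'n"
    and \<phi>_hat d\<phi>_hat :: "'v \<Rightarrow> real \<Rightarrow> real^'l"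
    and trig :: "'v \<Rightarrow> nat \<Rightarrow> ereal"
    and tlast :: "'v \<Rightarrow> real \<Rightarrow> real"
    and store :: "'v \<Rightarrow> 'v \<Rightarrow> real \<Rightarrow> (real^'n) \<times> real"
  assumes H: "H = UNIV - Byz"
    and attack: "f_local E f Byz"
    and robust: "r_robust E (2 * f + 1)"
    and S_semisimple: "semisimple_matrix S"
    and S_spectrum: "\<forall>z. complex_eigenvalue S z \<longrightarrow> Re z = 0"
    and EL: "\<forall>i. euler_lagrange (M i) (C i) (g i) (\<Omega> i)"
    and gains: "\<mu>\<^sub>1 > 0" "\<alpha>\<^sub>1 > 0" "\<alpha>\<^sub>2 > 1" "\<alpha>\<^sub>3 > 1" "\<mu>\<^sub>2 > 0"
      "\<forall>i\<in>H. k i > 0 \<and> F i > 0 \<and> k i * \<mu>\<^sub>2 > 1 / 2"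
    and T: "ereal t0 < T"
    \<comment> \<open>plant\<close>
    and q: "\<forall>i\<in>H. \<forall>t\<in>horizon t0 T. (q i has_vector_derivative dq i t) (at t within horizon t0 T)"
    and dq: "\<forall>i\<in>H. caratheodory_deriv t0 T (dq i) (ddq i)"
    and plant: "\<forall>i\<in>H. \<forall>t\<in>horizon t0 T.
      M i (q i t) *v ddq i t + C i (q i t) (dq i t) *v dq i t + g i (q i t) = \<tau> i t"
    \<comment> \<open>event-triggered scheme\<close>
    and trig: "\<forall>i\<in>H. trig i = trigger S (threshold \<alpha>\<^sub>1 \<alpha>\<^sub>2 \<alpha>\<^sub>3 t0) t0 T (\<eta> i)"
    and tlast: "\<forall>i\<in>H. tlast i = last_trigger S (threshold \<alpha>\<^sub>1 \<alpha>\<^sub>2 \<alpha>\<^sub>3 t0) t0 T (\<eta> i)"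
    \<comment> \<open>storage; entries for Byzantine in-neighbors are arbitrary\<close>
    and store: "\<forall>i\<in>H. \<forall>j\<in>in_nbrs E i \<inter> H. \<forall>t\<in>horizon t0 T.
      store i j t = (\<eta> j (tlast j t), tlast j t)"
    \<comment> \<open>observer and AVBRD\<close>
    and \<eta>: "\<forall>i\<in>H. caratheodory_deriv t0 T (\<eta> i) (d\<eta> i)"
    and observer: "\<forall>i\<in>H. \<forall>t\<in>horizon t0 T.
      d\<eta> i t = S *v \<eta> i t - \<mu>\<^sub>1 *\<^sub>R (\<eta>_hat i t - \<eta>_bar i t)"
    and \<eta>_hat: "\<forall>i\<in>H. \<forall>t\<in>horizon t0 T.
      \<eta>_hat i t = open_loop S (\<eta> i (tlast i t), tlast i t) t"
    and \<eta>_bar: "\<forall>i\<in>H. \<forall>t\<in>horizon t0 T.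
      \<eta>_bar i t = mat_exp (t *\<^sub>R S) *v
        avbrd f (in_nbrs E i) (mat_exp ((- t) *\<^sub>R S) *v \<eta>_hat i t)
          (\<lambda>j. mat_exp ((- t) *\<^sub>R S) *v open_loop S (store i j t) t)"
    \<comment> \<open>control law\<close>
    and v: "\<forall>i\<in>H. \<forall>t\<in>horizon t0 T. v i t = S *v \<eta> i t - \<mu>\<^sub>2 *\<^sub>R (q i t - \<eta> i t)"
    and dv: "\<forall>i\<in>H. \<forall>t\<in>horizon t0 T. dv i t = S *v d\<eta> i t - \<mu>\<^sub>2 *\<^sub>R (dq i t - d\<eta> i t)"
    and s: "\<forall>i\<in>H. \<forall>t\<in>horizon t0 T. s i t = dq i t - v i t"
    and \<tau>: "\<forall>i\<in>H. \<forall>t\<in>horizon t0 T.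
      \<tau> i t = - k i *\<^sub>R s i t + \<Omega> i (q i t) (dq i t) (dv i t) (v i t) *v \<phi>_hat i t"
    and \<phi>_hat: "\<forall>i\<in>H. caratheodory_deriv t0 T (\<phi>_hat i) (d\<phi>_hat i)"
    and adaptation: "\<forall>i\<in>H. \<forall>t\<in>horizon t0 T.
      d\<phi>_hat i t = - F i *\<^sub>R (transpose (\<Omega> i (q i t) (dq i t) (dv i t) (v i t)) *v s i t)"
  shows "(T = \<infinity> \<longrightarrow>
            (\<forall>i\<in>H. \<forall>j\<in>H. ((\<lambda>t. q j t - q i t) \<longlongrightarrow> 0) at_top \<and>
                            ((\<lambda>t. dq j t - dq i t) \<longlongrightarrow> 0) at_top))
       \<and> (\<forall>i\<in>H. bounded (q i ` horizon t0 T) \<and> bounded (dq i ` horizon t0 T))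
       \<and> (\<forall>i\<in>H. \<forall>b::real. finite {m. trig i m \<le> ereal b})"
proof -
  \<comment> \<open>The exponentials of the open-loop estimate and of the change of variable
    combine, so the held value depends on \<open>t\<close> only through the latest instant.\<close>
  define U where "U i t = mat_exp ((- tlast i t) *\<^sub>R S) *v \<eta> i (tlast i t)" for i t
  define data where "data i t j = mat_exp ((- t) *\<^sub>R S) *v open_loop S (store i j t) t" for i t j
  have estimate: "mat_exp ((- t) *\<^sub>R S) *v open_loop S (\<eta> i (tlast i t), tlast i t) t = U i t" for i t
    unfolding open_loop_def fst_conv snd_conv mat_exp_add_vector[OF S_semisimple] U_def by simp
  have hat: "\<eta>_hat i t = mat_exp (t *\<^sub>R S) *v U i t" if "i \<in> H" "t \<in> horizon t0 T" for i t
    using \<eta>_hat that unfolding estimate[of t i, symmetric] mat_exp_cancel(1)[OF S_semisimple] by blast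
  interpret net: observer_network E f Byz H S \<mu>\<^sub>1 \<alpha>\<^sub>1 \<alpha>\<^sub>2 \<alpha>\<^sub>3 t0 T \<eta> d\<eta> U data
  proof
    fix i t assume i: "i \<in> H" and t: "t \<in> horizon t0 T"
    show "U i t = mat_exp ((- last_trigger S (threshold \<alpha>\<^sub>1 \<alpha>\<^sub>2 \<alpha>\<^sub>3 t0) t0 T (\<eta> i) t) *\<^sub>R S) *v
        \<eta> i (last_trigger S (threshold \<alpha>\<^sub>1 \<alpha>\<^sub>2 \<alpha>\<^sub>3 t0) t0 T (\<eta> i) t)"
      using tlast i by (simp add: U_def)
    have "\<eta>_bar i t = mat_exp (t *\<^sub>R S) *v avbrd f (in_nbrs E i) (U i t) (data i t)"
      using \<eta>_bar i t mat_exp_cancel(2)[OF S_semisimple, of t "U i t"] unfolding data_def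
      by (simp add: hat[OF i t])
    then have "\<eta>_hat i t - \<eta>_bar i t
        = mat_exp (t *\<^sub>R S) *v (U i t - avbrd f (in_nbrs E i) (U i t) (data i t))"
      by (simp add: hat[OF i t] matrix_vector_mult_diff_distrib)
    then show "d\<eta> i t = S *v \<eta> i t - \<mu>\<^sub>1 *\<^sub>R
        (mat_exp (t *\<^sub>R S) *v (U i t - avbrd f (in_nbrs E i) (U i t) (data i t)))"
      using observer i t by simp
    fix j assume "j \<in> in_nbrs E i \<inter> H"
    then have "store i j t = (\<eta> j (tlast j t), tlast j t)" using store i t by blast
    then show "data i t j = U j t" unfolding data_def by (simp only: estimate)
  qed (use H attack robust S_semisimple S_spectrum gains T \<eta> in auto)
  \<comment> \<open>The model only asserts that parameters exist; one vector per agent is fixed for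
    the Lyapunov function.\<close>
  have "\<forall>i. \<exists>\<phi>. \<forall>x dx y z. M i x *v y + C i x dx *v z + g i x = \<Omega> i x dx y z *v \<phi>"
    using EL unfolding euler_lagrange_def by blast
  then obtain \<phi> where \<phi>: "\<forall>i x dx y z. M i x *v y + C i x dx *v z + g i x = \<Omega> i x dx y z *v \<phi> i"
    by metis
  have agent: "el_tracking (M i) (C i) (g i) (\<Omega> i) (\<phi> i) S \<mu>\<^sub>2 (k i) (F i) t0 T (q i) (dq i) (ddq i)
      (\<eta> i) (d\<eta> i) (v i) (dv i) (s i) (\<tau> i) (\<phi>_hat i) (d\<phi>_hat i)" if i: "i \<in> H" for i
  proof
    show "euler_lagrange (M i) (C i) (g i) (\<Omega> i)" using EL by blast
    show "bounded (\<eta> i ` horizon t0 T)" by (rule net.\<eta>_bounded[OF i])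
    show "bounded ((\<lambda>t. d\<eta> i t - S *v \<eta> i t) ` horizon t0 T)" by (rule net.deviation_bounded[OF i])
    show "bounded_primitive t0 b (\<eta> i) (d\<eta> i)" if "b \<in> horizon t0 T" for b
      by (rule net.local_primitives(1)[OF i that])
  qed (use i \<phi> gains q dq plant v dv s \<tau> \<phi>_hat adaptation in auto)
  have consensus: "((\<lambda>t. q j t - q i t) \<longlongrightarrow> 0) at_top \<and> ((\<lambda>t. dq j t - dq i t) \<longlongrightarrow> 0) at_top"
    if inf: "T = \<infinity>" and ij: "i \<in> H" "j \<in> H" for i j
  proof
    have r: "((\<lambda>t. q i t - \<eta> i t) \<longlongrightarrow> 0) at_top" if "i \<in> H" for i
      by (rule el_tracking.q_minus_\<eta>_tendsto_zero[OF agent[OF that] inf net.deviation_tendsto[OF inf that]])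
    have s0: "(s i \<longlongrightarrow> 0) at_top" if "i \<in> H" for i
      by (rule el_tracking.s_tendsto_zero[OF agent[OF that] inf])
    have \<eta>0: "((\<lambda>t. \<eta> j t - \<eta> i t) \<longlongrightarrow> 0) at_top" by (rule net.\<eta>_consensus[OF inf ij])
    have r0: "((\<lambda>t. (q j t - \<eta> j t) - (q i t - \<eta> i t)) \<longlongrightarrow> 0 - 0) at_top"
      by (intro tendsto_diff r ij)
    have "((\<lambda>t. ((q j t - \<eta> j t) - (q i t - \<eta> i t)) + (\<eta> j t - \<eta> i t)) \<longlongrightarrow> (0 - 0) + 0) at_top"
      by (intro tendsto_add r0 \<eta>0)
    then show "((\<lambda>t. q j t - q i t) \<longlongrightarrow> 0) at_top" by (simp add: algebra_simps)
    \<comment> \<open>Since \<open>dq\<close> is \<open>s\<close> plus \<open>v\<close>, the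
      velocity difference is a fixed linear combination of differences that are already known to
      vanish.\<close>
    have lim: "((\<lambda>t. (s j t - s i t) + (S *v (\<eta> j t - \<eta> i t)
        - \<mu>\<^sub>2 *\<^sub>R ((q j t - \<eta> j t) - (q i t - \<eta> i t)))) \<longlongrightarrow> (0 - 0) + (S *v 0 - \<mu>\<^sub>2 *\<^sub>R (0 - 0))) at_top"
      by (intro tendsto_add tendsto_diff tendsto_scaleR tendsto_const s0 r0 ij \<eta>0
          bounded_linear.tendsto[OF matrix_vector_mul_bounded_linear] r)
    have eq: "(s j t - s i t) + (S *v (\<eta> j t - \<eta> i t)
        - \<mu>\<^sub>2 *\<^sub>R ((q j t - \<eta> j t) - (q i t - \<eta> i t))) = dq j t - dq i t" if "t0 \<le> t" for t
    proof -
      have "t \<in> horizon t0 T" using that by (simp add: horizon_def inf)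
      then show ?thesis
        using s v ij by (simp add: matrix_vector_mult_diff_distrib scaleR_diff_right)
    qed
    show "((\<lambda>t. dq j t - dq i t) \<longlongrightarrow> 0) at_top"
      using Lim_transform_eventually[OF lim eventually_mono[OF eventually_ge_at_top[of t0] eq]] by simp
  qed
  have "bounded (q i ` horizon t0 T) \<and> bounded (dq i ` horizon t0 T)" if "i \<in> H" for i
    using el_tracking.q_bounded[OF agent[OF that]] el_tracking.dq_bounded[OF agent[OF that]] by blast
  moreover have "finite {m. trig i m \<le> ereal b}" if "i \<in> H" for i b
    using net.no_zeno[OF that] trig that by simp
  ultimately show ?thesis using consensus by blast
qed

end
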